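(* Let $F(x),G(x)$ be two de Branges GAFs (possibly associated with different de Branges spaces) and let $\rho_1^{F}(x),\rho_1^{G}(x)$ be their respective first intensity functions. If $$\rho_1^{F}(x)=\rho_1^{G}(x)\quad\text{for all } x\in\mathbb{R},$$ then there exists a non-random analytic function $S(z)$, which does not vanish anywhere, such that $(S(x)F(x))_{x\in\mathbb{R}}$ and $(G(x))_{x\in\mathbb{R}}$ have the same distribution. In particular, the random processes given by the real zeros of $F(x)$ and of $G(x)$ have the same distribution.
   Context: Hermite-Biehler function: an entire function $E$ with $|E(z)|>|E^*(z)|$ for $\operatorname{Im} z>0$, where $f^*(z)=\overline{f(\bar z)}$. All Hermite-Biehler functions considered have no real zeros. De Branges space: $H(E)=\{f\text{ entire}: f/E,\ f^*/E\in H^2(\mathbb{C}_+)\}$, where $H^2(\mathbb{C}_+)$ is the Hardy space of the upper half-plane, with norm $\|f\|_{H(E)}^2=\int_{-\infty}^{\infty}|f(x)/E(x)|^2\,dx$. It is a Hilbert space with reproducing kernel $$K(z,w)=\frac{i}{2\pi}\,\frac{E(z)\overline{E(w)}-E^*(z)\overline{E^*(w)}}{z-\overline{w}}.$$ Phase function: a smooth increasing function $\phi:\mathbb{R}\to\mathbb{R}$ with $E(x)=|E(x)|e^{-i\phi(x)}$ for $x\in\mathbb{R}$; it satisfies $\phi'>0$ and $K(x,x)=\frac1\pi\phi'(x)|E(x)|^2$. Normalized reproducing kernels: for $x,y\in\mathbb{R}$, $k_y(x)=\frac{K(x,y)}{K(y,y)^{1/2}}=\frac{|E(x)|}{\sqrt{\pi\phi'(y)}}\frac{\sin(\phi(x)-\phi(y))}{x-y}$.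 Orthonormal basis of reproducing kernels: a family $\{k_{\omega_n}\}$ which is an orthonormal basis of $H(E)$, where, for some $\alpha\in[0,\pi)$, $\{\omega_n\}$ consists of all real points with $\phi(\omega_n)=\alpha+\pi n$, $n\in\mathbb{Z}$ (only those $n$ for which such a point exists). By a theorem of de Branges, for all $\alpha\in[0,\pi)$ except at most one this family is an orthonormal basis. De Branges GAF: $F(x)=\sum_n a_n k_{\omega_n}(x)$, where the $a_n$ are i.i.d. real standard normal random variables and $\{k_{\omega_n}\}$ is such an orthonormal basis of some de Branges space $H(E)$. The series converges almost surely uniformly on compact subsets of $\mathbb{C}$, and $\mathbb{E}[F(x)F(y)]=K(x,y)$ for real $x,y$. First intensity function (with respect to Lebesgue measure): the function $\rho_1\ge 0$ on $\mathbb{R}$ with $\mathbb{E}[\#(Z_{\mathbb{R}}(F)\cap D)]=\int_D\rho_1(x)\,dx$ for all Borel sets $D\subset\mathbb{R}$, where $Z_{\mathbb{R}}(F)$ is the set of real zeros of $F$ (pointwise statements refer to the continuous version of this density). *)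

theory Defs
  imports "HOL-Complex_Analysis.Complex_Analysis" "HOL-Probability.Probability"
begin

section \<open>De Branges spaces\<close>

definition conj_reflect :: "(complex \<Rightarrow> complex) \<Rightarrow> complex \<Rightarrow> complex" where
  "conj_reflect f z = cnj (f (cnj z))"

text \<open>As usual in this context, the absence of real zeros is part of the definition.\<close>

definition hermite_biehler :: "(complex \<Rightarrow> complex) \<Rightarrow> bool" where
  "hermite_biehler E \<longleftrightarrow>
     E holomorphic_on UNIV \<and>
     (\<forall>z. Im z > 0 \<longrightarrow> cmod (E z) > cmod (conj_reflect E z)) \<and>
     (\<forall>x::real. E (of_real x) \<noteq> 0)"

definition hardy2_upper :: "(complex \<Rightarrow> complex) set" where
  "hardy2_upper =
     {f. f holomorphic_on {z. Im z > 0} \<and>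
         (SUP y\<in>{0<..}. \<integral>\<^sup>+x. ennreal ((cmod (f (Complex x y)))\<^sup>2) \<partial>lborel) < \<infinity>}"

definition de_branges_space :: "(complex \<Rightarrow> complex) \<Rightarrow> (complex \<Rightarrow> complex) set" where
  "de_branges_space E =
     {f. f holomorphic_on UNIV \<and>
         (\<lambda>z. f z / E z) \<in> hardy2_upper \<and>
         (\<lambda>z. conj_reflect f z / E z) \<in> hardy2_upper}"

definition db_norm :: "(complex \<Rightarrow> complex) \<Rightarrow> (complex \<Rightarrow> complex) \<Rightarrow> real" where
  "db_norm E f = sqrt (LINT x|lborel. (cmod (f (of_real x) / E (of_real x)))\<^sup>2)"

definition db_inner ::
  "(complex \<Rightarrow> complex) \<Rightarrow> (complex \<Rightarrow> complex) \<Rightarrow> (complex \<Rightarrow> complex) \<Rightarrow> complex" where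
  "db_inner E f g =
     (LINT x|lborel. (f (of_real x) / E (of_real x)) * cnj (g (of_real x) / E (of_real x)))"

text \<open>
  The numerator of the kernel vanishes at \<open>z = cnj w\<close>, so the quotient has a removable
  singularity there; its value is the derivative of the numerator in \<open>z\<close>.
\<close>

definition db_kernel :: "(complex \<Rightarrow> complex) \<Rightarrow> complex \<Rightarrow> complex \<Rightarrow> complex" where
  "db_kernel E z w =
     (let num = (\<lambda>u. E u * cnj (E w) - conj_reflect E u * cnj (conj_reflect E w))
      in \<i> / (2 * of_real pi) *
         (if z = cnj w then deriv num z else num z / (z - cnj w)))"

text \<open>For real \<open>y\<close> the number \<open>K(y,y)\<close> is real and positive.\<close>

definition db_normalized_kernel :: "(complex \<Rightarrow> complex) \<Rightarrow> real \<Rightarrow> complex \<Rightarrow> complex" where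
  "db_normalized_kernel E y z =
     db_kernel E z (of_real y) / of_real (sqrt (Re (db_kernel E (of_real y) (of_real y))))"

definition phase_function :: "(complex \<Rightarrow> complex) \<Rightarrow> (real \<Rightarrow> real) \<Rightarrow> bool" where
  "phase_function E \<phi> \<longleftrightarrow>
     (\<forall>n. ((deriv ^^ n) \<phi>) differentiable_on UNIV) \<and>
     strict_mono \<phi> \<and>
     (\<forall>x. E (of_real x) = of_real (cmod (E (of_real x))) * exp (- \<i> * of_real (\<phi> x)))"

definition phase_indices :: "(real \<Rightarrow> real) \<Rightarrow> real \<Rightarrow> int set" where
  "phase_indices \<phi> \<alpha> = {n. \<exists>x. \<phi> x = \<alpha> + pi * of_int n}"

definition phase_point :: "(real \<Rightarrow> real) \<Rightarrow> real \<Rightarrow> int \<Rightarrow> real" where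
  "phase_point \<phi> \<alpha> n = (THE x. \<phi> x = \<alpha> + pi * of_int n)"

definition db_orthonormal_basis ::
  "(complex \<Rightarrow> complex) \<Rightarrow> 'i set \<Rightarrow> ('i \<Rightarrow> complex \<Rightarrow> complex) \<Rightarrow> bool" where
  "db_orthonormal_basis E J e \<longleftrightarrow>
     (\<forall>n\<in>J. e n \<in> de_branges_space E) \<and>
     (\<forall>m\<in>J. \<forall>n\<in>J. db_inner E (e m) (e n) = (if m = n then 1 else 0)) \<and>
     (\<forall>f\<in>de_branges_space E. \<forall>\<epsilon>>0. \<exists>T c. finite T \<and> T \<subseteq> J \<and>
        db_norm E (\<lambda>z. f z - (\<Sum>n\<in>T. c n * e n z)) < \<epsilon>)"


section \<open>Gaussian analytic functions, their zeros and first intensity\<close>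

text \<open>
  A de Branges GAF is a random entire function that is almost surely the locally uniform sum
  of the series. The series is in general only conditionally convergent, so the order of
  summation is fixed by taking the partial sums over the indices in \<open>{-N..N}\<close>; another
  order would change the sum only on a null set.
\<close>

definition de_branges_GAF :: "'a measure \<Rightarrow> ('a \<Rightarrow> complex \<Rightarrow> complex) \<Rightarrow> bool" where
  "de_branges_GAF M F \<longleftrightarrow>
     prob_space M \<and>
     (\<forall>z. (\<lambda>\<xi>. F \<xi> z) \<in> borel_measurable M) \<and>
     (\<forall>\<xi>\<in>space M. F \<xi> holomorphic_on UNIV) \<and>
     (\<exists>E \<phi> \<alpha> a.
        let J = phase_indices \<phi> \<alpha>;
            k = (\<lambda>n. db_normalized_kernel E (phase_point \<phi> \<alpha> n))
        in hermite_biehler E \<and> phase_function E \<phi> \<and> 0 \<le> \<alpha> \<and> \<alpha> < pi \<and>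
           db_orthonormal_basis E J k \<and>
           prob_space.indep_vars M (\<lambda>_. borel) a J \<and>
           (\<forall>n\<in>J. distributed M lborel (a n) (\<lambda>x. ennreal (std_normal_density x))) \<and>
           (AE \<xi> in M. \<forall>C. compact C \<longrightarrow>
              uniform_limit C
                (\<lambda>N z. \<Sum>n\<in>{n\<in>J. \<bar>n\<bar> \<le> int N}. of_real (a n \<xi>) * k n z)
                (F \<xi>) sequentially))"

definition real_zeros :: "(complex \<Rightarrow> complex) \<Rightarrow> real set" where
  "real_zeros f = {x. f (of_real x) = 0}"

definition zero_count :: "(complex \<Rightarrow> complex) \<Rightarrow> real set \<Rightarrow> ennreal" where
  "zero_count f D = emeasure (count_space UNIV) (real_zeros f \<inter> D)"

text \<open>Continuity singles out the version of the density to which pointwise statements refer.\<close>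

definition first_intensity ::
  "'a measure \<Rightarrow> ('a \<Rightarrow> complex \<Rightarrow> complex) \<Rightarrow> (real \<Rightarrow> real) \<Rightarrow> bool" where
  "first_intensity M F \<rho> \<longleftrightarrow>
     (\<forall>x. 0 \<le> \<rho> x) \<and> continuous_on UNIV \<rho> \<and>
     (\<forall>D\<in>sets borel. (\<integral>\<^sup>+\<xi>. zero_count (F \<xi>) D \<partial>M) = (\<integral>\<^sup>+x\<in>D. ennreal (\<rho> x) \<partial>lborel))"

text \<open>
  Measurability is demanded explicitly because \<^const>\<open>distr\<close> is total and meaningless
  for non-measurable maps.
\<close>

definition same_distribution ::
  "'c measure \<Rightarrow> 'a measure \<Rightarrow> ('a \<Rightarrow> 'c) \<Rightarrow> 'b measure \<Rightarrow> ('b \<Rightarrow> 'c) \<Rightarrow> bool" where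
  "same_distribution K M X N Y \<longleftrightarrow>
     X \<in> measurable M K \<and> Y \<in> measurable N K \<and> distr M K X = distr N K Y"

text \<open>
  The zero set as a point process: the family of its counting variables, indexed by the
  Borel sets.
\<close>

definition zero_process :: "('a \<Rightarrow> complex \<Rightarrow> complex) \<Rightarrow> 'a \<Rightarrow> real set \<Rightarrow> ennreal" where
  "zero_process F \<xi> = (\<lambda>D\<in>sets borel. zero_count (F \<xi>) D)"

end

theory Submission
  imports Defs
begin

text \<open>
  Let \<open>F\<close> be a de Branges GAF. Each basis kernel has the form \<open>k_n z = c_n s z / (z - w_n)\<close>, where \<open>s\<close> is one
  real entire function whose zeros are exactly the real points \<open>w_n\<close>, all of them simple. Partial
  fractions therefore put the covariance \<open>C x y = (\<Sum>n. k_n x * k_n y)\<close> into the form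
  \<open>(U x V y - V x U y) / (x - y)\<close> with real entire functions \<open>U\<close>, \<open>V\<close> that have no common zero
  (\<open>kernel_is_pair_kernel\<close>). The sum converges because the random series converges almost surely
  (\<open>gaussian_series_char\<close>).

  The intensity is computed by a Kac-Rice argument. A centred Gaussian pair has opposite signs with
  probability \<open>\<theta> / pi\<close>, where \<open>\<theta>\<close> is the angle between the two variables, and almost surely all real
  zeros are simple, so that zeros are counted by sign changes along fine grids. Hence \<open>pi * \<rho> x\<close> is the
  speed, at \<open>x\<close>, of the curve that the normalized kernels trace on the unit sphere
  (\<open>first_intensity_eq_speed\<close>). Up to a constant factor the square \<open>q\<close> of that speed is the
  Schwarzian derivative of \<open>U / V\<close>.

  With \<open>W = U' V - V' U > 0\<close>, the functions \<open>U / sqrt W\<close> and \<open>V / sqrt W\<close> both solve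
  \<open>y'' = - 3 q y\<close>, and their Wronskian is 1. If two GAFs have the same intensity, they have the same \<open>q\<close>, so
  the two pairs of solutions differ by a constant matrix \<open>A\<close> of determinant 1. Writing \<open>(P, Q)\<close> for the pair
  of the second GAF, one has \<open>(P, Q) = \<sigma> * A (U, V)\<close> on the real line with a positive function \<open>\<sigma>\<close>. It extends to an
  entire function \<open>S\<close> without zeros because neither pair has a common zero. The determinant being 1, the
  second covariance at \<open>(x, y)\<close> is \<open>\<sigma> x * \<sigma> y * C x y\<close> (\<open>equal_speed_imp_kernel_scaling\<close>), and a Gaussian
  field is determined by its covariance.

  The zero processes are treated by exhibiting the zero process as a measurable function of the
  field restricted to the real line (\<open>measurable_zero_count\<close>); multiplication by \<open>S\<close> does not change it.
\<close>

section \<open>Joint characteristic functions determine joint laws\<close>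

lemma weighted_indicator_bounds:
  fixes h :: "'a \<Rightarrow> real"
  assumes "prob_space P" and Z [measurable]: "Z \<in> borel_measurable P" and h [measurable]: "h \<in> borel_measurable P"
    and h0: "\<And>x. 0 \<le> h x" and hK: "\<And>x. h x \<le> K" and B [measurable]: "B \<in> sets borel"
  shows "0 \<le> (LINT \<omega>|P. h \<omega> * indicator B (Z \<omega>))"
    and "(LINT \<omega>|P. h \<omega> * indicator B (Z \<omega>)) \<le> (LINT \<omega>|P. h \<omega>)"
proof -
  interpret prob_space P by fact
  have int: "integrable P h" by (rule integrable_const_bound[where B = K]) (use h0 hK in auto)
  then have "integrable P (\<lambda>\<omega>. h \<omega> * indicator B (Z \<omega>))"
    by (rule Bochner_Integration.integrable_bound) (auto simp: indicator_def)
  then show "(LINT \<omega>|P. h \<omega> * indicator B (Z \<omega>)) \<le> (LINT \<omega>|P. h \<omega>)"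
    using int by (intro Bochner_Integration.integral_mono) (auto simp: h0 indicator_def)
  show "0 \<le> (LINT \<omega>|P. h \<omega> * indicator B (Z \<omega>))"
    by (intro Bochner_Integration.integral_nonneg) (simp add: h0)
qed

text \<open>
  The weight \<open>h\<close> is absorbed into the measure, so that the uniqueness theorem for probability
  distributions on the line applies to weighted expectations.
\<close>
lemma tilted_law:
  fixes Z h :: "'a \<Rightarrow> real"
  assumes "prob_space P" and Z [measurable]: "Z \<in> borel_measurable P" and h [measurable]: "h \<in> borel_measurable P"
    and h0: "\<And>x. 0 \<le> h x" and hK: "\<And>x. h x \<le> K"
    and c: "c = (LINT \<omega>|P. h \<omega>)" "c > 0" and B [measurable]: "B \<in> sets borel"
  defines "\<mu> \<equiv> distr (density P (\<lambda>\<omega>. ennreal (h \<omega> / c))) borel Z"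
  shows "real_distribution \<mu>"
    and "char \<mu> t = (LINT \<omega>|P. of_real (h \<omega>) * iexp (t * Z \<omega>)) / c"
    and "(LINT x|\<mu>. indicator B x) = (LINT \<omega>|P. h \<omega> * indicator B (Z \<omega>)) / c"
proof -
  interpret prob_space P by fact
  have int: "integrable P h" by (rule integrable_const_bound[where B = K]) (use h0 hK in auto)
  have "(\<integral>\<^sup>+\<omega>. ennreal (h \<omega> / c) \<partial>P) = ennreal (LINT \<omega>|P. h \<omega> / c)"
    by (rule nn_integral_eq_integral) (use int h0 c(2) in auto)
  also have "\<dots> = 1" using c by simp
  finally interpret D: prob_space "density P (\<lambda>\<omega>. ennreal (h \<omega> / c))"
    by (intro prob_spaceI) (simp add: emeasure_density cong: nn_integral_cong)
  show "real_distribution \<mu>" unfolding \<mu>_def by (rule D.real_distribution_distr) simp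
  have "char \<mu> t = (LINT \<omega>|P. (h \<omega> / c) *\<^sub>R iexp (t * Z \<omega>))"
    unfolding char_def \<mu>_def using h0 c(2)
    by (subst integral_distr) (auto simp: integral_density)
  then show "char \<mu> t = (LINT \<omega>|P. of_real (h \<omega>) * iexp (t * Z \<omega>)) / c"
    by (simp add: scaleR_conv_of_real field_simps flip: integral_divide_zero)
  show "(LINT x|\<mu>. indicator B x) = (LINT \<omega>|P. h \<omega> * indicator B (Z \<omega>)) / c"
    unfolding \<mu>_def using h0 c(2)
    by (subst integral_distr) (auto simp: integral_density simp flip: integral_divide_zero)
qed

text \<open>
  If the weights have total mass 0 both sides vanish; otherwise the normalized weights are densities
  of probability measures with the same characteristic function.
\<close>
lemma weighted_char_uniqueness:
  fixes X :: "'a \<Rightarrow> real" and Y :: "'b \<Rightarrow> real" and H :: "'a \<Rightarrow> real" and H' :: "'b \<Rightarrow> real"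
  assumes M: "prob_space M" and N: "prob_space N"
    and X: "X \<in> borel_measurable M" and Y: "Y \<in> borel_measurable N"
    and H: "H \<in> borel_measurable M" and H': "H' \<in> borel_measurable N"
    and H0: "\<And>x. 0 \<le> H x" "\<And>x. 0 \<le> H' x" and HK: "\<And>x. H x \<le> K" "\<And>x. H' x \<le> K"
    and eq: "\<And>t. (LINT \<omega>|M. of_real (H \<omega>) * iexp (t * X \<omega>)) = (LINT \<omega>|N. of_real (H' \<omega>) * iexp (t * Y \<omega>))"
    and B: "B \<in> sets borel"
  shows "(LINT \<omega>|M. H \<omega> * indicator B (X \<omega>)) = (LINT \<omega>|N. H' \<omega> * indicator B (Y \<omega>))"
proof -
  define c where "c = (LINT \<omega>|M. H \<omega>)"
  have "complex_of_real (LINT \<omega>|M. H \<omega>) = complex_of_real (LINT \<omega>|N. H' \<omega>)"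
    using eq[of 0] by simp
  then have c': "c = (LINT \<omega>|N. H' \<omega>)" unfolding c_def of_real_eq_iff .
  note bM = weighted_indicator_bounds[OF M X H H0(1) HK(1) B, folded c_def]
  note bN = weighted_indicator_bounds[OF N Y H' H0(2) HK(2) B, folded c']
  show ?thesis
  proof (cases "c > 0")
    case False
    then show ?thesis using bM bN by linarith
  next
    case True
    note tM = tilted_law[OF M X H H0(1) HK(1) c_def True]
    note tN = tilted_law[OF N Y H' H0(2) HK(2) c' True]
    let ?\<mu> = "distr (density M (\<lambda>\<omega>. ennreal (H \<omega> / c))) borel X"
    let ?\<nu> = "distr (density N (\<lambda>\<omega>. ennreal (H' \<omega> / c))) borel Y"
    have "char ?\<mu> = char ?\<nu>"
      unfolding fun_eq_iff tM(2)[OF B] tN(2)[OF B] eq by blast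
    then have "?\<mu> = ?\<nu>" by (rule Levy_uniqueness[OF tM(1)[OF B] tN(1)[OF B]])
    then have "(LINT x|?\<mu>. indicator B x :: real) = (LINT x|?\<nu>. indicator B x)" by simp
    then show ?thesis using True unfolding tM(3)[OF B] tN(3)[OF B] by simp
  qed
qed

text \<open>
  Products of weights \<open>1 + cos (u * x + b)\<close> are nonnegative and at the same time linear combinations
  of exponentials, so their expectations are determined by the joint characteristic function. The extra
  exponential factor keeps the induction over \<open>J\<close> going: expanding one cosine only shifts its frequency.
\<close>
lemma trig_weights_eq:
  fixes X :: "'i \<Rightarrow> 'a \<Rightarrow> real" and Y :: "'i \<Rightarrow> 'b \<Rightarrow> real" and u b :: "'i \<Rightarrow> real"
  assumes "prob_space M" "prob_space N" and I: "finite I" and J: "J \<subseteq> I"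
    and X: "\<And>i. i \<in> I \<Longrightarrow> X i \<in> borel_measurable M"
    and Y: "\<And>i. i \<in> I \<Longrightarrow> Y i \<in> borel_measurable N"
    and eq: "\<And>v. (LINT \<omega>|M. iexp (\<Sum>i\<in>I. v i * X i \<omega>)) = (LINT \<omega>|N. iexp (\<Sum>i\<in>I. v i * Y i \<omega>))"
  shows "(LINT \<omega>|M. of_real (\<Prod>i\<in>J. 1 + cos (u i * X i \<omega> + b i)) * iexp (\<Sum>i\<in>I. v i * X i \<omega>)) =
         (LINT \<omega>|N. of_real (\<Prod>i\<in>J. 1 + cos (u i * Y i \<omega> + b i)) * iexp (\<Sum>i\<in>I. v i * Y i \<omega>))"
proof -
  have "finite J" using I J finite_subset by blast
  then show ?thesis using J
  proof (induction J arbitrary: v rule: finite_induct)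
    case empty
    show ?case using eq[of v] by simp
  next
    case (insert j J)
    then have j: "j \<in> I" and JI: "J \<subseteq> I" by auto
    have step: "(LINT \<omega>|P. of_real (\<Prod>i\<in>insert j J. 1 + cos (u i * Z i \<omega> + b i)) * iexp (\<Sum>i\<in>I. v i * Z i \<omega>)) =
        (LINT \<omega>|P. of_real (\<Prod>i\<in>J. 1 + cos (u i * Z i \<omega> + b i)) * iexp (\<Sum>i\<in>I. v i * Z i \<omega>)) +
        (iexp (b j) / 2) * (LINT \<omega>|P. of_real (\<Prod>i\<in>J. 1 + cos (u i * Z i \<omega> + b i)) * iexp (\<Sum>i\<in>I. (v(j := v j + u j)) i * Z i \<omega>)) +
        (iexp (- b j) / 2) * (LINT \<omega>|P. of_real (\<Prod>i\<in>J. 1 + cos (u i * Z i \<omega> + b i)) * iexp (\<Sum>i\<in>I. (v(j := v j - u j)) i * Z i \<omega>))"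
      if P: "prob_space P" and Z: "\<And>i. i \<in> I \<Longrightarrow> Z i \<in> borel_measurable P" for P :: "'c measure" and Z
    proof -
      interpret P: prob_space P by fact
      let ?H = "\<lambda>\<omega>. \<Prod>i\<in>J. 1 + cos (u i * Z i \<omega> + b i)"
      have meas [measurable]: "?H \<in> borel_measurable P" "\<And>w. (\<lambda>\<omega>. \<Sum>i\<in>I. w i * Z i \<omega>) \<in> borel_measurable P"
        using Z JI by (auto intro!: borel_measurable_prod borel_measurable_sum borel_measurable_times
            borel_measurable_add borel_measurable_continuous_on[of cos] continuous_intros)
      have abs1: "\<bar>1 + cos x\<bar> \<le> 2" for x :: real
        using cos_le_one[of x] cos_ge_minus_one[of x] by linarith
      have bd: "\<bar>?H \<omega>\<bar> \<le> 2 ^ card J" for \<omega>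
      proof -
        have "\<bar>?H \<omega>\<bar> = (\<Prod>i\<in>J. \<bar>1 + cos (u i * Z i \<omega> + b i)\<bar>)" by (simp add: abs_prod)
        also have "\<dots> \<le> (\<Prod>i\<in>J. 2)"
          using abs1 by (intro prod_mono) auto
        finally show ?thesis by simp
      qed
      have int: "integrable P (\<lambda>\<omega>. of_real (?H \<omega>) * iexp (\<Sum>i\<in>I. w i * Z i \<omega>))" for w
        by (rule P.integrable_const_bound[where B="2 ^ card J"])
           (auto simp: norm_mult bd simp del: of_real_prod of_real_sum of_real_add of_real_mult)
      have shift: "(\<Sum>i\<in>I. (v(j := v j + d)) i * Z i \<omega>) = (\<Sum>i\<in>I. v i * Z i \<omega>) + d * Z j \<omega>" for d \<omega>
      proof -
        have "(\<Sum>i\<in>I. (v(j := v j + d)) i * Z i \<omega>) = (\<Sum>i\<in>I. v i * Z i \<omega> + (if i = j then d * Z j \<omega> else 0))"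
          by (intro sum.cong) (auto simp: algebra_simps)
        also have "\<dots> = (\<Sum>i\<in>I. v i * Z i \<omega>) + d * Z j \<omega>"
          using I j by (simp add: sum.distrib)
        finally show ?thesis .
      qed
      have cos: "complex_of_real (1 + cos (u j * y + b j)) * iexp x =
         iexp x + iexp (b j) / 2 * iexp (x + u j * y) + iexp (- b j) / 2 * iexp (x + (- u j) * y)" for x y
        by (simp add: cos_of_real[symmetric] cos_exp_eq exp_add[symmetric] exp_minus ring_distribs add_divide_distrib del: cos_of_real)
           (simp add: exp_add exp_minus exp_diff field_simps)
      have "of_real (\<Prod>i\<in>insert j J. 1 + cos (u i * Z i \<omega> + b i)) * iexp (\<Sum>i\<in>I. v i * Z i \<omega>) =
         of_real (?H \<omega>) * iexp (\<Sum>i\<in>I. v i * Z i \<omega>) +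
         (iexp (b j) / 2) * (of_real (?H \<omega>) * iexp (\<Sum>i\<in>I. (v(j := v j + u j)) i * Z i \<omega>)) +
         (iexp (- b j) / 2) * (of_real (?H \<omega>) * iexp (\<Sum>i\<in>I. (v(j := v j + (- u j))) i * Z i \<omega>))" for \<omega>
      proof -
        have "of_real (\<Prod>i\<in>insert j J. 1 + cos (u i * Z i \<omega> + b i)) * iexp (\<Sum>i\<in>I. v i * Z i \<omega>) =
            of_real (?H \<omega>) * (of_real (1 + cos (u j * Z j \<omega> + b j)) * iexp (\<Sum>i\<in>I. v i * Z i \<omega>))"
          using insert.hyps by (simp del: of_real_add of_real_prod)
        then show ?thesis unfolding shift cos
          by (simp only: distrib_left mult.assoc mult.left_commute)
      qed
      then show ?thesis
        using int by simp
    qed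
    show ?case
      apply (subst step[OF \<open>prob_space M\<close> X], assumption)
      apply (subst step[OF \<open>prob_space N\<close> Y], assumption)
      apply (simp only: insert.IH[OF JI])
      done
  qed
qed

text \<open>
  Coordinates are converted one at a time from trigonometric weights to indicators. All other
  weights being nonnegative, each conversion is an instance of the one-dimensional weighted statement; the
  induction hypothesis for the cosines \<open>cos (u * x)\<close> and \<open>cos (u * x - pi / 2) = sin (u * x)\<close> supplies the
  characteristic function of the coordinate.
\<close>
lemma joint_char_uniqueness_weighted:
  fixes X :: "'i \<Rightarrow> 'a \<Rightarrow> real" and Y :: "'i \<Rightarrow> 'b \<Rightarrow> real" and w :: "'i \<Rightarrow> real \<Rightarrow> real"
  assumes M: "prob_space M" and N: "prob_space N" and I: "finite I"
    and X: "\<And>i. i \<in> I \<Longrightarrow> X i \<in> borel_measurable M"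
    and Y: "\<And>i. i \<in> I \<Longrightarrow> Y i \<in> borel_measurable N"
    and eq: "\<And>v. (LINT \<omega>|M. iexp (\<Sum>i\<in>I. v i * X i \<omega>)) = (LINT \<omega>|N. iexp (\<Sum>i\<in>I. v i * Y i \<omega>))"
    and J: "J \<subseteq> I"
    and ind: "\<And>i. i \<in> J \<Longrightarrow> \<exists>B\<in>sets borel. w i = indicator B"
    and trig: "\<And>i. i \<in> I - J \<Longrightarrow> \<exists>u b. w i = (\<lambda>x. 1 + cos (u * x + b))"
  shows "(LINT \<omega>|M. (\<Prod>i\<in>I. w i (X i \<omega>))) = (LINT \<omega>|N. (\<Prod>i\<in>I. w i (Y i \<omega>)))"
proof -
  have "finite J" using I J finite_subset by blast
  then show ?thesis using J ind trig
  proof (induction J arbitrary: w rule: finite_induct)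
    case empty
    then obtain u b where w: "\<And>i. i \<in> I \<Longrightarrow> w i = (\<lambda>x. 1 + cos (u i * x + b i))"
      using bchoice[of I "\<lambda>i ub. w i = (\<lambda>x. 1 + cos (fst ub * x + snd ub))"] by force
    have "complex_of_real (LINT \<omega>|M. (\<Prod>i\<in>I. 1 + cos (u i * X i \<omega> + b i))) =
          complex_of_real (LINT \<omega>|N. (\<Prod>i\<in>I. 1 + cos (u i * Y i \<omega> + b i)))"
      using trig_weights_eq[OF M N I subset_refl X Y eq, of u b "\<lambda>_. 0"]
      unfolding integral_complex_of_real[symmetric] by simp
    then show ?case unfolding of_real_eq_iff using w by simp
  next
    case (insert j J)
    then have j: "j \<in> I" and JI: "J \<subseteq> I" by auto
    obtain B where B: "B \<in> sets borel" "w j = indicator B" using insert.prems(2) by auto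
    let ?w = "\<lambda>u b. w(j := (\<lambda>x. 1 + cos (u * x + b)))"
    have IH: "(LINT \<omega>|M. (\<Prod>i\<in>I. ?w u b i (X i \<omega>))) = (LINT \<omega>|N. (\<Prod>i\<in>I. ?w u b i (Y i \<omega>)))" for u b
    proof (rule insert.IH[OF JI])
      show "\<exists>B\<in>sets borel. ?w u b i = indicator B" if "i \<in> J" for i
        using that insert.prems(2)[of i] insert.hyps by auto
      show "\<exists>u' b'. ?w u b i = (\<lambda>x. 1 + cos (u' * x + b'))" if "i \<in> I - J" for i
      proof (cases "i = j")
        case True then show ?thesis by auto
      next
        case False then show ?thesis using that insert.prems(3)[of i] by auto
      qed
    qed
    have rng: "0 \<le> w i x \<and> w i x \<le> 2" if "i \<in> I" for i x
    proof (cases "i \<in> insert j J")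
      case True then show ?thesis using insert.prems(2)[of i] by (auto simp: indicator_def)
    next
      case False
      then obtain u b where "w i = (\<lambda>x. 1 + cos (u * x + b))" using \<open>i \<in> I\<close> insert.prems(3)[of i] by blast
      moreover have "0 \<le> 1 + cos (u*x+b) \<and> 1 + cos (u*x+b) \<le> 2"
        using cos_le_one[of "u*x+b"] cos_ge_minus_one[of "u*x+b"] by linarith
      ultimately show ?thesis by simp
    qed
    have wm: "w i \<in> borel_measurable borel" if "i \<in> I" for i
    proof (cases "i \<in> insert j J")
      case True then show ?thesis using insert.prems(2)[of i] by auto
    next
      case False
      then obtain u b where "w i = (\<lambda>x. 1 + cos (u * x + b))" using \<open>i \<in> I\<close> insert.prems(3)[of i] by blast
      then show ?thesis by simp
    qed
    let ?H = "\<lambda>\<omega>. \<Prod>i\<in>I-{j}. w i (X i \<omega>)" and ?H' = "\<lambda>\<omega>. \<Prod>i\<in>I-{j}. w i (Y i \<omega>)"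
    have Hm: "?H \<in> borel_measurable M" "?H' \<in> borel_measurable N"
      using wm X Y by (auto intro!: borel_measurable_prod measurable_compose[OF _ wm])
    have bnd: "0 \<le> (\<Prod>i\<in>I-{j}. w i (z i))" "(\<Prod>i\<in>I-{j}. w i (z i)) \<le> (\<Prod>i\<in>I-{j}. 2)" for z
      using rng by (intro prod_nonneg; simp) (use rng in \<open>intro prod_mono, simp\<close>)
    have split: "(\<Prod>i\<in>I. v i (z i)) = (\<Prod>i\<in>I-{j}. v i (z i)) * v j (z j)" for v :: "'i \<Rightarrow> real \<Rightarrow> real" and z
      using I j by (simp add: prod.remove mult.commute)
    have sp: "(\<Prod>i\<in>I. ?w u b i (z i)) = (\<Prod>i\<in>I-{j}. w i (z i)) * (1 + cos (u * z j + b))" for u b z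
      unfolding split[of "?w u b"] by simp
    have int: "integrable P (\<lambda>\<omega>. (\<Prod>i\<in>I-{j}. w i (Z i \<omega>)) * f (Z j \<omega>))"
      if P: "prob_space P" and Z: "\<And>i. i \<in> I \<Longrightarrow> Z i \<in> borel_measurable P" and f: "f \<in> borel_measurable borel" "\<And>x. \<bar>f x\<bar> \<le> 1"
      for P :: "'c measure" and Z and f :: "real \<Rightarrow> real"
    proof -
      interpret P: prob_space P by fact
      show ?thesis
      proof (rule P.integrable_const_bound[where B="(\<Prod>i\<in>I-{j}. 2) * 1"])
        show "AE x in P. norm ((\<Prod>i\<in>I-{j}. w i (Z i x)) * f (Z j x)) \<le> (\<Prod>i\<in>I-{j}. 2) * 1"
          unfolding real_norm_def abs_mult
          by (intro AE_I2 mult_mono f(2)) (simp_all only: abs_of_nonneg[OF bnd(1)] bnd abs_ge_zero, simp)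
        show "(\<lambda>x. (\<Prod>i\<in>I-{j}. w i (Z i x)) * f (Z j x)) \<in> borel_measurable P"
          using wm Z f j by (auto intro!: borel_measurable_times borel_measurable_prod measurable_compose[OF _ wm]
            measurable_compose[OF _ f(1)])
      qed
    qed
    \<comment> \<open>Frequency 0 and phase \<open>pi/2\<close> turn the weight of the coordinate \<open>j\<close> into the constant 1.\<close>
    have one: "(LINT \<omega>|M. ?H \<omega>) = (LINT \<omega>|N. ?H' \<omega>)"
      using IH[of 0 "pi/2"] unfolding sp by simp
    have cs: "(LINT \<omega>|M. ?H \<omega> * cos (u * X j \<omega> + b)) = (LINT \<omega>|N. ?H' \<omega> * cos (u * Y j \<omega> + b))" for u b
    proof -
      have "(LINT \<omega>|M. ?H \<omega> * 1 + ?H \<omega> * cos (u * X j \<omega> + b)) = (LINT \<omega>|N. ?H' \<omega> * 1 + ?H' \<omega> * cos (u * Y j \<omega> + b))"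
        using IH[of u b] unfolding sp distrib_left .
      moreover have "(LINT \<omega>|M. ?H \<omega> * 1 + ?H \<omega> * cos (u * X j \<omega> + b)) = (LINT \<omega>|M. ?H \<omega> * 1) + (LINT \<omega>|M. ?H \<omega> * cos (u * X j \<omega> + b))"
        using int[of M X "\<lambda>_. 1", OF M X] int[of M X "\<lambda>x. cos (u * x + b)", OF M X]
        by (intro Bochner_Integration.integral_add) auto
      moreover have "(LINT \<omega>|N. ?H' \<omega> * 1 + ?H' \<omega> * cos (u * Y j \<omega> + b)) = (LINT \<omega>|N. ?H' \<omega> * 1) + (LINT \<omega>|N. ?H' \<omega> * cos (u * Y j \<omega> + b))"
        using int[of N Y "\<lambda>_. 1", OF N Y] int[of N Y "\<lambda>x. cos (u * x + b)", OF N Y]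
        by (intro Bochner_Integration.integral_add) auto
      ultimately show ?thesis using one by simp
    qed
    have expand: "(LINT \<omega>|P. complex_of_real (\<Prod>i\<in>I-{j}. w i (Z i \<omega>)) * iexp (t * Z j \<omega>)) =
        of_real (LINT \<omega>|P. (\<Prod>i\<in>I-{j}. w i (Z i \<omega>)) * cos (t * Z j \<omega> + 0)) +
        \<i> * of_real (LINT \<omega>|P. (\<Prod>i\<in>I-{j}. w i (Z i \<omega>)) * cos (t * Z j \<omega> + (- pi/2)))"
      if P: "prob_space P" and Z: "\<And>i. i \<in> I \<Longrightarrow> Z i \<in> borel_measurable P" for P :: "'c measure" and Z t
    proof -
      have *: "complex_of_real h * iexp x = complex_of_real (h * cos (x + 0)) + \<i> * complex_of_real (h * cos (x + (- pi/2)))" for h x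
      proof -
        have "cos (x + (- pi/2)) = sin x" by (simp add: cos_diff)
        then show ?thesis by (simp add: cis_conv_exp[symmetric] complex_eq_iff)
      qed
      have "(LINT \<omega>|P. complex_of_real (\<Prod>i\<in>I-{j}. w i (Z i \<omega>)) * iexp (t * Z j \<omega>)) =
        (LINT \<omega>|P. complex_of_real ((\<Prod>i\<in>I-{j}. w i (Z i \<omega>)) * cos (t * Z j \<omega> + 0))) +
        (LINT \<omega>|P. \<i> * complex_of_real ((\<Prod>i\<in>I-{j}. w i (Z i \<omega>)) * cos (t * Z j \<omega> + (- pi/2))))"
        unfolding *
        by (intro Bochner_Integration.integral_add integrable_mult_right integrable_of_real
              int[of P Z "\<lambda>x. cos (t * x + 0)", OF P Z] int[of P Z "\<lambda>x. cos (t * x + (- pi/2))", OF P Z]) auto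
      also have "(LINT \<omega>|P. \<i> * complex_of_real ((\<Prod>i\<in>I-{j}. w i (Z i \<omega>)) * cos (t * Z j \<omega> + (- pi/2)))) =
          \<i> * (LINT \<omega>|P. complex_of_real ((\<Prod>i\<in>I-{j}. w i (Z i \<omega>)) * cos (t * Z j \<omega> + (- pi/2))))"
        by (rule integral_mult_right_zero)
      finally show ?thesis unfolding integral_complex_of_real .
    qed
    have "(LINT \<omega>|M. ?H \<omega> * indicator B (X j \<omega>)) = (LINT \<omega>|N. ?H' \<omega> * indicator B (Y j \<omega>))"
      by (rule weighted_char_uniqueness[OF M N X[OF j] Y[OF j] Hm, where K="\<Prod>i\<in>I-{j}. 2"])
         (simp_all only: bnd expand[of M X, OF M X] expand[of N Y, OF N Y] cs B(1))
    then show ?case unfolding split[of w] B(2) .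
  qed
qed

text \<open>
  The multidimensional form of Levy's uniqueness theorem, stated on product sets.
\<close>
lemma joint_char_uniqueness:
  fixes X :: "'i \<Rightarrow> 'a \<Rightarrow> real" and Y :: "'i \<Rightarrow> 'b \<Rightarrow> real"
  assumes M: "prob_space M" and N: "prob_space N" and I: "finite I"
    and X: "\<And>i. i \<in> I \<Longrightarrow> X i \<in> borel_measurable M"
    and Y: "\<And>i. i \<in> I \<Longrightarrow> Y i \<in> borel_measurable N"
    and eq: "\<And>v. (LINT \<omega>|M. iexp (\<Sum>i\<in>I. v i * X i \<omega>)) = (LINT \<omega>|N. iexp (\<Sum>i\<in>I. v i * Y i \<omega>))"
    and B: "\<And>i. i \<in> I \<Longrightarrow> B i \<in> sets borel"
  shows "measure M {\<omega>\<in>space M. \<forall>i\<in>I. X i \<omega> \<in> B i} = measure N {\<omega>\<in>space N. \<forall>i\<in>I. Y i \<omega> \<in> B i}"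
proof -
  have *: "(LINT \<omega>|P. (\<Prod>i\<in>I. indicator (B i) (Z i \<omega>))) = measure P {\<omega>\<in>space P. \<forall>i\<in>I. Z i \<omega> \<in> B i}"
    if Z: "\<And>i. i \<in> I \<Longrightarrow> Z i \<in> borel_measurable P" for P :: "'c measure" and Z
  proof -
    have "{\<omega>\<in>space P. \<forall>i\<in>I. Z i \<omega> \<in> B i} \<in> sets P"
      using I B Z by (auto intro!: sets.sets_Collect_finite_All' simp: pred_def intro: measurable_sets_Collect)
    moreover have "(LINT \<omega>|P. (\<Prod>i\<in>I. indicator (B i) (Z i \<omega>))) = (LINT \<omega>|P. indicator {\<omega>\<in>space P. \<forall>i\<in>I. Z i \<omega> \<in> B i} \<omega> :: real)"
      using I by (intro Bochner_Integration.integral_cong) (auto simp: indicator_def prod_eq_1_iff prod_zero_iff)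
    ultimately show ?thesis by (simp add: Int_absorb1 sets.sets_into_space)
  qed
  show ?thesis
    using joint_char_uniqueness_weighted[OF M N I X Y eq subset_refl, of "\<lambda>i. indicator (B i)"] B
    by (force simp: *[OF X] *[OF Y])
qed

section \<open>Sign changes of a Gaussian pair\<close>

abbreviation "std_gauss \<equiv> std_normal_distribution"

lemma std_gauss_pair_char:
  "(LINT z|(std_gauss \<Otimes>\<^sub>M std_gauss). iexp (p * fst z + q * snd z)) = of_real (exp (- (p\<^sup>2 + q\<^sup>2) / 2))"
proof -
  interpret P: prob_space std_gauss by (rule prob_space_normal_density) simp
  interpret PP: pair_prob_space std_gauss std_gauss ..
  have int: "integrable (std_gauss \<Otimes>\<^sub>M std_gauss) (\<lambda>(x, y). iexp (p * x) * iexp (q * y))"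
    by (rule PP.integrable_const_bound[where B=1]) (auto simp: norm_mult split_beta)
  have "(LINT z|(std_gauss \<Otimes>\<^sub>M std_gauss). iexp (p * fst z + q * snd z)) =
        (LINT z|(std_gauss \<Otimes>\<^sub>M std_gauss). (\<lambda>(x, y). iexp (p * x) * iexp (q * y)) z)"
    by (simp add: split_beta exp_add[symmetric] distrib_left)
  also have "\<dots> = (LINT x|std_gauss. (LINT y|std_gauss. iexp (p * x) * iexp (q * y)))"
    using PP.integral_fst'[OF int] by simp
  also have "\<dots> = (LINT x|std_gauss. iexp (p * x) * char std_gauss q)"
    unfolding char_def by (simp del: of_real_mult)
  also have "\<dots> = char std_gauss p * char std_gauss q"
    unfolding char_def by (simp del: of_real_mult)
  also have "\<dots> = of_real (exp (- (p\<^sup>2 + q\<^sup>2) / 2))"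
    by (simp add: char_std_normal_distribution exp_add[symmetric] add_divide_distrib flip: of_real_mult)
  finally show ?thesis .
qed

text \<open>
  The radial part of a planar Gaussian integral in polar-like coordinates \<open>(x, x * u)\<close>.
\<close>
lemma nn_integral_Rayleigh:
  fixes k :: real
  assumes pos: "k > 0"
  shows "(\<integral>\<^sup>+x. ennreal (x * exp (- k * x\<^sup>2 / 2)) * indicator {0..} x \<partial>lborel) = ennreal (1 / k)"
proof -
  let ?F = "\<lambda>x. - exp (- k * x\<^sup>2 / 2) / k"
  have "(\<integral>\<^sup>+x. ennreal (x * exp (- k * x\<^sup>2 / 2)) * indicator {0..} x \<partial>lborel) = ennreal (0 - ?F 0)"
  proof (rule nn_integral_FTC_atLeast)
    show "(?F has_real_derivative x * exp (- k * x\<^sup>2 / 2)) (at x)" for x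
      using pos by (auto intro!: derivative_eq_intros simp: field_simps)
    have "filterlim (\<lambda>x::real. k / 2 * x\<^sup>2) at_top at_top"
      using pos by (intro filterlim_tendsto_pos_mult_at_top[OF tendsto_const] filterlim_pow_at_top filterlim_ident) auto
    then have "filterlim (\<lambda>x::real. - (k / 2 * x\<^sup>2)) at_bot at_top"
      by (simp add: filterlim_uminus_at_top)
    then have "((\<lambda>x. exp (- (k / 2 * x\<^sup>2))) \<longlongrightarrow> 0) at_top"
      by (rule filterlim_compose[OF exp_at_bot])
    then have "((\<lambda>x. - exp (- (k / 2 * x\<^sup>2)) / k) \<longlongrightarrow> - 0 / k) at_top"
      using pos by (intro tendsto_intros) auto
    then show "(?F \<longlongrightarrow> 0) at_top" by (simp add: algebra_simps)
  qed auto
  then show ?thesis by (simp add: field_simps)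
qed

lemma nn_integral_arctan_tail:
  assumes m: "m > (0::real)"
  shows "(\<integral>\<^sup>+u. ennreal (1 / (1 + u\<^sup>2)) * indicator {m..} u \<partial>lborel) = ennreal (arctan (1 / m))"
proof -
  have "(\<integral>\<^sup>+u. ennreal (1 / (1 + u\<^sup>2)) * indicator {m..} u \<partial>lborel) = ennreal (pi/2 - arctan m)"
    by (rule nn_integral_FTC_atLeast)
       (auto intro!: derivative_eq_intros tendsto_arctan_at_top simp: field_simps)
  then show ?thesis using arctan_inverse[of m] m by (simp add: inverse_eq_divide)
qed

text \<open>
  After the substitution \<open>y = - x * u\<close> the radial integral leaves half the Cauchy density,
  \<open>1 / (2 * pi * (1 + u\<^sup>2))\<close>, on the half-line \<open>u > c / d\<close>; this is the fraction of the circle that the wedge occupies.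
\<close>
lemma std_gauss_wedge:
  assumes c: "c > 0" and d: "d \<ge> 0"
  shows "measure (std_gauss \<Otimes>\<^sub>M std_gauss) {z. fst z > 0 \<and> c * fst z + d * snd z < 0} = arctan (d / c) / (2 * pi)"
proof (cases "d = 0")
  case True
  then have empty: "{z::real \<times> real. fst z > 0 \<and> c * fst z + d * snd z < 0} = {}"
    using c by (auto simp: mult_less_0_iff)
  show ?thesis unfolding empty using True by simp
next
  case False
  then have dpos: "d > 0" using d by simp
  define m where "m = c / d"
  have m: "m > 0" using c dpos by (simp add: m_def)
  interpret P: prob_space std_gauss by (rule prob_space_normal_density) simp
  interpret PP: pair_prob_space std_gauss std_gauss ..
  let ?A = "{z::real \<times> real. fst z > 0 \<and> c * fst z + d * snd z < 0}"
  let ?g = "std_normal_density"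
  have A [measurable]: "?A \<in> sets (borel \<Otimes>\<^sub>M borel)"
  proof -
    have "?A = {z\<in>space (borel \<Otimes>\<^sub>M borel). fst z > 0 \<and> c * fst z + d * snd z < 0}"
      by (simp add: space_pair_measure)
    also have "\<dots> \<in> sets (borel \<Otimes>\<^sub>M borel)" by measurable
    finally show ?thesis .
  qed
  have A': "?A \<in> sets (std_gauss \<Otimes>\<^sub>M std_gauss)"
    using A by (simp cong: sets_pair_measure_cong)
  have iff: "c * x + d * y < 0 \<longleftrightarrow> y < - m * x" for x y
    using dpos by (simp add: m_def field_simps) linarith
  have inner: "emeasure std_gauss (Pair x -` ?A) =
     (if x > 0 then \<integral>\<^sup>+u. ennreal (x * ?g (x * u)) * indicator {m<..} u \<partial>lborel else 0)" for x
  proof (cases "x > 0")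
    case True
    have "Pair x -` ?A = {..<- m * x}" using True by (auto simp: iff)
    then have "emeasure std_gauss (Pair x -` ?A) = (\<integral>\<^sup>+y. ennreal (?g y) * indicator {..<- m * x} y \<partial>lborel)"
      by (simp add: emeasure_density)
    also have "\<dots> = ennreal \<bar>- x\<bar> * (\<integral>\<^sup>+u. ennreal (?g (0 + - x * u)) * indicator {..<- m * x} (0 + - x * u) \<partial>lborel)"
      using True by (intro nn_integral_real_affine) auto
    also have "\<dots> = (\<integral>\<^sup>+u. ennreal \<bar>- x\<bar> * (ennreal (?g (0 + - x * u)) * indicator {..<- m * x} (0 + - x * u)) \<partial>lborel)"
      by (rule nn_integral_cmult[symmetric]) measurable
    also have "\<dots> = (\<integral>\<^sup>+u. ennreal (x * ?g (x * u)) * indicator {m<..} u \<partial>lborel)"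
    proof (intro nn_integral_cong)
      fix u :: real
      have "?g (0 + - x * u) = ?g (x * u)" by (simp add: std_normal_density_def)
      moreover have "ennreal (x * ?g (x * u)) = ennreal x * ennreal (?g (x * u))"
        using True by (intro ennreal_mult') simp
      moreover have "- x * u < - m * x \<longleftrightarrow> m < u" using True by simp
      ultimately show "ennreal \<bar>- x\<bar> * (ennreal (?g (0 + - x * u)) * indicator {..<- m * x} (0 + - x * u)) =
          ennreal (x * ?g (x * u)) * indicator {m<..} u"
        using True by (simp add: indicator_def)
    qed
    finally show ?thesis using True by simp
  next
    case False
    then show ?thesis by simp
  qed
  have gg: "?g x * (x * ?g (x * u)) = (x * exp (- (1 + u\<^sup>2) * x\<^sup>2 / 2)) * (1 / (2 * pi))" for x u
  proof -
    have "exp (- x\<^sup>2 / 2) * exp (- (x * u)\<^sup>2 / 2) = exp (- (1 + u\<^sup>2) * x\<^sup>2 / 2)"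
      by (simp add: exp_add[symmetric] power_mult_distrib field_simps)
    moreover have "sqrt (2 * pi) * sqrt (2 * pi) = 2 * pi" by simp
    ultimately show ?thesis
      by (simp add: std_normal_density_def field_simps)
  qed
  have "emeasure (std_gauss \<Otimes>\<^sub>M std_gauss) ?A = (\<integral>\<^sup>+x. emeasure std_gauss (Pair x -` ?A) \<partial>std_gauss)"
    by (rule P.emeasure_pair_measure_alt[OF A'])
  also have "\<dots> = (\<integral>\<^sup>+x. ennreal (?g x) * (if x > 0 then \<integral>\<^sup>+u. ennreal (x * ?g (x * u)) * indicator {m<..} u \<partial>lborel else 0) \<partial>lborel)"
    unfolding inner by (subst nn_integral_density) (measurable, simp_all add: open_Collect_less)
  also have "\<dots> = (\<integral>\<^sup>+x. \<integral>\<^sup>+u. ennreal (1 / (2 * pi)) * (ennreal (x * exp (- (1 + u\<^sup>2) * x\<^sup>2 / 2)) * indicator {0..} x * indicator {m<..} u) \<partial>lborel \<partial>lborel)"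
  proof (intro nn_integral_cong)
    fix x :: real
    show "ennreal (?g x) * (if x > 0 then \<integral>\<^sup>+u. ennreal (x * ?g (x * u)) * indicator {m<..} u \<partial>lborel else 0) =
       (\<integral>\<^sup>+u. ennreal (1 / (2 * pi)) * (ennreal (x * exp (- (1 + u\<^sup>2) * x\<^sup>2 / 2)) * indicator {0..} x * indicator {m<..} u) \<partial>lborel)"
    proof (cases "x > 0")
      case True
      then have "ennreal (?g x) * (\<integral>\<^sup>+u. ennreal (x * ?g (x * u)) * indicator {m<..} u \<partial>lborel) =
         (\<integral>\<^sup>+u. ennreal (?g x) * (ennreal (x * ?g (x * u)) * indicator {m<..} u) \<partial>lborel)"
        by (intro nn_integral_cmult[symmetric]) measurable
      also have "\<dots> = (\<integral>\<^sup>+u. ennreal (1 / (2 * pi)) * (ennreal (x * exp (- (1 + u\<^sup>2) * x\<^sup>2 / 2)) * indicator {0..} x * indicator {m<..} u) \<partial>lborel)"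
        using True gg[of x]
        by (intro nn_integral_cong) (auto simp: indicator_def ennreal_mult''[symmetric] mult.commute)
      finally show ?thesis using True by simp
    next
      case False
      then show ?thesis by (cases "x = 0") auto
    qed
  qed
  also have "\<dots> = (\<integral>\<^sup>+u. \<integral>\<^sup>+x. ennreal (1 / (2 * pi)) * (ennreal (x * exp (- (1 + u\<^sup>2) * x\<^sup>2 / 2)) * indicator {0..} x * indicator {m<..} u) \<partial>lborel \<partial>lborel)"
    by (rule lborel_pair.Fubini') measurable
  also have "\<dots> = (\<integral>\<^sup>+u. ennreal (1 / (2 * pi)) * (ennreal (1 / (1 + u\<^sup>2)) * indicator {m<..} u) \<partial>lborel)"
  proof (intro nn_integral_cong)
    fix u :: real
    have pos: "1 + u\<^sup>2 > 0" by (simp add: add_pos_nonneg)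
    show "(\<integral>\<^sup>+x. ennreal (1 / (2 * pi)) * (ennreal (x * exp (- (1 + u\<^sup>2) * x\<^sup>2 / 2)) * indicator {0..} x * indicator {m<..} u) \<partial>lborel) =
        ennreal (1 / (2 * pi)) * (ennreal (1 / (1 + u\<^sup>2)) * indicator {m<..} u)"
      unfolding nn_integral_Rayleigh[OF pos, symmetric]
      by (subst nn_integral_cmult, measurable, subst nn_integral_multc, measurable)
  qed
  also have "\<dots> = ennreal (1 / (2 * pi)) * (\<integral>\<^sup>+u. ennreal (1 / (1 + u\<^sup>2)) * indicator {m<..} u \<partial>lborel)"
    by (rule nn_integral_cmult) measurable
  also have "(\<integral>\<^sup>+u. ennreal (1 / (1 + u\<^sup>2)) * indicator {m<..} u \<partial>lborel) = (\<integral>\<^sup>+u. ennreal (1 / (1 + u\<^sup>2)) * indicator {m..} u \<partial>lborel)"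
    by (intro nn_integral_cong_AE) (use AE_lborel_singleton[of m] in \<open>auto simp: indicator_def\<close>)
  also have "\<dots> = ennreal (arctan (1 / m))" by (rule nn_integral_arctan_tail[OF m])
  finally have "emeasure (std_gauss \<Otimes>\<^sub>M std_gauss) ?A = ennreal (arctan (d / c) / (2 * pi))"
    by (simp add: m_def ennreal_mult'[symmetric])
  then show ?thesis using c d by (simp add: measure_def)
qed

text \<open>
  Only the joint characteristic function is given. By uniqueness the pair may be replaced by
  the triangular representation \<open>(r Z, (C Z + D Z') / r)\<close> with independent standard normal \<open>Z, Z'\<close>, where \<open>r\<^sup>2 = A\<close> and
  \<open>D\<^sup>2 = A B - C\<^sup>2\<close>.
\<close>
lemma gaussian_pair_wedge:
  fixes X Y :: "'a \<Rightarrow> real"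
  assumes M: "prob_space M" and X: "X \<in> borel_measurable M" and Y: "Y \<in> borel_measurable M"
    and ch: "\<And>v w. (LINT \<omega>|M. iexp (v * X \<omega> + w * Y \<omega>)) = of_real (exp (- (v\<^sup>2 * A + 2 * v * w * C + w\<^sup>2 * B) / 2))"
    and A: "A > 0" and C: "C > 0"
  shows "C\<^sup>2 \<le> A * B"
    and "measure M {\<omega>\<in>space M. X \<omega> > 0 \<and> Y \<omega> < 0} = arctan (sqrt (A * B - C\<^sup>2) / C) / (2 * pi)"
proof -
  interpret prob_space M by fact
  show le: "C\<^sup>2 \<le> A * B"
  proof -
    \<comment> \<open>A characteristic function is bounded by 1; evaluated at \<open>(C, - A)\<close> this is the Cauchy-Schwarz inequality.\<close>
    let ?q = "C\<^sup>2 * A + 2 * C * (- A) * C + (- A)\<^sup>2 * B"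
    have "exp (- ?q / 2) = norm (LINT \<omega>|M. iexp (C * X \<omega> + (- A) * Y \<omega>))"
      unfolding ch norm_of_real by simp
    also have "\<dots> \<le> (LINT \<omega>|M. norm (iexp (C * X \<omega> + (- A) * Y \<omega>)))"
      by (rule integral_norm_bound)
    also have "\<dots> = 1" by (simp add: prob_space del: of_real_add of_real_mult)
    finally have "?q \<ge> 0" by simp
    moreover have "?q = A * (A * B - C\<^sup>2)" by (simp add: power2_eq_square algebra_simps)
    ultimately show ?thesis using A by (simp add: zero_le_mult_iff)
  qed
  interpret P: prob_space std_gauss by (rule prob_space_normal_density) simp
  interpret PP: pair_prob_space std_gauss std_gauss ..
  define D where "D = sqrt (A * B - C\<^sup>2)"
  have D2: "D\<^sup>2 = A * B - C\<^sup>2" and D0: "D \<ge> 0" using le by (auto simp: D_def)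
  define r where "r = sqrt A"
  have r: "r > 0" "r\<^sup>2 = A" using A by (auto simp: r_def)
  define X' where "X' = (\<lambda>z::real\<times>real. r * fst z)"
  define Y' where "Y' = (\<lambda>z::real\<times>real. C / r * fst z + D / r * snd z)"
  have X'm: "X' \<in> borel_measurable (std_gauss \<Otimes>\<^sub>M std_gauss)" and Y'm: "Y' \<in> borel_measurable (std_gauss \<Otimes>\<^sub>M std_gauss)"
    unfolding X'_def Y'_def by measurable
  let ?Z = "\<lambda>b. if b then X else Y" and ?Z' = "\<lambda>b. if b then X' else Y'"
  have "measure M {\<omega>\<in>space M. \<forall>b\<in>UNIV. ?Z b \<omega> \<in> (if b then {0<..} else {..<0})} =
        measure (std_gauss \<Otimes>\<^sub>M std_gauss) {\<omega>\<in>space (std_gauss \<Otimes>\<^sub>M std_gauss). \<forall>b\<in>UNIV. ?Z' b \<omega> \<in> (if b then {0<..} else {..<0})}"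
  proof (rule joint_char_uniqueness)
    fix v :: "bool \<Rightarrow> real"
    let ?p = "v True" and ?q = "v False"
    have "(LINT \<omega>|(std_gauss \<Otimes>\<^sub>M std_gauss). iexp (\<Sum>i\<in>UNIV. v i * ?Z' i \<omega>)) =
      (LINT z|(std_gauss \<Otimes>\<^sub>M std_gauss). iexp ((?p * r + ?q * C / r) * fst z + (?q * D / r) * snd z))"
      by (simp add: UNIV_bool X'_def Y'_def algebra_simps add_divide_distrib del: of_real_add of_real_mult of_real_divide)
    also have "\<dots> = of_real (exp (- ((?p * r + ?q * C / r)\<^sup>2 + (?q * D / r)\<^sup>2) / 2))"
      by (rule std_gauss_pair_char)
    also have "(?p * r + ?q * C / r)\<^sup>2 + (?q * D / r)\<^sup>2 = ?p\<^sup>2 * r\<^sup>2 + 2 * ?p * ?q * C + ?q\<^sup>2 * ((C\<^sup>2 + D\<^sup>2) / r\<^sup>2)"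
      using r(1) by (simp add: power2_eq_square field_simps)
    also have "(C\<^sup>2 + D\<^sup>2) / r\<^sup>2 = B" using A by (simp add: D2 r)
    also have "r\<^sup>2 = A" by (fact r)
    also have "of_real (exp (- (?p\<^sup>2 * A + 2 * ?p * ?q * C + ?q\<^sup>2 * B) / 2)) = (LINT \<omega>|M. iexp (?p * X \<omega> + ?q * Y \<omega>))"
      by (rule ch[symmetric])
    also have "\<dots> = (LINT \<omega>|M. iexp (\<Sum>i\<in>UNIV. v i * ?Z i \<omega>))"
      by (simp add: UNIV_bool add.commute del: of_real_add of_real_mult)
    finally show "(LINT \<omega>|M. iexp (\<Sum>i\<in>UNIV. v i * ?Z i \<omega>)) = (LINT \<omega>|(std_gauss \<Otimes>\<^sub>M std_gauss). iexp (\<Sum>i\<in>UNIV. v i * ?Z' i \<omega>))" ..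
  qed (use M X Y X'm Y'm PP.prob_space_axioms in auto)
  also have "{\<omega>\<in>space M. \<forall>b\<in>UNIV. ?Z b \<omega> \<in> (if b then {0<..} else {..<0})} = {\<omega>\<in>space M. X \<omega> > 0 \<and> Y \<omega> < 0}"
    by (auto simp: UNIV_bool)
  also have "{\<omega>\<in>space (std_gauss \<Otimes>\<^sub>M std_gauss). \<forall>b\<in>UNIV. ?Z' b \<omega> \<in> (if b then {0<..} else {..<0})} =
      {z. fst z > 0 \<and> C * fst z + D * snd z < 0}"
  proof -
    have "C / r * x + D / r * y < 0 \<longleftrightarrow> C * x + D * y < 0" for x y
      using r(1) by (simp add: field_simps)
    then show ?thesis using r(1) by (auto simp: UNIV_bool X'_def Y'_def space_pair_measure zero_less_mult_iff)
  qed
  also have "measure (std_gauss \<Otimes>\<^sub>M std_gauss) \<dots> = arctan (D / C) / (2 * pi)"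
    by (rule std_gauss_wedge[OF C D0])
  finally show "measure M {\<omega>\<in>space M. X \<omega> > 0 \<and> Y \<omega> < 0} = arctan (sqrt (A * B - C\<^sup>2) / C) / (2 * pi)"
    unfolding D_def .
qed

section \<open>The zero process as a measurable function of the field\<close>

text \<open>
  The \<open>\<sigma>\<close>-algebra on the entire functions that is generated by their values at real points. A random
  entire function is measurable for it as soon as its real values are random variables, and its law is
  determined by the law of the field on the real line.
\<close>
definition entire_algebra :: "(complex \<Rightarrow> complex) measure" where
  "entire_algebra = vimage_algebra {f. f holomorphic_on UNIV} (\<lambda>f x::real. f (of_real x)) (Pi\<^sub>M UNIV (\<lambda>_. borel))"

lemma space_entire_algebra [simp]: "space entire_algebra = {f. f holomorphic_on UNIV}"
  by (simp add: entire_algebra_def)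

lemma measurable_eval_real [measurable]: "(\<lambda>f. f (complex_of_real x)) \<in> borel_measurable entire_algebra"
proof -
  have "(\<lambda>f x::real. f (complex_of_real x)) \<in> measurable entire_algebra (Pi\<^sub>M UNIV (\<lambda>_. borel))"
    unfolding entire_algebra_def by (rule measurable_vimage_algebra1) (simp add: space_PiM)
  from measurable_compose[OF this measurable_component_singleton[of x]] show ?thesis by simp
qed

lemma continuous_on_entire_real:
  assumes "f holomorphic_on UNIV"
  shows "continuous_on A (\<lambda>x::real. f (complex_of_real x))"
  by (rule continuous_on_compose2[OF holomorphic_on_imp_continuous_on[OF assms]]) (auto intro: continuous_intros)

text \<open>
  Existence of a zero is expressed by countably many values. Clamping the rationals to the interval
  gives a dense set of points that also covers degenerate intervals.
\<close>
lemma zero_in_interval_iff: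
  fixes c d :: real
  assumes f: "f holomorphic_on UNIV" and cd: "c \<le> d"
  shows "(\<exists>x\<in>{c..d}. f (complex_of_real x) = 0) \<longleftrightarrow>
         (\<forall>n. \<exists>r. norm (f (complex_of_real (max c (min d (real_of_rat r))))) < 1 / real (Suc n))"
    (is "?L \<longleftrightarrow> ?R")
proof
  assume ?L
  then obtain x where x: "c \<le> x" "x \<le> d" "f (complex_of_real x) = 0" by auto
  show ?R
  proof
    fix n :: nat
    let ?g = "\<lambda>y. norm (f (complex_of_real (max c (min d y))))"
    have "continuous_on UNIV ?g"
      by (intro continuous_on_norm continuous_on_compose2[OF continuous_on_entire_real[OF f, of UNIV]]
            continuous_intros) auto
    then have "open (?g -` {..<1 / real (Suc n)})"
      by (intro open_vimage) auto
    moreover have "x \<in> ?g -` {..<1 / real (Suc n)}" using x by simp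
    ultimately obtain e where e: "e > 0" "ball x e \<subseteq> ?g -` {..<1 / real (Suc n)}"
      by (rule openE)
    obtain r :: rat where "x < of_rat r" "of_rat r < x + e"
      using of_rat_dense[of x "x + e"] e(1) by auto
    then have "of_rat r \<in> ball x e" by (simp add: dist_real_def)
    then have "?g (of_rat r) < 1 / real (Suc n)" using e(2) by blast
    then show "\<exists>r. ?g (real_of_rat r) < 1 / real (Suc n)" by blast
  qed
next
  assume R: ?R
  show ?L
  proof (rule ccontr)
    assume no: "\<not> ?L"
    obtain x where x: "x \<in> {c..d}" "\<And>y. y \<in> {c..d} \<Longrightarrow> norm (f (complex_of_real x)) \<le> norm (f (complex_of_real y))"
      using continuous_attains_inf[of "{c..d}" "\<lambda>y. norm (f (complex_of_real y))"] cd
        continuous_on_norm[OF continuous_on_entire_real[OF f]] by auto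
    then have "norm (f (complex_of_real x)) > 0" using no by auto
    then obtain n where n: "1 / real (Suc n) < norm (f (complex_of_real x))"
      using nat_approx_posE by blast
    moreover obtain r where "norm (f (complex_of_real (max c (min d (real_of_rat r))))) < 1 / real (Suc n)"
      using R by blast
    moreover have "max c (min d (real_of_rat r)) \<in> {c..d}" using cd by auto
    ultimately show False using x(2) by (meson less_le_trans less_trans not_less)
  qed
qed

lemma sets_zero_in_interval:
  "{f \<in> space entire_algebra. \<exists>x\<in>{c..d}. f (complex_of_real x) = 0} \<in> sets entire_algebra"
proof (cases "c \<le> d")
  case True
  have "{f \<in> space entire_algebra. \<exists>x\<in>{c..d}. f (complex_of_real x) = 0} =
        {f \<in> space entire_algebra. \<forall>n. \<exists>r. norm (f (complex_of_real (max c (min d (real_of_rat r))))) < 1 / real (Suc n)}"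
    using zero_in_interval_iff[OF _ True] by auto
  also have "\<dots> \<in> sets entire_algebra" by measurable
  finally show ?thesis .
next
  case False
  then show ?thesis by simp
qed

definition has_zero_from :: "real \<Rightarrow> (complex \<Rightarrow> complex) \<Rightarrow> bool" where
  "has_zero_from q f \<longleftrightarrow> (\<exists>x\<ge>q. f (complex_of_real x) = 0)"

definition first_zero_from :: "real \<Rightarrow> (complex \<Rightarrow> complex) \<Rightarrow> real" where
  "first_zero_from q f = Inf {x. x \<ge> q \<and> f (complex_of_real x) = 0}"

lemma first_zero_from:
  assumes f: "f holomorphic_on UNIV" and z: "has_zero_from q f"
  shows "first_zero_from q f \<ge> q" "f (complex_of_real (first_zero_from q f)) = 0"
    and "\<And>x. x \<ge> q \<Longrightarrow> f (complex_of_real x) = 0 \<Longrightarrow> first_zero_from q f \<le> x"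
proof -
  let ?S = "{x. x \<ge> q \<and> f (complex_of_real x) = 0}"
  have bdd: "bdd_below ?S" by (auto intro: bdd_belowI)
  have "?S = {q..} \<inter> (\<lambda>x. f (complex_of_real x)) -` {0}" by auto
  moreover have "closed \<dots>"
    by (intro closed_Int closed_vimage continuous_on_entire_real[OF f]) auto
  ultimately have "closed ?S" by simp
  then have "Inf ?S \<in> ?S"
    using z bdd by (intro closed_contains_Inf) (auto simp: has_zero_from_def)
  then show "first_zero_from q f \<ge> q" "f (complex_of_real (first_zero_from q f)) = 0"
    by (auto simp: first_zero_from_def)
  show "first_zero_from q f \<le> x" if "x \<ge> q" "f (complex_of_real x) = 0" for x
    unfolding first_zero_from_def using that bdd by (intro cInf_lower) auto
qed

lemma measurable_has_zero_from [measurable]: "Measurable.pred entire_algebra (has_zero_from q)"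
proof -
  have hz: "has_zero_from q f \<longleftrightarrow> (\<exists>n::nat. \<exists>x\<in>{q..q + real n}. f (complex_of_real x) = 0)" for f
  proof
    assume "has_zero_from q f"
    then obtain x where x: "x \<ge> q" "f (complex_of_real x) = 0" by (auto simp: has_zero_from_def)
    obtain n :: nat where "x - q \<le> real n" using real_arch_simple by blast
    then show "\<exists>n::nat. \<exists>x\<in>{q..q + real n}. f (complex_of_real x) = 0"
      using x by (intro exI[of _ n] bexI[of _ x]) auto
  qed (auto simp: has_zero_from_def)
  then have "has_zero_from q = (\<lambda>f. \<exists>n::nat. \<exists>x\<in>{q..q + real n}. f (complex_of_real x) = 0)" by (intro ext hz)
  moreover have "Measurable.pred entire_algebra (\<lambda>f. \<exists>n::nat. \<exists>x\<in>{q..q + real n}. f (complex_of_real x) = 0)"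
    by (intro pred_intros_countable) (use sets_zero_in_interval in \<open>simp add: pred_def\<close>)
  ultimately show ?thesis by simp
qed

lemma measurable_first_zero_from [measurable]: "first_zero_from q \<in> borel_measurable entire_algebra"
proof (rule borel_measurableI_le)
  fix t
  have *: "first_zero_from q f \<le> t \<longleftrightarrow>
      (if has_zero_from q f then \<exists>x\<in>{q..t}. f (complex_of_real x) = 0 else Inf {} \<le> t)"
    if "f holomorphic_on UNIV" for f
  proof (cases "has_zero_from q f")
    case True
    note T = first_zero_from[OF that True]
    have "first_zero_from q f \<le> t \<longleftrightarrow> (\<exists>x\<in>{q..t}. f (complex_of_real x) = 0)"
    proof
      assume "first_zero_from q f \<le> t"
      then show "\<exists>x\<in>{q..t}. f (complex_of_real x) = 0"
        using T(1,2) by (intro bexI[of _ "first_zero_from q f"]) auto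
    next
      assume "\<exists>x\<in>{q..t}. f (complex_of_real x) = 0"
      then obtain x where "q \<le> x" "x \<le> t" "f (complex_of_real x) = 0" by auto
      then show "first_zero_from q f \<le> t" using T(3)[of x] by linarith
    qed
    then show ?thesis using True by simp
  next
    case False
    then have "{x. x \<ge> q \<and> f (complex_of_real x) = 0} = {}" by (auto simp: has_zero_from_def)
    then show ?thesis using False by (simp only: first_zero_from_def if_False)
  qed
  have [measurable]: "Measurable.pred entire_algebra (\<lambda>f. \<exists>x\<in>{q..t}. f (complex_of_real x) = 0)"
    using sets_zero_in_interval by (simp add: pred_def)
  have "{f \<in> space entire_algebra. first_zero_from q f \<le> t} =
    {f \<in> space entire_algebra. if has_zero_from q f then \<exists>x\<in>{q..t}. f (complex_of_real x) = 0 else Inf {} \<le> t}"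
    by (intro Collect_cong conj_cong refl *) simp
  also have "\<dots> \<in> sets entire_algebra" by measurable
  finally show "{f \<in> space entire_algebra. first_zero_from q f \<le> t} \<in> sets entire_algebra" .
qed

text \<open>
  Real zeros of a function that is not identically zero are isolated, so each is the first zero
  after some rational point. This enumerates the real zeros by measurable functions.
\<close>
lemma real_zero_is_first_zero:
  assumes f: "f holomorphic_on UNIV" and nz: "f (complex_of_real y) \<noteq> 0" and x: "f (complex_of_real x) = 0"
  shows "\<exists>r::rat. has_zero_from (of_rat r) f \<and> first_zero_from (of_rat r) f = x"
proof -
  obtain e where e: "e > 0" "\<And>z. z \<in> ball (complex_of_real x) e - {complex_of_real x} \<Longrightarrow> f z \<noteq> 0"
    by (rule isolated_zeros[OF f open_UNIV connected_UNIV UNIV_I x UNIV_I nz]) (use that in blast)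
  obtain r :: rat where r: "x - e < of_rat r" "of_rat r < x"
    using of_rat_dense[of "x - e" x] e(1) by auto
  have h: "has_zero_from (of_rat r) f" using r x by (auto simp: has_zero_from_def intro: less_imp_le)
  note T = first_zero_from[OF f h]
  have "first_zero_from (of_rat r) f \<le> x" using T(3) r x by auto
  moreover have False if "first_zero_from (of_rat r) f < x"
  proof -
    have "dist (complex_of_real x) (complex_of_real (first_zero_from (of_rat r) f)) < e"
      using T(1) r that by (simp add: dist_of_real dist_real_def)
    then show False using e(2) T(2) that by (auto simp: dist_real_def)
  qed
  ultimately show ?thesis using h by force
qed

text \<open>
  The zeros are counted along the enumeration by first zeros after the rationals, a zero being counted
  at the first index at which it appears. The zero function needs its own case, because it has no
  isolated zeros.
\<close>
lemma measurable_zero_count [measurable]: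
  assumes D [measurable]: "D \<in> sets borel"
  shows "(\<lambda>f. zero_count f D) \<in> borel_measurable entire_algebra"
proof -
  define q :: "nat \<Rightarrow> real" where "q i = of_rat (nat_to_rat_surj i)" for i
  define new where "new i f \<longleftrightarrow> has_zero_from (q i) f \<and> first_zero_from (q i) f \<in> D \<and>
     (\<forall>j\<in>{..<i}. \<not> (has_zero_from (q j) f \<and> first_zero_from (q j) f = first_zero_from (q i) f))" for i f
  define cnt where "cnt f = (\<Sum>i. (if new i f then 1 else 0) :: ennreal)" for f
  have new_meas [measurable]: "Measurable.pred entire_algebra (new i)" for i
  proof -
    have [measurable]: "Measurable.pred entire_algebra (\<lambda>f. first_zero_from a f = first_zero_from b f)" for a b
      using borel_measurable_eq[OF measurable_first_zero_from measurable_first_zero_from] by (simp add: pred_def)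
    show ?thesis unfolding new_def by measurable
  qed
  have cnt: "cnt \<in> borel_measurable entire_algebra"
    unfolding cnt_def by measurable
  have eq: "zero_count f D = (if \<forall>r. f (complex_of_real (of_rat r)) = 0 then emeasure (count_space UNIV) D else cnt f)"
    if f: "f holomorphic_on UNIV" for f
  proof (cases "\<forall>r. f (complex_of_real (of_rat r)) = 0")
    case True
    have "f (complex_of_real x) = 0" for x
    proof (rule ccontr)
      assume "f (complex_of_real x) \<noteq> 0"
      moreover have "open ((\<lambda>x. f (complex_of_real x)) -` (- {0}))"
        by (intro open_vimage continuous_on_entire_real[OF f]) auto
      ultimately obtain e where e: "e > 0" "\<And>y. dist y x < e \<Longrightarrow> f (complex_of_real y) \<noteq> 0"
        unfolding open_dist by force
      obtain r :: rat where "x < of_rat r" "of_rat r < x + e"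
        using of_rat_dense[of x "x + e"] e(1) by auto
      then show False using e(2)[of "of_rat r"] True by (auto simp: dist_real_def)
    qed
    then have "real_zeros f = UNIV" by (auto simp: real_zeros_def)
    then show ?thesis using True by (simp add: zero_count_def)
  next
    case False
    then obtain y where y: "f (complex_of_real y) \<noteq> 0" by auto
    define B where "B i = (if new i f then {first_zero_from (q i) f} else {})" for i
    have "disjoint_family B"
      unfolding disjoint_family_on_def
    proof (intro ballI impI)
      fix m n :: nat assume "m \<noteq> n"
      then show "B m \<inter> B n = {}"
        by (cases m n rule: linorder_cases) (auto simp: B_def new_def)
    qed
    then have "(\<Sum>i. emeasure (count_space UNIV) (B i)) = emeasure (count_space UNIV) (\<Union>i. B i)"
      by (intro suminf_emeasure) auto
    moreover have "emeasure (count_space UNIV) (B i) = (if new i f then 1 else 0)" for i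
      by (simp add: B_def)
    moreover have "(\<Union>i. B i) = real_zeros f \<inter> D"
    proof (intro subset_antisym subsetI)
      fix x assume "x \<in> (\<Union>i. B i)"
      then show "x \<in> real_zeros f \<inter> D"
        using first_zero_from(2)[OF f] by (auto simp: B_def new_def real_zeros_def split: if_splits)
    next
      fix x assume x: "x \<in> real_zeros f \<inter> D"
      then obtain r where r: "has_zero_from (of_rat r) f" "first_zero_from (of_rat r) f = x"
        using real_zero_is_first_zero[OF f y] by (auto simp: real_zeros_def)
      let ?P = "\<lambda>i. has_zero_from (q i) f \<and> first_zero_from (q i) f = x"
      obtain i0 where "r = nat_to_rat_surj i0" using surj_nat_to_rat_surj by (metis surjE)
      then have P0: "?P i0" using r by (simp add: q_def)
      define m where "m = (LEAST i. ?P i)"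
      have P: "?P m" unfolding m_def by (rule LeastI[of ?P, OF P0])
      have least: "\<not> ?P j" if "j < m" for j
        using not_less_Least[of j ?P] that unfolding m_def by simp
      have "\<forall>j\<in>{..<m}. \<not> (has_zero_from (q j) f \<and> first_zero_from (q j) f = first_zero_from (q m) f)"
        using least P by simp
      then have "new m f" unfolding new_def using P x by simp
      then have "x \<in> B m" using P by (simp add: B_def)
      then show "x \<in> (\<Union>i. B i)" by blast
    qed
    ultimately have "zero_count f D = cnt f" by (simp add: zero_count_def cnt_def)
    then show ?thesis using False by (simp only: if_False)
  qed
  have "(\<lambda>f. if \<forall>r. f (complex_of_real (of_rat r)) = 0 then emeasure (count_space UNIV) D else cnt f)
      \<in> borel_measurable entire_algebra"
    using cnt by measurable
  then show ?thesis
    by (subst measurable_cong[OF eq]) auto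
qed

text \<open>
  Both zero processes are images of the random entire functions under one measurable map on
  \<open>entire_algebra\<close>, on which the two random functions have the same law.
\<close>
lemma same_distribution_zero_process:
  fixes X :: "'a \<Rightarrow> complex \<Rightarrow> complex" and Y :: "'b \<Rightarrow> complex \<Rightarrow> complex"
  assumes X: "\<And>\<xi>. \<xi> \<in> space M \<Longrightarrow> X \<xi> holomorphic_on UNIV"
    and Y: "\<And>\<xi>. \<xi> \<in> space N \<Longrightarrow> Y \<xi> holomorphic_on UNIV"
    and same: "same_distribution (Pi\<^sub>M UNIV (\<lambda>_. borel)) M (\<lambda>\<xi> x::real. X \<xi> (of_real x)) N (\<lambda>\<xi> x. Y \<xi> (of_real x))"
  shows "same_distribution (Pi\<^sub>M (sets borel) (\<lambda>_. borel)) M (zero_process X) N (zero_process Y)"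
proof -
  let ?P = "Pi\<^sub>M (UNIV :: real set) (\<lambda>_. borel :: complex measure)"
  let ?r = "\<lambda>(f :: complex \<Rightarrow> complex) x::real. f (of_real x)"
  have Xm: "(\<lambda>\<xi>. ?r (X \<xi>)) \<in> measurable M ?P" and Ym: "(\<lambda>\<xi>. ?r (Y \<xi>)) \<in> measurable N ?P"
    and d: "distr M ?P (\<lambda>\<xi>. ?r (X \<xi>)) = distr N ?P (\<lambda>\<xi>. ?r (Y \<xi>))"
    using same by (auto simp: same_distribution_def)
  have X' [measurable]: "X \<in> measurable M entire_algebra" and Y' [measurable]: "Y \<in> measurable N entire_algebra"
    unfolding entire_algebra_def using X Y Xm Ym by (auto intro!: measurable_vimage_algebra2)
  have dd: "distr M entire_algebra X = distr N entire_algebra Y"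
  proof (rule measure_eqI)
    fix A assume "A \<in> sets (distr M entire_algebra X)"
    then have A: "A \<in> sets entire_algebra" by simp
    then obtain B where B: "B \<in> sets ?P" "A = ?r -` B \<inter> {f. f holomorphic_on UNIV}"
      unfolding entire_algebra_def by (subst (asm) sets_vimage_algebra2) (auto simp: space_PiM)
    have "X -` A \<inter> space M = (\<lambda>\<xi>. ?r (X \<xi>)) -` B \<inter> space M" "Y -` A \<inter> space N = (\<lambda>\<xi>. ?r (Y \<xi>)) -` B \<inter> space N"
      using X Y by (auto simp: B(2))
    then show "emeasure (distr M entire_algebra X) A = emeasure (distr N entire_algebra Y) A"
      using A B(1) arg_cong[OF d, of "\<lambda>\<mu>. emeasure \<mu> B"] Xm Ym by (simp add: emeasure_distr)
  qed simp
  let ?Q = "Pi\<^sub>M (sets (borel :: real measure)) (\<lambda>_. borel :: ennreal measure)"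
  define zp where "zp f = (\<lambda>D\<in>sets (borel :: real measure). zero_count f D)" for f
  have zp [measurable]: "zp \<in> measurable entire_algebra ?Q"
    unfolding zp_def by (rule measurable_restrict) simp
  have comp: "zero_process Z = (\<lambda>\<xi>. zp (Z \<xi>))" for Z :: "'c \<Rightarrow> complex \<Rightarrow> complex"
    by (simp add: zero_process_def zp_def fun_eq_iff)
  have "distr M ?Q (zero_process X) = distr (distr M entire_algebra X) ?Q zp"
    by (simp add: distr_distr comp comp_def)
  also have "\<dots> = distr N ?Q (zero_process Y)"
    by (simp add: dd distr_distr comp comp_def)
  finally show ?thesis
    unfolding same_distribution_def comp by simp
qed

section \<open>Kernels of a pair of real entire functions\<close>

text \<open>
  For a function that is real on the real line this is the \<open>n\<close>-th derivative of its restriction to that line.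
\<close>
definition rd :: "(complex \<Rightarrow> complex) \<Rightarrow> nat \<Rightarrow> real \<Rightarrow> real" where
  "rd f n x = Re ((deriv ^^ n) f (of_real x))"

definition wronsk :: "(complex \<Rightarrow> complex) \<Rightarrow> (complex \<Rightarrow> complex) \<Rightarrow> nat \<Rightarrow> nat \<Rightarrow> real \<Rightarrow> real" where
  "wronsk U V j k x = rd U j x * rd V k x - rd V j x * rd U k x"

text \<open>
  The de Branges form of a kernel; the diagonal value is the limit of the quotient.
\<close>
definition pair_kernel :: "(complex \<Rightarrow> complex) \<Rightarrow> (complex \<Rightarrow> complex) \<Rightarrow> real \<Rightarrow> real \<Rightarrow> real" where
  "pair_kernel U V x y =
     (if x = y then wronsk U V 1 0 x else (rd U 0 x * rd V 0 y - rd V 0 x * rd U 0 y) / (x - y))"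

text \<open>
  The value on the diagonal of the mixed second derivative of \<open>ln (pair_kernel U V x y)\<close>, which is one
  sixth of the Schwarzian derivative of \<open>U / V\<close>. It does not change when \<open>U\<close> and \<open>V\<close> are multiplied by a
  common function without zeros.
\<close>
definition zero_speed_sq :: "(complex \<Rightarrow> complex) \<Rightarrow> (complex \<Rightarrow> complex) \<Rightarrow> real \<Rightarrow> real" where
  "zero_speed_sq U V x =
     (wronsk U V 3 0 x / 6 + wronsk U V 2 1 x / 2) / wronsk U V 1 0 x - (wronsk U V 2 0 x / (2 * wronsk U V 1 0 x))\<^sup>2"

lemma has_derivative_rd:
  assumes "f holomorphic_on UNIV"
  shows "(rd f n has_real_derivative rd f (Suc n) x) (at x)"
proof -
  have "(deriv ^^ n) f holomorphic_on UNIV" by (intro holomorphic_higher_deriv assms) auto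
  then have "((deriv ^^ n) f has_field_derivative (deriv ^^ Suc n) f (of_real x)) (at (of_real x))"
    by (simp add: holomorphic_derivI)
  then have "((\<lambda>x. (deriv ^^ n) f (of_real x)) has_vector_derivative (deriv ^^ Suc n) f (of_real x)) (at x)"
    by (rule has_vector_derivative_real_field)
  then have "((\<lambda>x. Re ((deriv ^^ n) f (of_real x))) has_vector_derivative Re ((deriv ^^ Suc n) f (of_real x))) (at x)"
    by (rule bounded_linear.has_vector_derivative[OF bounded_linear_Re])
  then show ?thesis
    unfolding rd_def[abs_def] by (simp add: has_real_derivative_iff_has_vector_derivative)
qed

lemma isCont_rd: "f holomorphic_on UNIV \<Longrightarrow> isCont (rd f n) x"
  using has_derivative_rd DERIV_isCont by blast

lemma has_derivative_wronsk:
  assumes U: "U holomorphic_on UNIV" and V: "V holomorphic_on UNIV"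
  shows "(wronsk U V j k has_real_derivative wronsk U V (Suc j) k x + wronsk U V j (Suc k) x) (at x)"
proof -
  have "((\<lambda>x. rd U j x * rd V k x - rd V j x * rd U k x) has_real_derivative
      wronsk U V (Suc j) k x + wronsk U V j (Suc k) x) (at x)"
    unfolding wronsk_def
    by (auto intro!: derivative_eq_intros has_derivative_rd U V simp: algebra_simps)
  then show ?thesis by (simp add: wronsk_def[abs_def])
qed

lemma isCont_wronsk: "U holomorphic_on UNIV \<Longrightarrow> V holomorphic_on UNIV \<Longrightarrow> isCont (wronsk U V j k) x"
  using has_derivative_wronsk DERIV_isCont by blast

lemma wronsk_diag [simp]: "wronsk U V j j x = 0"
  by (simp add: wronsk_def)

lemma Taylor_between:
  fixes f :: "nat \<Rightarrow> real \<Rightarrow> real"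
  assumes "\<And>m x. (f m has_real_derivative f (Suc m) x) (at x)" "n > 0" "s \<noteq> t"
  shows "\<exists>\<xi>. \<bar>\<xi> - t\<bar> \<le> \<bar>s - t\<bar> \<and> f 0 s = (\<Sum>m<n. (f m t / fact m) * (s - t) ^ m) + (f n \<xi> / fact n) * (s - t) ^ n"
proof -
  have "\<exists>\<xi>. (if s < t then s < \<xi> \<and> \<xi> < t else t < \<xi> \<and> \<xi> < s) \<and>
      f 0 s = (\<Sum>m<n. (f m t / fact m) * (s - t) ^ m) + (f n \<xi> / fact n) * (s - t) ^ n"
    by (rule Taylor[where a = "min s t" and b = "max s t"]) (use assms in auto)
  then obtain \<xi> where "if s < t then s < \<xi> \<and> \<xi> < t else t < \<xi> \<and> \<xi> < s"
    "f 0 s = (\<Sum>m<n. (f m t / fact m) * (s - t) ^ m) + (f n \<xi> / fact n) * (s - t) ^ n" by blast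
  then show ?thesis by (intro exI[of _ \<xi>]) (auto split: if_splits)
qed

text \<open>
  The numerator vanishes to second order on the diagonal. Taylor expansion about \<open>t\<close> to order 2 for the
  Wronskian and to order 3 for \<open>\<lambda>y. U y V t - V y U t\<close> makes the factor \<open>(s - t)\<^sup>2\<close> explicit. Letting \<open>s\<close> and \<open>t\<close> move
  independently is essential, since the limit has to be uniform over all small intervals near \<open>x\<close>.
\<close>
lemma kernel_gap_limit:
  fixes s t :: "'c \<Rightarrow> real"
  assumes U: "U holomorphic_on UNIV" and V: "V holomorphic_on UNIV"
    and s: "(s \<longlongrightarrow> x) F" and t: "(t \<longlongrightarrow> x) F" and ne: "\<And>p. s p \<noteq> t p"
  shows "((\<lambda>p. (wronsk U V 1 0 (s p) * wronsk U V 1 0 (t p) - (pair_kernel U V (s p) (t p))\<^sup>2) / (s p - t p)\<^sup>2)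
      \<longlongrightarrow> wronsk U V 1 0 x * (wronsk U V 3 0 x / 6 + wronsk U V 2 1 x / 2) - (wronsk U V 2 0 x / 2)\<^sup>2) F"
proof -
  let ?w = "wronsk U V"
  have contR: "((\<lambda>p. rd f n (g p)) \<longlongrightarrow> rd f n x) F"
    if "f holomorphic_on UNIV" "(g \<longlongrightarrow> x) F" for f n and g :: "'c \<Rightarrow> real"
    using isCont_rd[OF that(1)] that(2) by (rule isCont_tendsto_compose)
  have contW: "((\<lambda>p. ?w j k (g p)) \<longlongrightarrow> ?w j k x) F"
    if "(g \<longlongrightarrow> x) F" for j k and g :: "'c \<Rightarrow> real"
    using isCont_wronsk[OF U V] that by (rule isCont_tendsto_compose)
  have lim_between: "(\<xi> \<longlongrightarrow> x) F" if "\<And>p. \<bar>\<xi> p - t p\<bar> \<le> \<bar>s p - t p\<bar>" for \<xi>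
  proof -
    have st: "((\<lambda>p. \<bar>s p - t p\<bar>) \<longlongrightarrow> 0) F"
      using tendsto_rabs[OF tendsto_diff[OF s t]] by simp
    have "((\<lambda>p. \<xi> p - t p) \<longlongrightarrow> 0) F"
      by (rule Lim_null_comparison[OF _ st]) (use that in simp)
    from tendsto_add[OF this t] show ?thesis by simp
  qed
  have "\<exists>\<xi>. \<bar>\<xi> - t p\<bar> \<le> \<bar>s p - t p\<bar> \<and>
      ?w 1 0 (s p) = ?w 1 0 (t p) + (s p - t p) * ?w 2 0 (t p) + (s p - t p)\<^sup>2 / 2 * (?w 3 0 \<xi> + ?w 2 1 \<xi>)" for p
  proof -
    define f where "f m = (case m of 0 \<Rightarrow> ?w 1 0 | Suc 0 \<Rightarrow> ?w 2 0 | _ \<Rightarrow> (\<lambda>x. ?w 3 0 x + ?w 2 1 x))" for m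
    have "\<exists>\<xi>. (if s p < t p then s p < \<xi> \<and> \<xi> < t p else t p < \<xi> \<and> \<xi> < s p) \<and>
      ?w 1 0 (s p) = (\<Sum>m<2. (f m (t p) / fact m) * (s p - t p) ^ m) + (f 2 \<xi> / fact 2) * (s p - t p) ^ 2"
    proof (rule Taylor[where a = "min (s p) (t p)" and b = "max (s p) (t p)"])
      show "\<forall>m y. m < 2 \<and> min (s p) (t p) \<le> y \<and> y \<le> max (s p) (t p) \<longrightarrow> (f m has_real_derivative f (Suc m) y) (at y)"
      proof (intro allI impI)
        fix m y assume "m < (2::nat) \<and> min (s p) (t p) \<le> y \<and> y \<le> max (s p) (t p)"
        then consider "m = 0" | "m = 1" by linarith
        then show "(f m has_real_derivative f (Suc m) y) (at y)"
          using has_derivative_wronsk[OF U V, of 1 0 y] has_derivative_wronsk[OF U V, of 2 0 y]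
          by cases (simp_all add: f_def numeral_2_eq_2 numeral_3_eq_3)
      qed
    qed (use ne[of p] in \<open>auto simp: f_def\<close>)
    then obtain \<xi> where "if s p < t p then s p < \<xi> \<and> \<xi> < t p else t p < \<xi> \<and> \<xi> < s p"
      and eq: "?w 1 0 (s p) = (\<Sum>m<2. (f m (t p) / fact m) * (s p - t p) ^ m) + (f 2 \<xi> / fact 2) * (s p - t p) ^ 2"
      by blast
    then have "\<bar>\<xi> - t p\<bar> \<le> \<bar>s p - t p\<bar>" by (auto split: if_splits)
    with eq show ?thesis
      by (intro exI[of _ \<xi>]) (simp add: f_def numeral_2_eq_2 field_simps)
  qed
  then obtain \<xi> where \<xi>: "\<And>p. \<bar>\<xi> p - t p\<bar> \<le> \<bar>s p - t p\<bar>"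
    and Ws: "\<And>p. ?w 1 0 (s p) = ?w 1 0 (t p) + (s p - t p) * ?w 2 0 (t p) + (s p - t p)\<^sup>2 / 2 * (?w 3 0 (\<xi> p) + ?w 2 1 (\<xi> p))"
    by metis
  have "\<exists>\<eta>. \<bar>\<eta> - t p\<bar> \<le> \<bar>s p - t p\<bar> \<and>
      rd U 0 (s p) * rd V 0 (t p) - rd V 0 (s p) * rd U 0 (t p) =
      (s p - t p) * ?w 1 0 (t p) + (s p - t p)\<^sup>2 / 2 * ?w 2 0 (t p) +
      (s p - t p) ^ 3 / 6 * (rd U 3 \<eta> * rd V 0 (t p) - rd V 3 \<eta> * rd U 0 (t p))" for p
  proof -
    have "((\<lambda>y. rd U m y * rd V 0 (t p) - rd V m y * rd U 0 (t p)) has_real_derivative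
        rd U (Suc m) y * rd V 0 (t p) - rd V (Suc m) y * rd U 0 (t p)) (at y)" for m y
      by (auto intro!: derivative_eq_intros has_derivative_rd U V)
    from Taylor_between[where f = "\<lambda>m y. rd U m y * rd V 0 (t p) - rd V m y * rd U 0 (t p)" and n = 3, OF this _ ne[of p]]
    obtain \<eta> where \<eta>: "\<bar>\<eta> - t p\<bar> \<le> \<bar>s p - t p\<bar>"
      and eq: "rd U 0 (s p) * rd V 0 (t p) - rd V 0 (s p) * rd U 0 (t p) =
        (\<Sum>m<3. (rd U m (t p) * rd V 0 (t p) - rd V m (t p) * rd U 0 (t p)) / fact m * (s p - t p) ^ m) +
        (rd U 3 \<eta> * rd V 0 (t p) - rd V 3 \<eta> * rd U 0 (t p)) / fact 3 * (s p - t p) ^ 3"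
      by auto
    have "(\<Sum>m<3. g m) = g 0 + g 1 + g 2" for g :: "nat \<Rightarrow> real" by (simp add: numeral_3_eq_3 numeral_2_eq_2)
    with eq have "rd U 0 (s p) * rd V 0 (t p) - rd V 0 (s p) * rd U 0 (t p) =
      (s p - t p) * ?w 1 0 (t p) + (s p - t p)\<^sup>2 / 2 * ?w 2 0 (t p) +
      (s p - t p) ^ 3 / 6 * (rd U 3 \<eta> * rd V 0 (t p) - rd V 3 \<eta> * rd U 0 (t p))"
      by (simp add: wronsk_def fact_numeral mult.commute)
    with \<eta> show ?thesis by blast
  qed
  then obtain \<eta> where \<eta>: "\<And>p. \<bar>\<eta> p - t p\<bar> \<le> \<bar>s p - t p\<bar>"
    and Ds: "\<And>p. rd U 0 (s p) * rd V 0 (t p) - rd V 0 (s p) * rd U 0 (t p) =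
      (s p - t p) * ?w 1 0 (t p) + (s p - t p)\<^sup>2 / 2 * ?w 2 0 (t p) +
      (s p - t p) ^ 3 / 6 * (rd U 3 (\<eta> p) * rd V 0 (t p) - rd V 3 (\<eta> p) * rd U 0 (t p))"
    by metis
  define a where "a p = ?w 3 0 (\<xi> p) + ?w 2 1 (\<xi> p)" for p
  define b where "b p = rd U 3 (\<eta> p) * rd V 0 (t p) - rd V 3 (\<eta> p) * rd U 0 (t p)" for p
  have a: "(a \<longlongrightarrow> ?w 3 0 x + ?w 2 1 x) F"
    unfolding a_def by (intro tendsto_intros contW lim_between \<xi>)
  have b: "(b \<longlongrightarrow> ?w 3 0 x) F"
    unfolding b_def wronsk_def by (intro tendsto_intros contR lim_between \<eta> U V t)
  have alg: "(w + h * p + h\<^sup>2 / 2 * a) * w - (w + h / 2 * p + h\<^sup>2 / 6 * b)\<^sup>2 =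
      h\<^sup>2 * (w * a / 2 - w * b / 3 - p\<^sup>2 / 4 - h * p * b / 6 - h\<^sup>2 * b\<^sup>2 / 36)" for w h p a b :: real
    by (simp add: field_simps power2_eq_square)
  have eq: "(?w 1 0 (s p) * ?w 1 0 (t p) - (pair_kernel U V (s p) (t p))\<^sup>2) / (s p - t p)\<^sup>2 =
     ?w 1 0 (t p) * a p / 2 - ?w 1 0 (t p) * b p / 3 - (?w 2 0 (t p))\<^sup>2 / 4
      - (s p - t p) * ?w 2 0 (t p) * b p / 6 - (s p - t p)\<^sup>2 * (b p)\<^sup>2 / 36" for p
  proof -
    define h where "h = s p - t p"
    have h: "h \<noteq> 0" using ne[of p] by (simp add: h_def)
    have "pair_kernel U V (s p) (t p) = (h * ?w 1 0 (t p) + h\<^sup>2 / 2 * ?w 2 0 (t p) + h ^ 3 / 6 * b p) / h"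
      using ne[of p] Ds[of p] by (simp add: pair_kernel_def h_def b_def)
    also have "\<dots> = ?w 1 0 (t p) + h / 2 * ?w 2 0 (t p) + h\<^sup>2 / 6 * b p"
      using h by (simp add: field_simps power2_eq_square power3_eq_cube)
    finally have k: "pair_kernel U V (s p) (t p) = ?w 1 0 (t p) + h / 2 * ?w 2 0 (t p) + h\<^sup>2 / 6 * b p" .
    have w: "?w 1 0 (s p) = ?w 1 0 (t p) + h * ?w 2 0 (t p) + h\<^sup>2 / 2 * a p"
      using Ws[of p] by (simp add: h_def a_def)
    have "?w 1 0 (s p) * ?w 1 0 (t p) - (pair_kernel U V (s p) (t p))\<^sup>2 =
       h\<^sup>2 * (?w 1 0 (t p) * a p / 2 - ?w 1 0 (t p) * b p / 3 - (?w 2 0 (t p))\<^sup>2 / 4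
      - h * ?w 2 0 (t p) * b p / 6 - h\<^sup>2 * (b p)\<^sup>2 / 36)"
      unfolding k w by (rule alg)
    then show ?thesis using h by (simp add: h_def)
  qed
  have "((\<lambda>p. ?w 1 0 (t p) * a p / 2 - ?w 1 0 (t p) * b p / 3 - (?w 2 0 (t p))\<^sup>2 / 4
      - (s p - t p) * ?w 2 0 (t p) * b p / 6 - (s p - t p)\<^sup>2 * (b p)\<^sup>2 / 36) \<longlongrightarrow>
      ?w 1 0 x * (?w 3 0 x + ?w 2 1 x) / 2 - ?w 1 0 x * ?w 3 0 x / 3 - (?w 2 0 x)\<^sup>2 / 4
      - (x - x) * ?w 2 0 x * ?w 3 0 x / 6 - (x - x)\<^sup>2 * (?w 3 0 x)\<^sup>2 / 36) F"
    by (intro tendsto_intros contW a b s t) auto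
  also have "?w 1 0 x * (?w 3 0 x + ?w 2 1 x) / 2 - ?w 1 0 x * ?w 3 0 x / 3 - (?w 2 0 x)\<^sup>2 / 4
      - (x - x) * ?w 2 0 x * ?w 3 0 x / 6 - (x - x)\<^sup>2 * (?w 3 0 x)\<^sup>2 / 36 =
     ?w 1 0 x * (?w 3 0 x / 6 + ?w 2 1 x / 2) - (?w 2 0 x / 2)\<^sup>2"
    by (simp add: field_simps power2_eq_square)
  finally show ?thesis unfolding eq .
qed

lemma pair_kernel_limit:
  fixes s t :: "'c \<Rightarrow> real"
  assumes U: "U holomorphic_on UNIV" and V: "V holomorphic_on UNIV"
    and s: "(s \<longlongrightarrow> x) F" and t: "(t \<longlongrightarrow> x) F" and ne: "\<And>p. s p \<noteq> t p"
  shows "((\<lambda>p. pair_kernel U V (s p) (t p)) \<longlongrightarrow> wronsk U V 1 0 x) F"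
proof -
  have "\<exists>\<eta>. \<bar>\<eta> - t p\<bar> \<le> \<bar>s p - t p\<bar> \<and>
      pair_kernel U V (s p) (t p) = rd U 1 \<eta> * rd V 0 (t p) - rd V 1 \<eta> * rd U 0 (t p)" for p
  proof -
    have "((\<lambda>y. rd U m y * rd V 0 (t p) - rd V m y * rd U 0 (t p)) has_real_derivative
        rd U (Suc m) y * rd V 0 (t p) - rd V (Suc m) y * rd U 0 (t p)) (at y)" for m y
      by (auto intro!: derivative_eq_intros has_derivative_rd U V)
    from Taylor_between[where f = "\<lambda>m y. rd U m y * rd V 0 (t p) - rd V m y * rd U 0 (t p)" and n = 1, OF this _ ne[of p]]
    obtain \<eta> where \<eta>: "\<bar>\<eta> - t p\<bar> \<le> \<bar>s p - t p\<bar>"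
      and eq: "rd U 0 (s p) * rd V 0 (t p) - rd V 0 (s p) * rd U 0 (t p) =
        (rd U 1 \<eta> * rd V 0 (t p) - rd V 1 \<eta> * rd U 0 (t p)) * (s p - t p)"
      by (auto simp: mult.commute)
    then show ?thesis
      using ne[of p] by (intro exI[of _ \<eta>]) (simp add: pair_kernel_def)
  qed
  then obtain \<eta> where \<eta>: "\<And>p. \<bar>\<eta> p - t p\<bar> \<le> \<bar>s p - t p\<bar>"
    and eq: "\<And>p. pair_kernel U V (s p) (t p) = rd U 1 (\<eta> p) * rd V 0 (t p) - rd V 1 (\<eta> p) * rd U 0 (t p)"
    by metis
  have st: "((\<lambda>p. \<bar>s p - t p\<bar>) \<longlongrightarrow> 0) F"
    using tendsto_rabs[OF tendsto_diff[OF s t]] by simp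
  have "((\<lambda>p. \<eta> p - t p) \<longlongrightarrow> 0) F"
    by (rule Lim_null_comparison[OF _ st]) (use \<eta> in simp)
  from tendsto_add[OF this t] have \<eta>x: "(\<eta> \<longlongrightarrow> x) F" by simp
  show ?thesis unfolding eq wronsk_def
    by (intro tendsto_intros isCont_tendsto_compose[OF isCont_rd] U V \<eta>x t)
qed

text \<open>
  The arctangent is the angle between two Gaussian variables whose covariance is the kernel; for small
  angles it may be replaced by its tangent.
\<close>
lemma angular_speed_limit:
  fixes s t :: "'c \<Rightarrow> real"
  assumes U: "U holomorphic_on UNIV" and V: "V holomorphic_on UNIV"
    and s: "(s \<longlongrightarrow> x) F" and t: "(t \<longlongrightarrow> x) F" and ne: "\<And>p. s p \<noteq> t p"
    and W: "wronsk U V 1 0 x > 0"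
  shows "((\<lambda>p. arctan (sqrt (wronsk U V 1 0 (s p) * wronsk U V 1 0 (t p) - (pair_kernel U V (s p) (t p))\<^sup>2)
              / pair_kernel U V (s p) (t p)) / \<bar>s p - t p\<bar>)
      \<longlongrightarrow> sqrt (zero_speed_sq U V x)) F"
proof -
  let ?w = "wronsk U V"
  \<comment> \<open>Writing \<open>arctan z = z * g z\<close> with \<open>g\<close> continuous avoids a division by the angle, which may vanish.\<close>
  define g where "g z = (if z = 0 then 1 else arctan z / z)" for z :: real
  have gz: "arctan z = z * g z" for z by (simp add: g_def)
  have "((\<lambda>z. arctan z / z) \<longlongrightarrow> 1) (at 0)"
  proof -
    have "(arctan has_real_derivative inverse (1 + 0\<^sup>2)) (at 0)" by (rule DERIV_arctan)
    then show ?thesis by (simp add: has_field_derivative_iff)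
  qed
  then have "isCont g 0"
    unfolding isCont_def by (auto simp: g_def intro: Lim_transform_eventually simp: eventually_at_filter)
  then have g: "isCont g 0" .
  define k where "k p = pair_kernel U V (s p) (t p)" for p
  define G where "G p = (?w 1 0 (s p) * ?w 1 0 (t p) - (k p)\<^sup>2) / (s p - t p)\<^sup>2" for p
  have k: "(k \<longlongrightarrow> ?w 1 0 x) F" unfolding k_def by (rule pair_kernel_limit[OF U V s t ne])
  have G: "(G \<longlongrightarrow> ?w 1 0 x * (?w 3 0 x / 6 + ?w 2 1 x / 2) - (?w 2 0 x / 2)\<^sup>2) F"
    unfolding G_def k_def by (rule kernel_gap_limit[OF U V s t ne])
  define z where "z p = sqrt (G p) * \<bar>s p - t p\<bar> / k p" for p
  have "(z \<longlongrightarrow> sqrt (?w 1 0 x * (?w 3 0 x / 6 + ?w 2 1 x / 2) - (?w 2 0 x / 2)\<^sup>2) * \<bar>x - x\<bar> / ?w 1 0 x) F"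
    unfolding z_def by (intro tendsto_intros s t k G) (use W in simp)
  then have "(z \<longlongrightarrow> 0) F" by simp
  then have gz_lim: "((\<lambda>p. g (z p)) \<longlongrightarrow> 1) F"
    using isCont_tendsto_compose[OF g] by (force simp: g_def)
  have "((\<lambda>p. sqrt (G p) / k p * g (z p)) \<longlongrightarrow>
      sqrt (?w 1 0 x * (?w 3 0 x / 6 + ?w 2 1 x / 2) - (?w 2 0 x / 2)\<^sup>2) / ?w 1 0 x * 1) F"
    by (intro tendsto_intros k G gz_lim) (use W in simp)
  also have "sqrt (?w 1 0 x * (?w 3 0 x / 6 + ?w 2 1 x / 2) - (?w 2 0 x / 2)\<^sup>2) / ?w 1 0 x * 1 = sqrt (zero_speed_sq U V x)"
  proof -
    have "zero_speed_sq U V x = (?w 1 0 x * (?w 3 0 x / 6 + ?w 2 1 x / 2) - (?w 2 0 x / 2)\<^sup>2) / (?w 1 0 x)\<^sup>2"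
      using W unfolding zero_speed_sq_def by (simp add: field_simps power2_eq_square)
    then show ?thesis using W by (simp add: real_sqrt_divide)
  qed
  also have "(\<lambda>p. sqrt (G p) / k p * g (z p)) =
     (\<lambda>p. arctan (sqrt (?w 1 0 (s p) * ?w 1 0 (t p) - (k p)\<^sup>2) / k p) / \<bar>s p - t p\<bar>)"
  proof
    fix p
    have h: "\<bar>s p - t p\<bar> \<noteq> 0" using ne[of p] by simp
    have "sqrt (?w 1 0 (s p) * ?w 1 0 (t p) - (k p)\<^sup>2) / k p = z p"
      using h by (simp add: z_def G_def real_sqrt_divide)
    then show "sqrt (G p) / k p * g (z p) = arctan (sqrt (?w 1 0 (s p) * ?w 1 0 (t p) - (k p)\<^sup>2) / k p) / \<bar>s p - t p\<bar>"
      using h by (simp add: gz) (simp add: z_def)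
  qed
  finally show ?thesis unfolding k_def .
qed

text \<open>
  The classical passage from the Schwarzian to a linear equation: after division by the square root of
  their Wronskian, \<open>U\<close> and \<open>V\<close> satisfy the same equation \<open>y'' = - 3 q y\<close>. Differentiation uses that
  \<open>h = - W' / (2 W)\<close> is the logarithmic derivative of \<open>g = 1 / sqrt W\<close>, and that \<open>f''\<close> is a combination of \<open>f\<close> and \<open>f'\<close> whose
  coefficients are quotients of Wronskians.
\<close>
lemma normalized_pair_ode:
  assumes U: "U holomorphic_on UNIV" and V: "V holomorphic_on UNIV"
    and W: "\<And>x. wronsk U V 1 0 x > 0" and f: "f = U \<or> f = V"
  defines "g \<equiv> (\<lambda>x. 1 / sqrt (wronsk U V 1 0 x))"
    and "h \<equiv> (\<lambda>x. - wronsk U V 2 0 x / (2 * wronsk U V 1 0 x))"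
  shows "((\<lambda>x. rd f 0 x * g x) has_real_derivative g x * (rd f 1 x + h x * rd f 0 x)) (at x)"
    and "((\<lambda>x. g x * (rd f 1 x + h x * rd f 0 x)) has_real_derivative
           - 3 * zero_speed_sq U V x * (rd f 0 x * g x)) (at x)"
proof -
  let ?w = "wronsk U V"
  have fh: "f holomorphic_on UNIV" using f U V by auto
  have dW: "(?w 1 0 has_real_derivative ?w 2 0 y) (at y)" for y
    using has_derivative_wronsk[OF U V, of 1 0 y] by (simp add: numeral_2_eq_2)
  have dW2: "(?w 2 0 has_real_derivative ?w 3 0 y + ?w 2 1 y) (at y)" for y
    using has_derivative_wronsk[OF U V, of 2 0 y] by (simp add: numeral_2_eq_2 numeral_3_eq_3)
  have df: "(rd f 0 has_real_derivative rd f 1 y) (at y)" "(rd f 1 has_real_derivative rd f 2 y) (at y)" for y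
    using has_derivative_rd[OF fh, of 0 y] has_derivative_rd[OF fh, of 1 y] by (simp_all add: numeral_2_eq_2)
  have dg: "(g has_real_derivative g y * h y) (at y)" for y
  proof -
    have "((\<lambda>x. 1 / sqrt (?w 1 0 x)) has_real_derivative
        - (?w 2 0 y / (sqrt (?w 1 0 y) * 2)) / (sqrt (?w 1 0 y) * sqrt (?w 1 0 y))) (at y)"
      using W[of y] by (auto intro!: derivative_eq_intros dW dW[unfolded One_nat_def] simp: field_simps)
    moreover have "- (?w 2 0 y / (sqrt (?w 1 0 y) * 2)) / (sqrt (?w 1 0 y) * sqrt (?w 1 0 y)) = g y * h y"
      using W[of y] by (simp add: g_def h_def)
    ultimately show ?thesis unfolding g_def[abs_def] by simp
  qed
  have dh: "(h has_real_derivative - (?w 3 0 y + ?w 2 1 y) / (2 * ?w 1 0 y) + 2 * (h y)\<^sup>2) (at y)" for y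
  proof -
    have "((\<lambda>x. - ?w 2 0 x / (2 * ?w 1 0 x)) has_real_derivative
      (- (?w 3 0 y + ?w 2 1 y) * (2 * ?w 1 0 y) - (- ?w 2 0 y) * (2 * ?w 2 0 y)) / ((2 * ?w 1 0 y) * (2 * ?w 1 0 y))) (at y)"
      by (rule DERIV_divide[OF DERIV_minus[OF dW2] DERIV_cmult[OF dW]]) (use W[of y] in simp)
    moreover have "(- (?w 3 0 y + ?w 2 1 y) * (2 * ?w 1 0 y) - (- ?w 2 0 y) * (2 * ?w 2 0 y)) / ((2 * ?w 1 0 y) * (2 * ?w 1 0 y)) =
        - (?w 3 0 y + ?w 2 1 y) / (2 * ?w 1 0 y) + 2 * (h y)\<^sup>2"
      using W[of y] by (simp add: h_def field_simps power2_eq_square)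
    ultimately show ?thesis unfolding h_def[abs_def] by simp
  qed
  show "((\<lambda>x. rd f 0 x * g x) has_real_derivative g x * (rd f 1 x + h x * rd f 0 x)) (at x)"
    by (auto intro!: derivative_eq_intros df dg simp: algebra_simps)
  have rel: "?w 1 0 x * rd f 2 x = ?w 2 0 x * rd f 1 x - ?w 2 1 x * rd f 0 x"
    using f by (auto simp: wronsk_def algebra_simps)
  then have f2: "rd f 2 x = - 2 * h x * rd f 1 x - ?w 2 1 x / ?w 1 0 x * rd f 0 x"
    using W[of x] by (simp add: h_def field_simps)
  let ?h' = "- (?w 3 0 x + ?w 2 1 x) / (2 * ?w 1 0 x) + 2 * (h x)\<^sup>2"
  have "((\<lambda>x. g x * (rd f 1 x + h x * rd f 0 x)) has_real_derivative
      g x * h x * (rd f 1 x + h x * rd f 0 x) + (rd f 2 x + (?h' * rd f 0 x + rd f 1 x * h x)) * g x) (at x)"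
    by (intro DERIV_mult DERIV_add df dg dh)
  also have "g x * h x * (rd f 1 x + h x * rd f 0 x) + (rd f 2 x + (?h' * rd f 0 x + rd f 1 x * h x)) * g x =
      - 3 * ((?w 3 0 x / 6 + ?w 2 1 x / 2) / ?w 1 0 x - (h x)\<^sup>2) * (rd f 0 x * g x)"
  proof -
    have "G * H * (F1 + H * F0) + (- 2 * H * F1 - b * k * F0 + ((- (a + b) * k / 2 + 2 * H\<^sup>2) * F0 + F1 * H)) * G =
       - 3 * ((a / 6 + b / 2) * k - H\<^sup>2) * (F0 * G)" for G H F0 F1 a b k :: real
      by algebra
    note alg = this
    define k where "k = 1 / ?w 1 0 x"
    have e: "X / (2 * ?w 1 0 x) = X * k / 2" "X / ?w 1 0 x = X * k" for X
      by (simp_all add: k_def)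
    show ?thesis unfolding f2 e by (rule alg)
  qed
  also have "(?w 3 0 x / 6 + ?w 2 1 x / 2) / ?w 1 0 x - (h x)\<^sup>2 = zero_speed_sq U V x"
    by (simp add: zero_speed_sq_def h_def)
  finally show "((\<lambda>x. g x * (rd f 1 x + h x * rd f 0 x)) has_real_derivative
           - 3 * zero_speed_sq U V x * (rd f 0 x * g x)) (at x)" .
qed

lemma wronskian_constant:
  fixes y z y1 z1 l :: "real \<Rightarrow> real"
  assumes "\<And>x. (y has_real_derivative y1 x) (at x)" "\<And>x. (y1 has_real_derivative l x * y x) (at x)"
    and "\<And>x. (z has_real_derivative z1 x) (at x)" "\<And>x. (z1 has_real_derivative l x * z x) (at x)"
  shows "\<exists>c. \<forall>x. y1 x * z x - y x * z1 x = c"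
proof -
  have "((\<lambda>x. y1 x * z x - y x * z1 x) has_real_derivative 0) (at x)" for x
    by (auto intro!: derivative_eq_intros assms simp: algebra_simps)
  then have "(y1 x * z x - y x * z1 x) = (y1 0 * z 0 - y 0 * z1 0)" for x
    using DERIV_isconst_all[of "\<lambda>x. y1 x * z x - y x * z1 x"] by blast
  then show ?thesis by blast
qed

text \<open>
  Two fundamental systems of the same linear equation are related by a constant matrix. Its entries are
  Wronskians of one solution from each system, which are constant. The normalization makes both Wronskians 1 and hence the determinant 1.
\<close>
lemma normalized_pairs_linear_relation:
  assumes U: "U holomorphic_on UNIV" and V: "V holomorphic_on UNIV" and W: "\<And>x. wronsk U V 1 0 x > 0"
    and U': "U' holomorphic_on UNIV" and V': "V' holomorphic_on UNIV" and W': "\<And>x. wronsk U' V' 1 0 x > 0"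
    and q: "\<And>x. zero_speed_sq U V x = zero_speed_sq U' V' x"
  shows "\<exists>a b c d \<sigma>. a * d - b * c = (1::real) \<and> (\<forall>x. \<sigma> x > (0::real) \<and>
     (\<sigma> x)\<^sup>2 * wronsk U V 1 0 x = wronsk U' V' 1 0 x \<and>
     rd U' 0 x = \<sigma> x * (a * rd U 0 x + b * rd V 0 x) \<and> rd V' 0 x = \<sigma> x * (c * rd U 0 x + d * rd V 0 x))"
proof -
  define g where "g x = 1 / sqrt (wronsk U V 1 0 x)" for x
  define h where "h x = - wronsk U V 2 0 x / (2 * wronsk U V 1 0 x)" for x
  define g' where "g' x = 1 / sqrt (wronsk U' V' 1 0 x)" for x
  define h' where "h' x = - wronsk U' V' 2 0 x / (2 * wronsk U' V' 1 0 x)" for x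
  define n where "n f x = rd f 0 x * g x" for f x
  define n1 where "n1 f x = g x * (rd f 1 x + h x * rd f 0 x)" for f x
  define m where "m f x = rd f 0 x * g' x" for f x
  define m1 where "m1 f x = g' x * (rd f 1 x + h' x * rd f 0 x)" for f x
  define l where "l x = - 3 * zero_speed_sq U V x" for x
  have dn: "(n f has_real_derivative n1 f x) (at x)" "(n1 f has_real_derivative l x * n f x) (at x)"
    if "f = U \<or> f = V" for f x
    using normalized_pair_ode[OF U V W that, of x]
    by (simp_all add: n_def[abs_def] n1_def[abs_def] g_def[abs_def] h_def[abs_def] l_def)
  have dm: "(m f has_real_derivative m1 f x) (at x)" "(m1 f has_real_derivative l x * m f x) (at x)"
    if "f = U' \<or> f = V'" for f x
    using normalized_pair_ode[OF U' V' W' that, of x]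
    by (simp_all add: m_def[abs_def] m1_def[abs_def] g'_def[abs_def] h'_def[abs_def] l_def q)
  have w1: "n1 U x * n V x - n U x * n1 V x = 1" for x
  proof -
    have "n1 U x * n V x - n U x * n1 V x = (g x)\<^sup>2 * wronsk U V 1 0 x"
      by (simp add: n_def n1_def wronsk_def power2_eq_square algebra_simps)
    then show ?thesis using W[of x] by (simp add: g_def power_divide)
  qed
  have w1': "m1 U' x * m V' x - m U' x * m1 V' x = 1" for x
  proof -
    have "m1 U' x * m V' x - m U' x * m1 V' x = (g' x)\<^sup>2 * wronsk U' V' 1 0 x"
      by (simp add: m_def m1_def wronsk_def power2_eq_square algebra_simps)
    then show ?thesis using W'[of x] by (simp add: g'_def power_divide)
  qed
  have lin: "\<exists>a b. \<forall>x. m f x = a * n U x + b * n V x \<and> m1 f x = a * n1 U x + b * n1 V x"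
    if f: "f = U' \<or> f = V'" for f
  proof -
    obtain a where a: "\<And>x. m1 f x * n V x - m f x * n1 V x = a"
      using wronskian_constant[where y = "m f" and z = "n V", OF dm(1)[OF f] dm(2)[OF f] dn(1) dn(2)] by blast
    obtain b where b: "\<And>x. n1 U x * m f x - n U x * m1 f x = b"
      using wronskian_constant[where y = "n U" and z = "m f", OF dn(1) dn(2) dm(1)[OF f] dm(2)[OF f]] by blast
    have "m f x = a * n U x + b * n V x \<and> m1 f x = a * n1 U x + b * n1 V x" for x
    proof -
      have "a * n U x + b * n V x = m f x * (n1 U x * n V x - n U x * n1 V x)"
        unfolding a[of x, symmetric] b[of x, symmetric] by (simp add: algebra_simps)
      moreover have "a * n1 U x + b * n1 V x = m1 f x * (n1 U x * n V x - n U x * n1 V x)"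
        unfolding a[of x, symmetric] b[of x, symmetric] by (simp add: algebra_simps)
      ultimately show ?thesis using w1 by simp
    qed
    then show ?thesis by blast
  qed
  obtain a b where ab: "\<And>x. m U' x = a * n U x + b * n V x" "\<And>x. m1 U' x = a * n1 U x + b * n1 V x"
    using lin[of U'] by blast
  obtain c d where cd: "\<And>x. m V' x = c * n U x + d * n V x" "\<And>x. m1 V' x = c * n1 U x + d * n1 V x"
    using lin[of V'] by blast
  have "1 = m1 U' 0 * m V' 0 - m U' 0 * m1 V' 0" using w1' by simp
  also have "\<dots> = (a * d - b * c) * (n1 U 0 * n V 0 - n U 0 * n1 V 0)"
    unfolding ab cd by (simp add: algebra_simps)
  finally have det: "a * d - b * c = 1" using w1 by simp
  define \<sigma> where "\<sigma> x = sqrt (wronsk U' V' 1 0 x / wronsk U V 1 0 x)" for x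
  have s: "\<sigma> x > 0" "(\<sigma> x)\<^sup>2 * wronsk U V 1 0 x = wronsk U' V' 1 0 x" for x
    using W[of x] W'[of x] by (auto simp: \<sigma>_def)
  have gs: "g x = \<sigma> x * g' x" "g' x > 0" for x
    using W[of x] W'[of x] by (auto simp: \<sigma>_def g_def g'_def real_sqrt_divide)
  have "rd U' 0 x = \<sigma> x * (a * rd U 0 x + b * rd V 0 x)" for x
  proof -
    have "g' x * rd U' 0 x = g' x * (\<sigma> x * (a * rd U 0 x + b * rd V 0 x))"
      using ab(1)[of x] by (simp add: m_def n_def gs(1) algebra_simps)
    then show ?thesis using gs(2)[of x] by simp
  qed
  moreover have "rd V' 0 x = \<sigma> x * (c * rd U 0 x + d * rd V 0 x)" for x
  proof -
    have "g' x * rd V' 0 x = g' x * (\<sigma> x * (c * rd U 0 x + d * rd V 0 x))"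
      using cd(1)[of x] by (simp add: m_def n_def gs(1) algebra_simps)
    then show ?thesis using gs(2)[of x] by simp
  qed
  ultimately show ?thesis using det s by blast
qed

lemma entire_eqI_real:
  assumes f: "f holomorphic_on UNIV" and g: "g holomorphic_on UNIV"
    and eq: "\<And>x::real. f (of_real x) = g (of_real x)"
  shows "f z = g z"
proof -
  have h: "(\<lambda>z. f z - g z) holomorphic_on UNIV" by (intro holomorphic_intros f g)
  have l: "complex_of_real 0 islimpt range complex_of_real"
  proof (rule islimpt_approachable[THEN iffD2], intro allI impI)
    fix e :: real assume "e > 0"
    then show "\<exists>x'\<in>range complex_of_real. x' \<noteq> complex_of_real 0 \<and> dist x' (complex_of_real 0) < e"
      by (intro bexI[of _ "complex_of_real (e / 2)"] rangeI) auto
  qed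
  have "f z - g z = 0"
    by (rule analytic_continuation[OF h open_UNIV connected_UNIV subset_UNIV UNIV_I l]) (auto simp: eq)
  then show ?thesis by simp
qed

text \<open>
  The quotient of two proportional pairs without common zeros: at each point one of the two formulas
  for the quotient applies.
\<close>
lemma entire_quotient:
  assumes P: "P holomorphic_on UNIV" "Q holomorphic_on UNIV" and no: "\<And>z. \<not> (P z = 0 \<and> Q z = 0)"
    and U: "U holomorphic_on UNIV" "V holomorphic_on UNIV" and no': "\<And>z. \<not> (U z = 0 \<and> V z = 0)"
    and cross: "\<And>z. U z * Q z = V z * P z"
  shows "\<exists>S. S holomorphic_on UNIV \<and> (\<forall>z. S z \<noteq> 0 \<and> U z = S z * P z \<and> V z = S z * Q z)"
proof -
  define S where "S z = (if P z \<noteq> 0 then U z / P z else V z / Q z)" for z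
  have SU: "U z = S z * P z" and SV: "V z = S z * Q z" for z
    using cross[of z] no[of z] by (auto simp: S_def field_simps)
  have "S z \<noteq> 0" for z using no'[of z] SU[of z] SV[of z] by auto
  moreover have "S holomorphic_on UNIV"
  proof -
    let ?A = "- (P -` {0})" and ?B = "- (Q -` {0})"
    have op: "open ?A" "open ?B"
      by (auto intro!: open_Compl closed_vimage holomorphic_on_imp_continuous_on P)
    have "S holomorphic_on ?A \<longleftrightarrow> (\<lambda>z. U z / P z) holomorphic_on ?A"
      by (intro holomorphic_cong) (auto simp: S_def)
    moreover have "(\<lambda>z. U z / P z) holomorphic_on ?A"
      by (intro holomorphic_on_divide holomorphic_on_subset[OF U(1)] holomorphic_on_subset[OF P(1)]) auto
    moreover have "S holomorphic_on ?B \<longleftrightarrow> (\<lambda>z. V z / Q z) holomorphic_on ?B"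
      by (intro holomorphic_cong) (auto simp: SV)
    moreover have "(\<lambda>z. V z / Q z) holomorphic_on ?B"
      by (intro holomorphic_on_divide holomorphic_on_subset[OF U(2)] holomorphic_on_subset[OF P(2)]) auto
    ultimately have "S holomorphic_on (?A \<union> ?B)"
      using op by (intro holomorphic_on_Un) auto
    moreover have "?A \<union> ?B = UNIV" using no by auto
    ultimately show ?thesis by simp
  qed
  ultimately show ?thesis using SU SV by blast
qed

text \<open>
  The relation \<open>(U', V') = \<sigma> * A (U, V)\<close> on the real line gives a proportionality of entire pairs, whose factor is
  the required entire function. Since \<open>det A = 1\<close>, the antisymmetric form \<open>U x V y - V x U y\<close> is multiplied
  exactly by \<open>\<sigma> x * \<sigma> y\<close>.
\<close>
theorem equal_speed_imp_kernel_scaling: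
  assumes U: "U holomorphic_on UNIV" "\<And>x::real. U (of_real x) \<in> \<real>"
    and V: "V holomorphic_on UNIV" "\<And>x::real. V (of_real x) \<in> \<real>"
    and no: "\<And>z. \<not> (U z = 0 \<and> V z = 0)" and W: "\<And>x. wronsk U V 1 0 x > 0"
    and U': "U' holomorphic_on UNIV" "\<And>x::real. U' (of_real x) \<in> \<real>"
    and V': "V' holomorphic_on UNIV" "\<And>x::real. V' (of_real x) \<in> \<real>"
    and no': "\<And>z. \<not> (U' z = 0 \<and> V' z = 0)" and W': "\<And>x. wronsk U' V' 1 0 x > 0"
    and q: "\<And>x. zero_speed_sq U V x = zero_speed_sq U' V' x"
  shows "\<exists>S \<sigma>. S holomorphic_on UNIV \<and> (\<forall>z. S z \<noteq> 0) \<and> (\<forall>x::real. S (of_real x) = of_real (\<sigma> x)) \<and>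
     (\<forall>x y. pair_kernel U' V' x y = \<sigma> x * \<sigma> y * pair_kernel U V x y)"
proof -
  obtain a b c d \<sigma> where det: "a * d - b * c = (1::real)"
    and s: "\<And>x. \<sigma> x > (0::real)" "\<And>x. (\<sigma> x)\<^sup>2 * wronsk U V 1 0 x = wronsk U' V' 1 0 x"
    and rU: "\<And>x. rd U' 0 x = \<sigma> x * (a * rd U 0 x + b * rd V 0 x)"
    and rV: "\<And>x. rd V' 0 x = \<sigma> x * (c * rd U 0 x + d * rd V 0 x)"
    using normalized_pairs_linear_relation[OF U(1) V(1) W U'(1) V'(1) W' q] by blast
  have re: "f (of_real x) = of_real (rd f 0 x)" if "f (of_real x) \<in> \<real>" for f and x :: real
    using that by (simp add: rd_def)
  define P where "P z = of_real a * U z + of_real b * V z" for z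
  define Q where "Q z = of_real c * U z + of_real d * V z" for z
  have P: "P holomorphic_on UNIV" and Q: "Q holomorphic_on UNIV"
    unfolding P_def[abs_def] Q_def[abs_def] by (intro holomorphic_intros U V)+
  have PQ: "\<not> (P z = 0 \<and> Q z = 0)" for z
  proof
    assume 0: "P z = 0 \<and> Q z = 0"
    have det': "complex_of_real a * of_real d - of_real b * of_real c = 1"
      using det by (metis of_real_1 of_real_diff of_real_mult)
    have "of_real d * P z - of_real b * Q z = (of_real a * of_real d - of_real b * of_real c) * U z"
      "of_real a * Q z - of_real c * P z = (of_real a * of_real d - of_real b * of_real c) * V z"
      by (simp_all add: P_def Q_def algebra_simps)
    then have "U z = 0" "V z = 0" using 0 det' by auto
    then show False using no by blast
  qed
  have PR: "P (of_real x) = of_real (a * rd U 0 x + b * rd V 0 x)"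
    and QR: "Q (of_real x) = of_real (c * rd U 0 x + d * rd V 0 x)" for x :: real
    by (simp_all add: P_def Q_def re U V)
  have UR: "U' (of_real x) = of_real (\<sigma> x) * P (of_real x)" and VR: "V' (of_real x) = of_real (\<sigma> x) * Q (of_real x)" for x :: real
    unfolding PR QR by (simp_all add: re U' V' rU rV)
  have cross: "U' z * Q z = V' z * P z" for z
    by (rule entire_eqI_real) (auto intro!: holomorphic_intros U' V' P Q simp: UR VR)
  obtain S where S: "S holomorphic_on UNIV" "\<And>z. S z \<noteq> 0" "\<And>z. U' z = S z * P z" "\<And>z. V' z = S z * Q z"
    using entire_quotient[OF P Q PQ U'(1) V'(1) no' cross] by blast
  have SR: "S (of_real x) = of_real (\<sigma> x)" for x :: real
    using PQ[of "of_real x"] S(3)[of "of_real x"] S(4)[of "of_real x"] UR[of x] VR[of x] by auto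
  have "pair_kernel U' V' x y = \<sigma> x * \<sigma> y * pair_kernel U V x y" for x y
  proof (cases "x = y")
    case True
    then show ?thesis using s(2)[of x] by (simp add: pair_kernel_def power2_eq_square)
  next
    case False
    have "rd U' 0 x * rd V' 0 y - rd V' 0 x * rd U' 0 y =
       \<sigma> x * \<sigma> y * ((a * d - b * c) * (rd U 0 x * rd V 0 y - rd V 0 x * rd U 0 y))"
      unfolding rU rV by (simp add: algebra_simps)
    then show ?thesis using False det by (simp add: pair_kernel_def)
  qed
  then show ?thesis using S SR by blast
qed

section \<open>Counting simple zeros by sign changes on a grid\<close>

text \<open>
  The partition has \<open>n + 1\<close> cells, so that it is meaningful for every \<open>n\<close>, with \<open>{a..b}\<close> itself as the only cell for \<open>n = 0\<close>.
\<close>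
definition grid :: "real \<Rightarrow> real \<Rightarrow> nat \<Rightarrow> nat \<Rightarrow> real" where
  "grid a b n i = a + (b - a) * real i / real (Suc n)"

definition sign_changes :: "(real \<Rightarrow> real) \<Rightarrow> real \<Rightarrow> real \<Rightarrow> nat \<Rightarrow> nat" where
  "sign_changes f a b n = card {i. i \<le> n \<and> f (grid a b n i) * f (grid a b n (Suc i)) < 0}"

lemma grid_diff: "grid a b n (Suc i) - grid a b n i = (b - a) / real (Suc n)"
proof -
  have "(b - a) * real (Suc i) = (b - a) * real i + (b - a)" by (simp add: algebra_simps)
  then show ?thesis
    unfolding grid_def by (simp only: add_divide_distrib add.assoc[symmetric] add_diff_cancel_left')
qed

lemma grid_less: "a < b \<Longrightarrow> i < j \<Longrightarrow> grid a b n i < grid a b n j"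
  unfolding grid_def by (simp add: divide_strict_right_mono)

lemma grid_le: "a < b \<Longrightarrow> i \<le> j \<Longrightarrow> grid a b n i \<le> grid a b n j"
  using grid_less[of a b i j n] by (cases "i = j") (auto intro: less_imp_le)

lemma grid_ends [simp]: "grid a b n 0 = a" "grid a b n (Suc n) = b"
  unfolding grid_def by simp_all

lemma grid_range: "a < b \<Longrightarrow> i \<le> Suc n \<Longrightarrow> a \<le> grid a b n i \<and> grid a b n i \<le> b"
  using grid_le[of a b 0 i n] grid_le[of a b i "Suc n" n] by simp

lemma grid_cell:
  assumes ab: "a < b" and x: "a \<le> x" "x \<le> b"
  shows "\<exists>i\<le>n. grid a b n i \<le> x \<and> x \<le> grid a b n (Suc i)"
proof -
  let ?S = "{i. i \<le> n \<and> grid a b n i \<le> x}"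
  define i where "i = Max ?S"
  have fin: "finite ?S" by simp
  have "0 \<in> ?S" using x by simp
  then have "i \<in> ?S" unfolding i_def by (intro Max_in[OF fin]) blast
  then have i: "i \<le> n" "grid a b n i \<le> x" by simp_all
  have "x \<le> grid a b n (Suc i)"
  proof (cases "i = n")
    case True then show ?thesis using x by simp
  next
    case False
    show ?thesis
    proof (rule ccontr)
      assume "\<not> ?thesis"
      then have "Suc i \<in> ?S" using False i by simp
      then have "Suc i \<le> i" unfolding i_def by (rule Max_ge[OF fin])
      then show False by simp
    qed
  qed
  then show ?thesis using i by blast
qed

lemma card_zeros_ge_sign_changes:
  assumes ab: "a < b" and f: "continuous_on UNIV f" and fin: "finite {x\<in>{a..b}. f x = 0}"
  shows "sign_changes f a b n \<le> card {x\<in>{a..b}. f x = 0}"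
proof -
  let ?t = "grid a b n"
  let ?I = "{i. i \<le> n \<and> f (?t i) * f (?t (Suc i)) < 0}"
  have "\<exists>z. ?t i < z \<and> z < ?t (Suc i) \<and> f z = 0" if "i \<in> ?I" for i
  proof -
    have lt: "?t i \<le> ?t (Suc i)" using grid_less[OF ab, of i "Suc i" n] by simp
    have ne: "f (?t i) * f (?t (Suc i)) < 0" using that by simp
    have cont: "continuous_on {?t i..?t (Suc i)} f" using f continuous_on_subset by blast
    obtain z where z: "?t i \<le> z" "z \<le> ?t (Suc i)" "f z = 0"
    proof (cases "f (?t i) < 0")
      case True
      then have "f (?t i) \<le> 0" "0 \<le> f (?t (Suc i))" using ne by (auto simp: mult_less_0_iff)
      then show ?thesis using IVT'[of f "?t i" 0 "?t (Suc i)"] lt cont that by blast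
    next
      case False
      then have "f (?t (Suc i)) \<le> 0" "0 \<le> f (?t i)" using ne by (auto simp: mult_less_0_iff)
      then show ?thesis using IVT2'[of f "?t (Suc i)" 0 "?t i"] lt cont that by blast
    qed
    moreover have "z \<noteq> ?t i" "z \<noteq> ?t (Suc i)" using z(3) ne by auto
    ultimately show ?thesis by (intro exI[of _ z]) auto
  qed
  then obtain z where z: "\<And>i. i \<in> ?I \<Longrightarrow> ?t i < z i \<and> z i < ?t (Suc i) \<and> f (z i) = 0" by metis
  have "inj_on z ?I"
  proof (rule inj_onI)
    fix i j assume ij: "i \<in> ?I" "j \<in> ?I" "z i = z j"
    have no: False if "i < j" "i \<in> ?I" "j \<in> ?I" "z i = z j" for i j
      using z[OF that(2)] z[OF that(3)] grid_le[OF ab, of "Suc i" j n] that by simp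
    show "i = j" using no[of i j] no[of j i] ij by (cases i j rule: linorder_cases) auto
  qed
  moreover have "z ` ?I \<subseteq> {x\<in>{a..b}. f x = 0}"
  proof
    fix y assume "y \<in> z ` ?I"
    then obtain i where i: "i \<in> ?I" "y = z i" by blast
    then have "a \<le> ?t i" "?t (Suc i) \<le> b" using grid_range[OF ab, of i n] grid_range[OF ab, of "Suc i" n] by auto
    then show "y \<in> {x\<in>{a..b}. f x = 0}" using z[OF i(1)] i(2) by auto
  qed
  ultimately show ?thesis
    unfolding sign_changes_def using fin card_inj_on_le by blast
qed

lemma simple_zero_sign_change:
  assumes d: "(f has_real_derivative d) (at x)" "d \<noteq> 0" and x: "f x = 0"
  shows "\<exists>\<delta>>0. \<forall>y. y \<noteq> x \<and> \<bar>y - x\<bar> < \<delta> \<longrightarrow> f y * d * (y - x) > 0"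
proof -
  have "((\<lambda>y. (f y - f x) / (y - x)) \<longlongrightarrow> d) (at x)" using d(1) by (simp add: has_field_derivative_iff)
  then have "((\<lambda>y. f y / (y - x) * d) \<longlongrightarrow> d * d) (at x)" using x by (intro tendsto_intros) simp
  moreover have "d * d > 0" using d(2) by (simp add: zero_less_mult_iff linorder_neq_iff) blast
  ultimately have "eventually (\<lambda>y. f y / (y - x) * d > 0) (at x)" by (rule order_tendstoD)
  then obtain \<delta> where \<delta>: "\<delta> > 0" "\<And>y. y \<noteq> x \<Longrightarrow> dist y x < \<delta> \<Longrightarrow> f y / (y - x) * d > 0"
    unfolding eventually_at by auto
  have "f y * d * (y - x) > 0" if "y \<noteq> x" "\<bar>y - x\<bar> < \<delta>" for y
  proof -
    have "f y / (y - x) * d > 0" using \<delta>(2) that by (simp add: dist_real_def)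
    moreover have "(y - x)\<^sup>2 > 0" using that by simp
    ultimately have "f y / (y - x) * d * (y - x)\<^sup>2 > 0" by (rule mult_pos_pos)
    moreover have "f y / (y - x) * d * (y - x)\<^sup>2 = f y * d * (y - x)" using that by (simp add: power2_eq_square)
    ultimately show ?thesis by simp
  qed
  then show ?thesis using \<delta>(1) by blast
qed

text \<open>
  Near a simple zero the function changes sign and has no other zero. Once the mesh is smaller than
  the size of all these neighbourhoods, distinct zeros lie in distinct cells and each such cell shows a sign
  change.
\<close>
lemma eventually_sign_changes_eq_card_zeros:
  assumes ab: "a < b" and f: "continuous_on UNIV f" and fin: "finite {x\<in>{a..b}. f x = 0}"
    and simple: "\<And>x. x \<in> {a..b} \<Longrightarrow> f x = 0 \<Longrightarrow> \<exists>d. d \<noteq> 0 \<and> (f has_real_derivative d) (at x)"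
    and nz: "\<And>n i. i \<le> Suc n \<Longrightarrow> f (grid a b n i) \<noteq> 0"
  shows "eventually (\<lambda>n. sign_changes f a b n = card {x\<in>{a..b}. f x = 0}) sequentially"
proof -
  let ?Z = "{x\<in>{a..b}. f x = 0}"
  have "\<forall>x\<in>?Z. \<exists>d. d \<noteq> 0 \<and> (f has_real_derivative d) (at x)" using simple by blast
  then obtain d where d: "\<forall>x\<in>?Z. d x \<noteq> 0 \<and> (f has_real_derivative d x) (at x)" by (rule bchoice[THEN exE])
  have "\<forall>x\<in>?Z. \<exists>\<delta>. \<delta> > 0 \<and> (\<forall>y. y \<noteq> x \<and> \<bar>y - x\<bar> < \<delta> \<longrightarrow> f y * d x * (y - x) > 0)"
  proof
    fix x assume "x \<in> ?Z"
    then show "\<exists>\<delta>. \<delta> > 0 \<and> (\<forall>y. y \<noteq> x \<and> \<bar>y - x\<bar> < \<delta> \<longrightarrow> f y * d x * (y - x) > 0)"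
      using simple_zero_sign_change[of f "d x" x] d by blast
  qed
  then obtain \<delta> where *: "\<forall>x\<in>?Z. \<delta> x > 0 \<and> (\<forall>y. y \<noteq> x \<and> \<bar>y - x\<bar> < \<delta> x \<longrightarrow> f y * d x * (y - x) > 0)"
    by (rule bchoice[THEN exE])
  then have \<delta>: "\<And>x. x \<in> ?Z \<Longrightarrow> \<delta> x > 0"
    and sgn: "\<And>x y. x \<in> ?Z \<Longrightarrow> y \<noteq> x \<Longrightarrow> \<bar>y - x\<bar> < \<delta> x \<Longrightarrow> f y * d x * (y - x) > 0"
    by blast+
  have "eventually (\<lambda>n. \<forall>x\<in>?Z. (b - a) / real (Suc n) < \<delta> x) sequentially"
  proof (subst eventually_ball_finite_distrib[OF fin], intro ballI)
    fix x assume x: "x \<in> ?Z"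
    have "(\<lambda>n. (b - a) / real (Suc n)) \<longlonglongrightarrow> 0"
      using LIMSEQ_Suc[OF lim_const_over_n[of "b - a"]] by simp
    then show "eventually (\<lambda>n. (b - a) / real (Suc n) < \<delta> x) sequentially"
      using \<delta>[OF x] by (rule order_tendstoD)
  qed
  then show ?thesis
  proof eventually_elim
    case (elim n)
    let ?t = "grid a b n"
    let ?I = "{i. i \<le> n \<and> f (?t i) * f (?t (Suc i)) < 0}"
    have "\<exists>i\<le>n. ?t i < x \<and> x < ?t (Suc i)" if x: "x \<in> ?Z" for x
    proof -
      obtain i where i: "i \<le> n" "?t i \<le> x" "x \<le> ?t (Suc i)" using grid_cell[OF ab, of x n] x by auto
      moreover have "?t i \<noteq> x" "?t (Suc i) \<noteq> x" using nz[of i n] nz[of "Suc i" n] i(1) x by auto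
      ultimately show ?thesis by (intro exI[of _ i]) auto
    qed
    then obtain c where c: "\<And>x. x \<in> ?Z \<Longrightarrow> c x \<le> n \<and> ?t (c x) < x \<and> x < ?t (Suc (c x))" by metis
    have len: "?t (Suc i) - ?t i < \<delta> x" if "x \<in> ?Z" for x i
      using elim that unfolding grid_diff by blast
    have "c x \<in> ?I" if x: "x \<in> ?Z" for x
    proof -
      have cx: "c x \<le> n" "?t (c x) < x" "x < ?t (Suc (c x))" using c[OF x] by auto
      have "f (?t (c x)) * d x * (?t (c x) - x) > 0" "f (?t (Suc (c x))) * d x * (?t (Suc (c x)) - x) > 0"
        using sgn[OF x, of "?t (c x)"] sgn[OF x, of "?t (Suc (c x))"] len[OF x, of "c x"] cx by auto
      then have "f (?t (c x)) * d x < 0" "f (?t (Suc (c x))) * d x > 0"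
        using cx by (auto simp: zero_less_mult_iff)
      then have "f (?t (c x)) * d x * (f (?t (Suc (c x))) * d x) < 0" by (rule mult_neg_pos)
      then have "(f (?t (c x)) * f (?t (Suc (c x)))) * (d x)\<^sup>2 < 0" by (simp add: power2_eq_square mult_ac)
      then have "f (?t (c x)) * f (?t (Suc (c x))) < 0" by (simp add: mult_less_0_iff not_less)
      then show ?thesis using cx by simp
    qed
    moreover have "inj_on c ?Z"
    proof (rule inj_onI, rule ccontr)
      fix x y assume xy: "x \<in> ?Z" "y \<in> ?Z" "c x = c y" "x \<noteq> y"
      have "\<bar>y - x\<bar> < \<delta> x" using c[OF xy(1)] c[OF xy(2)] len[OF xy(1), of "c x"] xy(3) by auto
      then have "f y * d x * (y - x) > 0" using sgn[OF xy(1)] xy(4) by auto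
      then show False using xy(2) by simp
    qed
    ultimately have "card ?Z \<le> card ?I" by (intro card_inj_on_le[of c]) auto
    then show ?case
      using card_zeros_ge_sign_changes[OF ab f fin, of n] unfolding sign_changes_def by simp
  qed
qed

text \<open>
  The angle between two centred Gaussian variables with covariance \<open>pair_kernel U V\<close>, provided that the
  covariance is positive.
\<close>
definition angle_kernel :: "(complex \<Rightarrow> complex) \<Rightarrow> (complex \<Rightarrow> complex) \<Rightarrow> real \<Rightarrow> real \<Rightarrow> real" where
  "angle_kernel U V s t =
     arctan (sqrt (wronsk U V 1 0 s * wronsk U V 1 0 t - (pair_kernel U V s t)\<^sup>2) / pair_kernel U V s t)"

lemma angle_kernel_uniform:
  assumes U: "U holomorphic_on UNIV" and V: "V holomorphic_on UNIV" and W: "wronsk U V 1 0 x > 0" and \<epsilon>: "\<epsilon> > 0"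
  shows "\<exists>\<delta>>0. \<forall>s t. s \<noteq> t \<and> \<bar>s - x\<bar> < \<delta> \<and> \<bar>t - x\<bar> < \<delta> \<longrightarrow>
     pair_kernel U V s t > 0 \<and> \<bar>angle_kernel U V s t / \<bar>s - t\<bar> - sqrt (zero_speed_sq U V x)\<bar> < \<epsilon>"
proof -
  let ?S = "{p :: real \<times> real. fst p \<noteq> snd p}"
  let ?F = "at (x, x) within ?S"
  \<comment> \<open>Off the diagonal this is the first projection; the value on the diagonal only serves to keep the two points apart.\<close>
  define s where "s p = (if fst p = snd p then snd p + 1 else fst p)" for p :: "real \<times> real"
  have ne: "s p \<noteq> snd p" for p by (simp add: s_def)
  have id: "((\<lambda>p. p) \<longlongrightarrow> (x, x)) ?F" by (rule tendsto_ident_at)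
  have t: "(snd \<longlongrightarrow> x) ?F" using tendsto_snd[OF id] by simp
  have "((\<lambda>p. fst p) \<longlongrightarrow> x) ?F" using tendsto_fst[OF id] by simp
  moreover have "eventually (\<lambda>p. fst p = s p) ?F"
    unfolding eventually_at_filter by (simp add: s_def)
  ultimately have s: "(s \<longlongrightarrow> x) ?F" by (rule Lim_transform_eventually)
  have "eventually (\<lambda>p. pair_kernel U V (s p) (snd p) > 0) ?F"
    using pair_kernel_limit[OF U V s t ne] W by (rule order_tendstoD)
  moreover have "eventually (\<lambda>p. dist (angle_kernel U V (s p) (snd p) / \<bar>s p - snd p\<bar>) (sqrt (zero_speed_sq U V x)) < \<epsilon>) ?F"
    using angular_speed_limit[OF U V s t ne W] \<epsilon> unfolding angle_kernel_def by (rule tendstoD)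
  ultimately have "eventually (\<lambda>p. pair_kernel U V (s p) (snd p) > 0 \<and>
      dist (angle_kernel U V (s p) (snd p) / \<bar>s p - snd p\<bar>) (sqrt (zero_speed_sq U V x)) < \<epsilon>) ?F"
    by (rule eventually_conj)
  then obtain d where d: "d > 0" "\<And>p. p \<in> ?S \<Longrightarrow> p \<noteq> (x, x) \<Longrightarrow> dist p (x, x) < d \<Longrightarrow>
      pair_kernel U V (s p) (snd p) > 0 \<and>
      dist (angle_kernel U V (s p) (snd p) / \<bar>s p - snd p\<bar>) (sqrt (zero_speed_sq U V x)) < \<epsilon>"
    unfolding eventually_at by blast
  show ?thesis
  proof (intro exI[of _ "d / 2"] conjI allI impI)
    show "d / 2 > 0" using d(1) by simp
    fix u v assume uv: "u \<noteq> v \<and> \<bar>u - x\<bar> < d / 2 \<and> \<bar>v - x\<bar> < d / 2"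
    have "dist (u, v) (x, x) \<le> \<bar>u - x\<bar> + \<bar>v - x\<bar>"
      unfolding dist_Pair_Pair dist_real_def by (rule sqrt_sum_squares_le_sum) auto
    then have "dist (u, v) (x, x) < d" using uv by linarith
    moreover have "s (u, v) = u" using uv by (simp add: s_def)
    ultimately show "pair_kernel U V u v > 0"
      "\<bar>angle_kernel U V u v / \<bar>u - v\<bar> - sqrt (zero_speed_sq U V x)\<bar> < \<epsilon>"
      using d(2)[of "(u, v)"] uv by (auto simp: dist_real_def)
  qed
qed

section \<open>The Kac-Rice formula\<close>

text \<open>
  A random entire function that is almost surely real on the real line, where it is a centred Gaussian
  field with a covariance of de Branges form. This is the common ground of the computation of intensities
  and of the comparison of laws.
\<close>
locale gaussian_entire = prob_space M for M :: "'a measure" +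
  fixes F :: "'a \<Rightarrow> complex \<Rightarrow> complex" and U V :: "complex \<Rightarrow> complex"
  assumes F_meas: "\<And>z. (\<lambda>\<xi>. F \<xi> z) \<in> borel_measurable M"
    and F_hol: "\<And>\<xi>. \<xi> \<in> space M \<Longrightarrow> F \<xi> holomorphic_on UNIV"
    and F_real: "AE \<xi> in M. \<forall>x::real. F \<xi> (of_real x) \<in> \<real>"
    and U: "U holomorphic_on UNIV" "\<And>x::real. U (of_real x) \<in> \<real>"
    and V: "V holomorphic_on UNIV" "\<And>x::real. V (of_real x) \<in> \<real>"
    and no_common_zero: "\<And>z. \<not> (U z = 0 \<and> V z = 0)"
    and W: "\<And>x. wronsk U V 1 0 x > 0"
    and char_F: "\<And>I v. finite I \<Longrightarrow> (LINT \<xi>|M. iexp (\<Sum>x\<in>I. v x * rd (F \<xi>) 0 x)) =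
        of_real (exp (- (\<Sum>x\<in>I. \<Sum>y\<in>I. v x * v y * pair_kernel U V x y) / 2))"
begin

lemma X_meas [measurable]: "(\<lambda>\<xi>. rd (F \<xi>) 0 x) \<in> borel_measurable M"
  unfolding rd_def using F_meas by simp

lemma pair_kernel_diag: "pair_kernel U V x x = wronsk U V 1 0 x"
  by (simp add: pair_kernel_def)

lemma char_single: "(LINT \<xi>|M. iexp (v * rd (F \<xi>) 0 t)) = of_real (exp (- (v\<^sup>2 * wronsk U V 1 0 t) / 2))"
  using char_F[of "{t}" "\<lambda>_. v"] by (simp add: pair_kernel_diag power2_eq_square)

lemma char_pair:
  assumes "s \<noteq> t"
  shows "(LINT \<xi>|M. iexp (v * rd (F \<xi>) 0 s + w * rd (F \<xi>) 0 t)) =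
    of_real (exp (- (v\<^sup>2 * wronsk U V 1 0 s + 2 * v * w * pair_kernel U V s t + w\<^sup>2 * wronsk U V 1 0 t) / 2))"
proof -
  have sym: "pair_kernel U V t s = pair_kernel U V s t"
    using assms by (simp add: pair_kernel_def divide_simps) (simp add: algebra_simps)
  let ?v = "(\<lambda>x. if x = s then v else w)"
  have "(LINT \<xi>|M. iexp (\<Sum>x\<in>{s, t}. ?v x * rd (F \<xi>) 0 x)) =
        of_real (exp (- (\<Sum>x\<in>{s, t}. \<Sum>y\<in>{s, t}. ?v x * ?v y * pair_kernel U V x y) / 2))"
    by (rule char_F) simp
  moreover have "(\<Sum>x\<in>{s, t}. ?v x * rd (F \<xi>) 0 x) = v * rd (F \<xi>) 0 s + w * rd (F \<xi>) 0 t" for \<xi>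
    using assms by simp
  moreover have "(\<Sum>x\<in>{s, t}. \<Sum>y\<in>{s, t}. ?v x * ?v y * pair_kernel U V x y) =
      v\<^sup>2 * wronsk U V 1 0 s + 2 * v * w * pair_kernel U V s t + w\<^sup>2 * wronsk U V 1 0 t"
    using assms by (simp add: sym pair_kernel_diag power2_eq_square algebra_simps)
  ultimately show ?thesis by simp
qed

text \<open>
  The density of a centred normal variable with standard deviation \<open>r\<close> is at most \<open>1 / (2 * r)\<close>, because \<open>sqrt (2 * pi) \<ge> 2\<close>.
\<close>
lemma small_value_prob:
  assumes e: "e \<ge> 0"
  shows "measure M {\<xi>\<in>space M. \<bar>rd (F \<xi>) 0 t\<bar> \<le> e} \<le> e / sqrt (wronsk U V 1 0 t)"
proof -
  define r where "r = sqrt (wronsk U V 1 0 t)"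
  have r: "r > 0" "r\<^sup>2 = wronsk U V 1 0 t" using W[of t] by (auto simp: r_def)
  interpret P: prob_space std_gauss by (rule prob_space_normal_density) simp
  have "measure M {\<xi>\<in>space M. \<forall>i\<in>{()}. rd (F \<xi>) 0 t \<in> {-e..e}} =
        measure std_gauss {z\<in>space std_gauss. \<forall>i\<in>{()}. r * z \<in> {-e..e}}"
  proof (rule joint_char_uniqueness)
    fix v :: "unit \<Rightarrow> real"
    have "(LINT z|std_gauss. iexp (\<Sum>i\<in>{()}. v i * (r * z))) = char std_gauss (v () * r)"
      unfolding char_def by (simp add: mult_ac)
    also have "\<dots> = of_real (exp (- ((v ())\<^sup>2 * wronsk U V 1 0 t) / 2))"
      by (simp add: char_std_normal_distribution power_mult_distrib r(2))
    also have "\<dots> = (LINT \<xi>|M. iexp (\<Sum>i\<in>{()}. v i * rd (F \<xi>) 0 t))"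
      using char_single[of "v ()" t] by simp
    finally show "(LINT \<xi>|M. iexp (\<Sum>i\<in>{()}. v i * rd (F \<xi>) 0 t)) = (LINT z|std_gauss. iexp (\<Sum>i\<in>{()}. v i * (r * z)))" ..
  qed (auto simp: prob_space_axioms P.prob_space_axioms)
  also have "{z\<in>space std_gauss. \<forall>i\<in>{()}. r * z \<in> {-e..e}} = {- (e / r)..e / r}"
    using r(1) by (auto simp: field_simps)
  also have "measure std_gauss {- (e / r)..e / r} \<le> e / r"
  proof -
    have half: "std_normal_density x \<le> 1 / 2" for x
    proof -
      have "2 = sqrt 4" by simp
      also have "\<dots> \<le> sqrt (2 * pi)" using pi_gt3 by (intro real_sqrt_le_mono) simp
      finally have "1 / sqrt (2 * pi) \<le> 1 / 2" by (intro divide_left_mono) auto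
      moreover have "exp (- x\<^sup>2 / 2) \<le> 1" by simp
      ultimately have "1 / sqrt (2 * pi) * exp (- x\<^sup>2 / 2) \<le> 1 / 2 * 1" by (intro mult_mono) auto
      then show ?thesis by (simp add: std_normal_density_def)
    qed
    have "emeasure std_gauss {- (e / r)..e / r} = (\<integral>\<^sup>+x. ennreal (std_normal_density x) * indicator {- (e / r)..e / r} x \<partial>lborel)"
      by (simp add: emeasure_density)
    also have "\<dots> \<le> (\<integral>\<^sup>+x. ennreal (1 / 2) * indicator {- (e / r)..e / r} x \<partial>lborel)"
      by (intro nn_integral_mono mult_right_mono ennreal_leI half) simp
    also have "\<dots> = ennreal (1 / 2) * emeasure lborel {- (e / r)..e / r}" by (rule nn_integral_cmult_indicator) simp
    also have "\<dots> = ennreal (1 / 2) * ennreal (2 * (e / r))" using e r(1) by simp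
    also have "\<dots> = ennreal (e / r)" using e r(1) by (subst ennreal_mult[symmetric]) auto
    finally show ?thesis using e r(1) by (simp add: P.emeasure_eq_measure)
  qed
  finally show ?thesis by (simp add: r_def abs_le_iff minus_le_iff conj_commute)
qed

lemma AE_nonzero: "AE \<xi> in M. rd (F \<xi>) 0 t \<noteq> 0"
proof -
  have "measure M {\<xi>\<in>space M. \<bar>rd (F \<xi>) 0 t\<bar> \<le> 0} \<le> 0" using small_value_prob[of 0 t] by simp
  then have "emeasure M {\<xi>\<in>space M. \<not> rd (F \<xi>) 0 t \<noteq> 0} = 0"
    by (simp add: emeasure_eq_measure measure_le_0_iff)
  then show ?thesis by (subst AE_iff_measurable[OF _ refl]) auto
qed

lemma sign_change_prob:
  assumes st: "s \<noteq> t" and C: "pair_kernel U V s t > 0"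
  shows "measure M {\<xi>\<in>space M. rd (F \<xi>) 0 s * rd (F \<xi>) 0 t < 0} = angle_kernel U V s t / pi"
proof -
  let ?X = "\<lambda>\<xi>. rd (F \<xi>) 0 s" and ?Y = "\<lambda>\<xi>. rd (F \<xi>) 0 t"
  have 1: "measure M {\<xi>\<in>space M. ?X \<xi> > 0 \<and> ?Y \<xi> < 0} = angle_kernel U V s t / (2 * pi)"
    unfolding angle_kernel_def
    by (rule gaussian_pair_wedge(2)[OF prob_space_axioms X_meas X_meas char_pair[OF st] W C])
  have 2: "measure M {\<xi>\<in>space M. - ?X \<xi> > 0 \<and> - ?Y \<xi> < 0} = angle_kernel U V s t / (2 * pi)"
    unfolding angle_kernel_def
  proof (rule gaussian_pair_wedge(2)[OF prob_space_axioms _ _ _ W C])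
    fix v w
    show "(LINT \<xi>|M. iexp (v * - ?X \<xi> + w * - ?Y \<xi>)) =
      of_real (exp (- (v\<^sup>2 * wronsk U V 1 0 s + 2 * v * w * pair_kernel U V s t + w\<^sup>2 * wronsk U V 1 0 t) / 2))"
      using char_pair[OF st, of "- v" "- w"] by simp
  qed auto
  have "{\<xi>\<in>space M. ?X \<xi> * ?Y \<xi> < 0} = {\<xi>\<in>space M. ?X \<xi> > 0 \<and> ?Y \<xi> < 0} \<union> {\<xi>\<in>space M. - ?X \<xi> > 0 \<and> - ?Y \<xi> < 0}"
    by (auto simp: mult_less_0_iff)
  moreover have "measure M \<dots> = measure M {\<xi>\<in>space M. ?X \<xi> > 0 \<and> ?Y \<xi> < 0} + measure M {\<xi>\<in>space M. - ?X \<xi> > 0 \<and> - ?Y \<xi> < 0}"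
    by (rule finite_measure_Union) auto
  ultimately show ?thesis using 1 2 by simp
qed

text \<open>
  Near a double zero the function is quadratically small: if \<open>\<bar>f''\<bar> \<le> m\<close>, then a double zero within
  distance \<open>h\<close> of a grid point forces \<open>\<bar>f\<bar> \<le> m * h\<^sup>2\<close> there. This has probability of order \<open>h\<^sup>2\<close>, while
  only about \<open>1 / h\<close> grid points are needed.
\<close>
lemma AE_simple_zeros:
  assumes ab: "a < b"
  shows "AE \<xi> in M. \<forall>x\<in>{a..b}. rd (F \<xi>) 0 x = 0 \<longrightarrow> rd (F \<xi>) 1 x \<noteq> 0"
proof -
  \<comment> \<open>The intermediate point in Taylor's formula is only known to lie within one mesh width of the zero, possibly outside \<open>{a..b}\<close>.\<close>
  let ?J = "{2 * a - b..2 * b - a}"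
  have contW: "continuous_on {a..b} (wronsk U V 1 0)"
    by (intro continuous_at_imp_continuous_on ballI isCont_wronsk U V)
  have "{a..b} \<noteq> {}" using ab by simp
  then obtain x0 where "\<forall>y\<in>{a..b}. wronsk U V 1 0 x0 \<le> wronsk U V 1 0 y"
    using continuous_attains_inf[OF compact_Icc _ contW] by blast
  then have x0: "\<And>y. y \<in> {a..b} \<Longrightarrow> wronsk U V 1 0 x0 \<le> wronsk U V 1 0 y" by blast
  define r where "r = sqrt (wronsk U V 1 0 x0)"
  have r: "r > 0" using W by (simp add: r_def)
  have "AE \<xi> in M. \<not> ((\<exists>x\<in>{a..b}. rd (F \<xi>) 0 x = 0 \<and> rd (F \<xi>) 1 x = 0) \<and> (\<forall>y\<in>?J. \<bar>rd (F \<xi>) 2 y\<bar> \<le> real m))" for m :: nat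
  proof -
    define h where "h n = (b - a) / real (Suc n)" for n
    define A where "A n = (\<Union>i\<in>{..n}. {\<xi>\<in>space M. \<bar>rd (F \<xi>) 0 (grid a b n i)\<bar> \<le> real m * (h n)\<^sup>2})" for n
    have A: "A n \<in> sets M" for n unfolding A_def by (intro sets.finite_UN) auto
    have pA: "measure M (A n) \<le> real m * (b - a) / r * h n" for n
    proof -
      have "measure M (A n) \<le> (\<Sum>i\<in>{..n}. measure M {\<xi>\<in>space M. \<bar>rd (F \<xi>) 0 (grid a b n i)\<bar> \<le> real m * (h n)\<^sup>2})"
        unfolding A_def by (rule finite_measure_subadditive_finite) auto
      also have "\<dots> \<le> (\<Sum>i\<in>{..n}. real m * (h n)\<^sup>2 / r)"
      proof (rule sum_mono)
        fix i assume "i \<in> {..n}"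
        then have "grid a b n i \<in> {a..b}" using grid_range[OF ab, of i n] by simp
        then have "r \<le> sqrt (wronsk U V 1 0 (grid a b n i))" unfolding r_def using x0 by simp
        then have "real m * (h n)\<^sup>2 / sqrt (wronsk U V 1 0 (grid a b n i)) \<le> real m * (h n)\<^sup>2 / r"
          using r by (intro frac_le) auto
        then show "measure M {\<xi>\<in>space M. \<bar>rd (F \<xi>) 0 (grid a b n i)\<bar> \<le> real m * (h n)\<^sup>2} \<le> real m * (h n)\<^sup>2 / r"
          using small_value_prob[of "real m * (h n)\<^sup>2" "grid a b n i"] by simp
      qed
      also have "\<dots> = real (Suc n) * h n * (real m * h n / r)" by (simp add: power2_eq_square)
      also have "real (Suc n) * h n = b - a" by (simp add: h_def)
      finally show ?thesis by (simp add: mult_ac)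
    qed
    have "(\<Inter>n. A n) \<in> null_sets M"
    proof -
      have "measure M (\<Inter>n. A n) \<le> real m * (b - a) / r * h n" for n
      proof -
        have "measure M (\<Inter>n. A n) \<le> measure M (A n)" by (rule finite_measure_mono) (use A in auto)
        then show ?thesis using pA[of n] by linarith
      qed
      moreover have "(\<lambda>n. real m * (b - a) / r * h n) \<longlonglongrightarrow> real m * (b - a) / r * 0"
        unfolding h_def using LIMSEQ_Suc[OF lim_const_over_n[of "b - a"]] by (intro tendsto_intros) simp
      ultimately have "measure M (\<Inter>n. A n) \<le> 0"
        by (intro LIMSEQ_le_const[where X = "\<lambda>n. real m * (b - a) / r * h n"]) auto
      moreover have "(\<Inter>n. A n) \<in> sets M" using A by (intro sets.countable_INT) auto
      ultimately show ?thesis by (simp add: null_sets_def emeasure_eq_measure measure_le_0_iff)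
    qed
    then show ?thesis
    proof (rule AE_I', intro subsetI)
      fix \<xi> assume "\<xi> \<in> {\<xi>\<in>space M. \<not> \<not> ((\<exists>x\<in>{a..b}. rd (F \<xi>) 0 x = 0 \<and> rd (F \<xi>) 1 x = 0) \<and> (\<forall>y\<in>?J. \<bar>rd (F \<xi>) 2 y\<bar> \<le> real m))}"
      then have \<xi>: "\<xi> \<in> space M" and bd: "\<And>y. y \<in> ?J \<Longrightarrow> \<bar>rd (F \<xi>) 2 y\<bar> \<le> real m"
        and "\<exists>x\<in>{a..b}. rd (F \<xi>) 0 x = 0 \<and> rd (F \<xi>) 1 x = 0" by auto
      then obtain x where x: "x \<in> {a..b}" "rd (F \<xi>) 0 x = 0" "rd (F \<xi>) 1 x = 0" by blast
      have "\<xi> \<in> A n" for n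
      proof -
        obtain i where i: "i \<le> n" "grid a b n i \<le> x" "x \<le> grid a b n (Suc i)"
          using grid_cell[OF ab, of x n] x(1) by auto
        let ?t = "grid a b n i"
        have d: "\<bar>?t - x\<bar> \<le> h n" using i grid_diff[of a b n i] unfolding h_def by linarith
        have hb: "h n \<le> b - a" using ab unfolding h_def by (simp add: divide_le_eq)
        have "\<bar>rd (F \<xi>) 0 ?t\<bar> \<le> real m * (h n)\<^sup>2"
        proof (cases "?t = x")
          case True then show ?thesis using x by simp
        next
          case False
          obtain \<eta> where \<eta>: "\<bar>\<eta> - x\<bar> \<le> \<bar>?t - x\<bar>"
            "rd (F \<xi>) 0 ?t = (\<Sum>k<2. (rd (F \<xi>) k x / fact k) * (?t - x) ^ k) + (rd (F \<xi>) 2 \<eta> / fact 2) * (?t - x) ^ 2"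
            using Taylor_between[where f = "rd (F \<xi>)" and n = 2, OF has_derivative_rd[OF F_hol[OF \<xi>]] _ False] by auto
          then have "rd (F \<xi>) 0 ?t = rd (F \<xi>) 2 \<eta> / 2 * (?t - x)\<^sup>2"
            using x by (simp add: numeral_2_eq_2)
          then have "\<bar>rd (F \<xi>) 0 ?t\<bar> = \<bar>rd (F \<xi>) 2 \<eta>\<bar> / 2 * \<bar>?t - x\<bar>\<^sup>2"
            by (simp only: abs_mult abs_divide abs_numeral power_abs[symmetric])
          also have "\<dots> \<le> real m * (h n)\<^sup>2"
          proof (rule mult_mono)
            have "\<bar>rd (F \<xi>) 2 \<eta>\<bar> \<le> real m" using \<eta>(1) d hb x(1) by (intro bd) auto
            then show "\<bar>rd (F \<xi>) 2 \<eta>\<bar> / 2 \<le> real m" by simp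
            show "\<bar>?t - x\<bar>\<^sup>2 \<le> (h n)\<^sup>2" using d by (intro power_mono) auto
          qed auto
          finally show ?thesis .
        qed
        then show ?thesis unfolding A_def using i(1) \<xi> by blast
      qed
      then show "\<xi> \<in> (\<Inter>n. A n)" by blast
    qed
  qed
  then have "AE \<xi> in M. \<forall>m::nat. \<not> ((\<exists>x\<in>{a..b}. rd (F \<xi>) 0 x = 0 \<and> rd (F \<xi>) 1 x = 0) \<and> (\<forall>y\<in>?J. \<bar>rd (F \<xi>) 2 y\<bar> \<le> real m))"
    unfolding AE_all_countable by blast
  then show ?thesis
  proof (rule AE_mp, intro AE_I2 impI)
    fix \<xi> assume \<xi>: "\<xi> \<in> space M"
      and no: "\<forall>m::nat. \<not> ((\<exists>x\<in>{a..b}. rd (F \<xi>) 0 x = 0 \<and> rd (F \<xi>) 1 x = 0) \<and> (\<forall>y\<in>?J. \<bar>rd (F \<xi>) 2 y\<bar> \<le> real m))"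
    have "continuous_on ?J (\<lambda>y. \<bar>rd (F \<xi>) 2 y\<bar>)"
      by (intro continuous_on_rabs continuous_at_imp_continuous_on ballI isCont_rd F_hol \<xi>)
    then have "compact ((\<lambda>y. \<bar>rd (F \<xi>) 2 y\<bar>) ` ?J)" by (intro compact_continuous_image compact_Icc)
    then have "bdd_above ((\<lambda>y. \<bar>rd (F \<xi>) 2 y\<bar>) ` ?J)" by (intro bounded_imp_bdd_above compact_imp_bounded)
    then obtain B where B: "\<And>y. y \<in> ?J \<Longrightarrow> \<bar>rd (F \<xi>) 2 y\<bar> \<le> B" unfolding bdd_above_def by blast
    obtain m :: nat where "B \<le> real m" using real_arch_simple by blast
    then have "\<forall>y\<in>?J. \<bar>rd (F \<xi>) 2 y\<bar> \<le> real m" using B by (meson order_trans)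
    then show "\<forall>x\<in>{a..b}. rd (F \<xi>) 0 x = 0 \<longrightarrow> rd (F \<xi>) 1 x \<noteq> 0" using no by blast
  qed
qed
end

lemma finite_real_zeros:
  assumes f: "f holomorphic_on UNIV" and y: "f (complex_of_real y) \<noteq> 0"
  shows "finite (real_zeros f \<inter> {a..b})"
proof (cases "f constant_on UNIV")
  case True
  then obtain c where "\<And>z. f z = c" unfolding constant_on_def by auto
  then have "real_zeros f = {}" using y by (simp add: real_zeros_def)
  then show ?thesis by simp
next
  case False
  let ?K = "complex_of_real ` {a..b}"
  have "finite {z\<in>?K. f z = 0}"
    by (rule holomorphic_compact_finite_zeros[OF f open_UNIV connected_UNIV _ subset_UNIV False])
       (intro compact_continuous_image continuous_intros compact_Icc)
  moreover have "complex_of_real ` (real_zeros f \<inter> {a..b}) \<subseteq> {z\<in>?K. f z = 0}"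
    by (auto simp: real_zeros_def)
  ultimately have "finite (complex_of_real ` (real_zeros f \<inter> {a..b}))" by (rule rev_finite_subset)
  then show ?thesis by (rule finite_imageD) (simp add: inj_on_def)
qed

context gaussian_entire begin

text \<open>
  The upper bound by the number of zeros holds for every grid, the equality only eventually. The first
  gives the lower estimate of the expected number of zeros, the second the upper one through Fatou's lemma.
\<close>
lemma AE_zero_count:
  assumes ab: "a < b"
  shows "AE \<xi> in M. (\<forall>n. of_nat (sign_changes (rd (F \<xi>) 0) a b n) \<le> zero_count (F \<xi>) {a..b}) \<and>
     eventually (\<lambda>n. of_nat (sign_changes (rd (F \<xi>) 0) a b n) = zero_count (F \<xi>) {a..b}) sequentially"
proof -
  have "AE \<xi> in M. \<forall>n i. rd (F \<xi>) 0 (grid a b n i) \<noteq> 0"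
    unfolding AE_all_countable using AE_nonzero by blast
  then have "AE \<xi> in M. (\<forall>x\<in>{a..b}. rd (F \<xi>) 0 x = 0 \<longrightarrow> rd (F \<xi>) 1 x \<noteq> 0) \<and>
      (\<forall>x::real. F \<xi> (of_real x) \<in> \<real>) \<and> (\<forall>n i. rd (F \<xi>) 0 (grid a b n i) \<noteq> 0)"
    using AE_simple_zeros[OF ab] F_real by (intro AE_conjI)
  then show ?thesis
  proof (rule AE_mp, intro AE_I2 impI)
    fix \<xi> assume \<xi>: "\<xi> \<in> space M"
      and "(\<forall>x\<in>{a..b}. rd (F \<xi>) 0 x = 0 \<longrightarrow> rd (F \<xi>) 1 x \<noteq> 0) \<and>
      (\<forall>x::real. F \<xi> (of_real x) \<in> \<real>) \<and> (\<forall>n i. rd (F \<xi>) 0 (grid a b n i) \<noteq> 0)"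
    then have simple: "\<And>x. x \<in> {a..b} \<Longrightarrow> rd (F \<xi>) 0 x = 0 \<Longrightarrow> rd (F \<xi>) 1 x \<noteq> 0"
      and real: "\<And>x::real. F \<xi> (of_real x) \<in> \<real>" and nz: "\<And>n i. rd (F \<xi>) 0 (grid a b n i) \<noteq> 0" by blast+
    note hol = F_hol[OF \<xi>]
    have re: "F \<xi> (of_real x) = of_real (rd (F \<xi>) 0 x)" for x using real[of x] by (simp add: rd_def)
    have Z: "real_zeros (F \<xi>) \<inter> {a..b} = {x\<in>{a..b}. rd (F \<xi>) 0 x = 0}"
      by (auto simp: real_zeros_def re)
    have "F \<xi> (of_real a) \<noteq> 0" using nz[of 0 0] by (simp add: re)
    then have fin: "finite {x\<in>{a..b}. rd (F \<xi>) 0 x = 0}"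
      using finite_real_zeros[OF hol, of a a b] unfolding Z by blast
    have zc: "zero_count (F \<xi>) {a..b} = of_nat (card {x\<in>{a..b}. rd (F \<xi>) 0 x = 0})"
      unfolding zero_count_def Z using fin by (simp add: emeasure_count_space_finite)
    have cont: "continuous_on UNIV (rd (F \<xi>) 0)"
      by (intro continuous_at_imp_continuous_on ballI isCont_rd hol)
    have "\<exists>d. d \<noteq> 0 \<and> (rd (F \<xi>) 0 has_real_derivative d) (at x)" if "x \<in> {a..b}" "rd (F \<xi>) 0 x = 0" for x
      using simple[OF that] has_derivative_rd[OF hol, of 0 x] by auto
    then have "eventually (\<lambda>n. sign_changes (rd (F \<xi>) 0) a b n = card {x\<in>{a..b}. rd (F \<xi>) 0 x = 0}) sequentially"
      by (intro eventually_sign_changes_eq_card_zeros ab cont fin nz)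
    then have "eventually (\<lambda>n. of_nat (sign_changes (rd (F \<xi>) 0) a b n) = zero_count (F \<xi>) {a..b}) sequentially"
      by eventually_elim (simp add: zc)
    moreover have "of_nat (sign_changes (rd (F \<xi>) 0) a b n) \<le> zero_count (F \<xi>) {a..b}" for n
      unfolding zc of_nat_le_iff by (rule card_zeros_ge_sign_changes[OF ab cont fin])
    ultimately show "(\<forall>n. of_nat (sign_changes (rd (F \<xi>) 0) a b n) \<le> zero_count (F \<xi>) {a..b}) \<and>
     eventually (\<lambda>n. of_nat (sign_changes (rd (F \<xi>) 0) a b n) = zero_count (F \<xi>) {a..b}) sequentially" by blast
  qed
qed

lemma sign_changes_eq_sum:
  "(of_nat (sign_changes f a b n) :: ennreal) =
     (\<Sum>i\<le>n. indicator {x. x < (0::real)} (f (grid a b n i) * f (grid a b n (Suc i))))"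
proof -
  have "(\<Sum>i\<le>n. indicator {x. x < (0::real)} (f (grid a b n i) * f (grid a b n (Suc i))) :: ennreal) =
      (\<Sum>i\<le>n. if f (grid a b n i) * f (grid a b n (Suc i)) < 0 then 1 else 0)"
    by (intro sum.cong) (simp_all add: indicator_def)
  also have "\<dots> = of_nat (card ({..n} \<inter> {i. f (grid a b n i) * f (grid a b n (Suc i)) < 0}))"
    by (simp add: sum.If_cases)
  also have "{..n} \<inter> {i. f (grid a b n i) * f (grid a b n (Suc i)) < 0} =
      {i. i \<le> n \<and> f (grid a b n i) * f (grid a b n (Suc i)) < 0}" by auto
  finally show ?thesis by (simp add: sign_changes_def)
qed

lemma measurable_negative_product:
  "(\<lambda>\<xi>. indicator {x. x < (0::real)} (rd (F \<xi>) 0 s * rd (F \<xi>) 0 t) :: ennreal) \<in> borel_measurable M"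
proof -
  have "(\<lambda>x. indicator {x. x < (0::real)} x :: ennreal) \<in> borel_measurable borel"
    by (rule borel_measurable_indicator) simp
  from measurable_compose[OF borel_measurable_times[OF X_meas X_meas] this] show ?thesis .
qed

lemma measurable_sign_changes [measurable]:
  "(\<lambda>\<xi>. of_nat (sign_changes (rd (F \<xi>) 0) a b n) :: ennreal) \<in> borel_measurable M"
  unfolding sign_changes_eq_sum
  by (intro borel_measurable_sum measurable_negative_product)

lemma angle_kernel_nonneg:
  assumes "s \<noteq> t" "pair_kernel U V s t > 0"
  shows "0 \<le> angle_kernel U V s t"
proof -
  have "0 \<le> measure M {\<xi>\<in>space M. rd (F \<xi>) 0 s * rd (F \<xi>) 0 t < 0}" by (rule measure_nonneg)
  then have "0 \<le> angle_kernel U V s t / pi" unfolding sign_change_prob[OF assms] .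
  then show ?thesis using pi_gt_zero by (simp add: zero_le_divide_iff)
qed

lemma expected_sign_changes:
  assumes ab: "a < b" and C: "\<And>s t. s \<in> {a..b} \<Longrightarrow> t \<in> {a..b} \<Longrightarrow> s \<noteq> t \<Longrightarrow> pair_kernel U V s t > 0"
  shows "(\<integral>\<^sup>+\<xi>. of_nat (sign_changes (rd (F \<xi>) 0) a b n) \<partial>M) =
     ennreal (\<Sum>i\<le>n. angle_kernel U V (grid a b n i) (grid a b n (Suc i)) / pi)"
proof -
  let ?t = "grid a b n"
  have "(\<integral>\<^sup>+\<xi>. of_nat (sign_changes (rd (F \<xi>) 0) a b n) \<partial>M) =
     (\<Sum>i\<le>n. \<integral>\<^sup>+\<xi>. indicator {x. x < (0::real)} (rd (F \<xi>) 0 (?t i) * rd (F \<xi>) 0 (?t (Suc i))) \<partial>M)"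
    unfolding sign_changes_eq_sum
    by (intro nn_integral_sum measurable_negative_product)
  also have "\<dots> = (\<Sum>i\<le>n. ennreal (angle_kernel U V (?t i) (?t (Suc i)) / pi))"
  proof (rule sum.cong)
    fix i assume "i \<in> {..n}"
    then have i: "?t i \<in> {a..b}" "?t (Suc i) \<in> {a..b}" "?t i \<noteq> ?t (Suc i)"
      using grid_range[OF ab, of i n] grid_range[OF ab, of "Suc i" n] grid_less[OF ab, of i "Suc i" n] by auto
    let ?A = "{\<xi>\<in>space M. rd (F \<xi>) 0 (?t i) * rd (F \<xi>) 0 (?t (Suc i)) < 0}"
    have "(\<integral>\<^sup>+\<xi>. indicator {x. x < (0::real)} (rd (F \<xi>) 0 (?t i) * rd (F \<xi>) 0 (?t (Suc i))) \<partial>M) = (\<integral>\<^sup>+\<xi>. indicator ?A \<xi> \<partial>M)"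
      by (intro nn_integral_cong) (simp add: indicator_def)
    also have "\<dots> = emeasure M ?A" by (rule nn_integral_indicator) measurable
    also have "\<dots> = ennreal (angle_kernel U V (?t i) (?t (Suc i)) / pi)"
      using sign_change_prob[OF i(3) C[OF i]] by (simp add: emeasure_eq_measure)
    finally show "(\<integral>\<^sup>+\<xi>. indicator {x. x < (0::real)} (rd (F \<xi>) 0 (?t i) * rd (F \<xi>) 0 (?t (Suc i))) \<partial>M) =
      ennreal (angle_kernel U V (?t i) (?t (Suc i)) / pi)" .
  qed simp
  also have "\<dots> = ennreal (\<Sum>i\<le>n. angle_kernel U V (?t i) (?t (Suc i)) / pi)"
  proof (rule sum_ennreal)
    fix i assume "i \<in> {..n}"
    then have i: "?t i \<in> {a..b}" "?t (Suc i) \<in> {a..b}" "?t i \<noteq> ?t (Suc i)"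
      using grid_range[OF ab, of i n] grid_range[OF ab, of "Suc i" n] grid_less[OF ab, of i "Suc i" n] by auto
    show "0 \<le> angle_kernel U V (?t i) (?t (Suc i)) / pi"
      using angle_kernel_nonneg[OF i(3) C[OF i]] by simp
  qed
  finally show ?thesis .
qed

text \<open>
  The lower bound already follows from the coarsest grid, whose only cell is \<open>{a..b}\<close>.
\<close>
lemma expected_zeros_bounds:
  assumes ab: "a < b" and C: "\<And>s t. s \<in> {a..b} \<Longrightarrow> t \<in> {a..b} \<Longrightarrow> s \<noteq> t \<Longrightarrow>
      pair_kernel U V s t > 0 \<and> c * \<bar>s - t\<bar> \<le> angle_kernel U V s t \<and> angle_kernel U V s t \<le> d * \<bar>s - t\<bar>"
  shows "ennreal (c * (b - a) / pi) \<le> (\<integral>\<^sup>+\<xi>. zero_count (F \<xi>) {a..b} \<partial>M)"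
    and "(\<integral>\<^sup>+\<xi>. zero_count (F \<xi>) {a..b} \<partial>M) \<le> ennreal (d * (b - a) / pi)"
proof -
  have C1: "\<And>s t. s \<in> {a..b} \<Longrightarrow> t \<in> {a..b} \<Longrightarrow> s \<noteq> t \<Longrightarrow> pair_kernel U V s t > 0" using C by blast
  have sum: "(\<Sum>i\<le>n. e * (grid a b n (Suc i) - grid a b n i) / pi) = e * (b - a) / pi" for n e
  proof -
    have "(\<Sum>i\<le>n. e * (grid a b n (Suc i) - grid a b n i) / pi) = (\<Sum>i\<le>n. e * ((b - a) / real (Suc n)) / pi)"
      by (simp only: grid_diff)
    also have "\<dots> = real (Suc n) * (e * ((b - a) / real (Suc n)) / pi)" by simp
    also have "\<dots> = e * (b - a) / pi" by (simp del: of_nat_Suc)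
    finally show ?thesis .
  qed
  have cell: "c * (grid a b n (Suc i) - grid a b n i) / pi \<le> angle_kernel U V (grid a b n i) (grid a b n (Suc i)) / pi \<and>
      angle_kernel U V (grid a b n i) (grid a b n (Suc i)) / pi \<le> d * (grid a b n (Suc i) - grid a b n i) / pi"
    if "i \<le> n" for i n
  proof -
    have i: "grid a b n i \<in> {a..b}" "grid a b n (Suc i) \<in> {a..b}" "grid a b n i < grid a b n (Suc i)"
      using grid_range[OF ab, of i n] grid_range[OF ab, of "Suc i" n] grid_less[OF ab, of i "Suc i" n] that by auto
    have "\<bar>grid a b n i - grid a b n (Suc i)\<bar> = grid a b n (Suc i) - grid a b n i" using i(3) by simp
    then show ?thesis using C[OF i(1,2)] i(3) by (intro conjI divide_right_mono) auto
  qed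
  show "ennreal (c * (b - a) / pi) \<le> (\<integral>\<^sup>+\<xi>. zero_count (F \<xi>) {a..b} \<partial>M)"
  proof -
    have "(\<Sum>i\<le>0. c * (grid a b 0 (Suc i) - grid a b 0 i) / pi) \<le>
        (\<Sum>i\<le>0. angle_kernel U V (grid a b 0 i) (grid a b 0 (Suc i)) / pi)"
      by (rule sum_mono, rule cell[THEN conjunct1]) (simp only: atMost_iff)
    then have "ennreal (c * (b - a) / pi) \<le> ennreal (\<Sum>i\<le>0. angle_kernel U V (grid a b 0 i) (grid a b 0 (Suc i)) / pi)"
      unfolding sum by (rule ennreal_leI)
    also have "\<dots> = (\<integral>\<^sup>+\<xi>. of_nat (sign_changes (rd (F \<xi>) 0) a b 0) \<partial>M)"
      by (rule expected_sign_changes[OF ab C1, symmetric])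
    also have "\<dots> \<le> (\<integral>\<^sup>+\<xi>. zero_count (F \<xi>) {a..b} \<partial>M)"
      using AE_zero_count[OF ab] by (intro nn_integral_mono_AE) (auto elim: AE_mp)
    finally show ?thesis .
  qed
  show "(\<integral>\<^sup>+\<xi>. zero_count (F \<xi>) {a..b} \<partial>M) \<le> ennreal (d * (b - a) / pi)"
  proof -
    let ?N = "\<lambda>n \<xi>. of_nat (sign_changes (rd (F \<xi>) 0) a b n) :: ennreal"
    have "AE \<xi> in M. zero_count (F \<xi>) {a..b} = liminf (\<lambda>n. ?N n \<xi>)"
      using AE_zero_count[OF ab]
    proof (rule AE_mp, intro AE_I2 impI)
      fix \<xi> assume "(\<forall>n. ?N n \<xi> \<le> zero_count (F \<xi>) {a..b}) \<and> eventually (\<lambda>n. ?N n \<xi> = zero_count (F \<xi>) {a..b}) sequentially"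
      then have "(\<lambda>n. ?N n \<xi>) \<longlonglongrightarrow> zero_count (F \<xi>) {a..b}" by (auto intro: tendsto_eventually)
      then show "zero_count (F \<xi>) {a..b} = liminf (\<lambda>n. ?N n \<xi>)"
        by (intro lim_imp_Liminf[symmetric]) auto
    qed
    then have "(\<integral>\<^sup>+\<xi>. zero_count (F \<xi>) {a..b} \<partial>M) = (\<integral>\<^sup>+\<xi>. liminf (\<lambda>n. ?N n \<xi>) \<partial>M)"
      by (rule nn_integral_cong_AE)
    also have "\<dots> \<le> liminf (\<lambda>n. \<integral>\<^sup>+\<xi>. ?N n \<xi> \<partial>M)"
      by (rule nn_integral_liminf) measurable
    also have "\<dots> \<le> liminf (\<lambda>n. ennreal (d * (b - a) / pi))"
    proof (rule Liminf_mono, intro always_eventually allI)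
      fix n
      have "(\<integral>\<^sup>+\<xi>. ?N n \<xi> \<partial>M) = ennreal (\<Sum>i\<le>n. angle_kernel U V (grid a b n i) (grid a b n (Suc i)) / pi)"
        by (rule expected_sign_changes[OF ab C1])
      also have "\<dots> \<le> ennreal (\<Sum>i\<le>n. d * (grid a b n (Suc i) - grid a b n i) / pi)"
        by (rule ennreal_leI, rule sum_mono, rule cell[THEN conjunct2]) (simp only: atMost_iff)
      also have "\<dots> = ennreal (d * (b - a) / pi)" unfolding sum ..
      finally show "(\<integral>\<^sup>+\<xi>. ?N n \<xi> \<partial>M) \<le> ennreal (d * (b - a) / pi)" .
    qed
    also have "\<dots> = ennreal (d * (b - a) / pi)" by (rule Liminf_const) simp
    finally show ?thesis .
  qed
qed

text \<open>
  On short intervals around \<open>x\<close> both the expected number of zeros and the integral of the intensity are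
  proportional to the length up to a small relative error, and \<open>\<rho>\<close> is continuous at \<open>x\<close>.
\<close>
theorem first_intensity_eq_speed:
  assumes \<rho>: "first_intensity M F \<rho>"
  shows "pi * \<rho> x = sqrt (zero_speed_sq U V x)"
proof -
  have \<rho>0: "\<And>x. 0 \<le> \<rho> x" and cont: "isCont \<rho> x"
    and int: "\<And>a b. (\<integral>\<^sup>+\<xi>. zero_count (F \<xi>) {a..b} \<partial>M) = (\<integral>\<^sup>+x\<in>{a..b}. ennreal (\<rho> x) \<partial>lborel)"
    using \<rho> by (auto simp: first_intensity_def continuous_on_eq_continuous_at)
  have "\<bar>pi * \<rho> x - sqrt (zero_speed_sq U V x)\<bar> \<le> (pi + 1) * \<epsilon>" if \<epsilon>: "\<epsilon> > 0" for \<epsilon>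
  proof -
    let ?L = "sqrt (zero_speed_sq U V x)"
    obtain \<delta> where \<delta>: "\<delta> > 0" and near: "\<And>s t. s \<noteq> t \<Longrightarrow> \<bar>s - x\<bar> < \<delta> \<Longrightarrow> \<bar>t - x\<bar> < \<delta> \<Longrightarrow>
        pair_kernel U V s t > 0 \<and> \<bar>angle_kernel U V s t / \<bar>s - t\<bar> - ?L\<bar> < \<epsilon>"
      using angle_kernel_uniform[OF U(1) V(1) W \<epsilon>, of x] by blast
    obtain \<delta>' where \<delta>': "\<delta>' > 0" and near': "\<And>y. dist y x < \<delta>' \<Longrightarrow> dist (\<rho> y) (\<rho> x) < \<epsilon>"
      using cont \<epsilon> unfolding continuous_at_eps_delta by blast
    define h where "h = min \<delta> \<delta>' / 2"
    have h: "h > 0" "h < \<delta>" "h < \<delta>'" using \<delta> \<delta>' by (auto simp: h_def)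
    let ?a = "x - h" and ?b = "x + h"
    have ab: "?a < ?b" using h by simp
    have C: "pair_kernel U V s t > 0 \<and> (?L - \<epsilon>) * \<bar>s - t\<bar> \<le> angle_kernel U V s t \<and> angle_kernel U V s t \<le> (?L + \<epsilon>) * \<bar>s - t\<bar>"
      if "s \<in> {?a..?b}" "t \<in> {?a..?b}" "s \<noteq> t" for s t
    proof -
      have "\<bar>s - x\<bar> < \<delta>" "\<bar>t - x\<bar> < \<delta>" using that(1,2) h by auto
      note n = near[OF that(3) this]
      have "\<bar>s - t\<bar> > 0" using that by simp
      then have "(?L - \<epsilon>) * \<bar>s - t\<bar> \<le> angle_kernel U V s t / \<bar>s - t\<bar> * \<bar>s - t\<bar>"
        "angle_kernel U V s t / \<bar>s - t\<bar> * \<bar>s - t\<bar> \<le> (?L + \<epsilon>) * \<bar>s - t\<bar>"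
        using n by (intro mult_right_mono; linarith)+
      then show ?thesis using n that(3) by simp
    qed
    have rho: "\<rho> x - \<epsilon> \<le> \<rho> y" "\<rho> y \<le> \<rho> x + \<epsilon>" if "y \<in> {?a..?b}" for y
      using near'[of y] that h by (auto simp: dist_real_def abs_less_iff)
    have c: "(\<integral>\<^sup>+x\<in>{?a..?b}. ennreal e \<partial>lborel) = ennreal (e * (?b - ?a))" if "e \<ge> 0" for e
      using that h by (simp add: nn_integral_cmult_indicator ennreal_mult'[symmetric])
    have "ennreal ((?L - \<epsilon>) * (?b - ?a) / pi) \<le> (\<integral>\<^sup>+x\<in>{?a..?b}. ennreal (\<rho> x) \<partial>lborel)"
      using expected_zeros_bounds(1)[OF ab C] unfolding int by blast
    also have "\<dots> \<le> (\<integral>\<^sup>+y\<in>{?a..?b}. ennreal (\<rho> x + \<epsilon>) \<partial>lborel)"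
      by (intro nn_integral_mono) (auto simp: indicator_def intro!: ennreal_leI rho)
    also have "\<dots> = ennreal ((\<rho> x + \<epsilon>) * (?b - ?a))" using \<rho>0[of x] \<epsilon> by (intro c) simp
    finally have "(?L - \<epsilon>) * (?b - ?a) / pi \<le> (\<rho> x + \<epsilon>) * (?b - ?a)"
      using \<rho>0[of x] \<epsilon> h by (subst (asm) ennreal_le_iff) auto
    then have "((?L - \<epsilon>) / pi) * (?b - ?a) \<le> (\<rho> x + \<epsilon>) * (?b - ?a)" by simp
    then have "(?L - \<epsilon>) / pi \<le> \<rho> x + \<epsilon>" by (rule mult_right_le_imp_le) (use h in simp)
    then have lower: "?L - \<epsilon> \<le> pi * (\<rho> x + \<epsilon>)" by (simp add: field_simps)
    have "pi * (\<rho> x - \<epsilon>) \<le> ?L + \<epsilon>"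
    proof (cases "\<rho> x - \<epsilon> \<ge> 0")
      case True
      have ne: "?a \<noteq> ?b" and mem: "?a \<in> {?a..?b}" "?b \<in> {?a..?b}" using h by auto
      have "angle_kernel U V ?a ?b \<ge> 0"
        by (rule angle_kernel_nonneg[OF ne C[OF mem ne, THEN conjunct1]])
      moreover have "angle_kernel U V ?a ?b \<le> (?L + \<epsilon>) * \<bar>?a - ?b\<bar>"
        by (rule C[OF mem ne, THEN conjunct2, THEN conjunct2])
      ultimately have "0 \<le> (?L + \<epsilon>) * \<bar>?a - ?b\<bar>" by linarith
      then have L0: "?L + \<epsilon> \<ge> 0" using h by (simp add: zero_le_mult_iff)
      have "ennreal ((\<rho> x - \<epsilon>) * (?b - ?a)) = (\<integral>\<^sup>+y\<in>{?a..?b}. ennreal (\<rho> x - \<epsilon>) \<partial>lborel)"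
        using True by (rule c[symmetric])
      also have "\<dots> \<le> (\<integral>\<^sup>+y\<in>{?a..?b}. ennreal (\<rho> y) \<partial>lborel)"
        by (intro nn_integral_mono) (auto simp: indicator_def intro!: ennreal_leI rho)
      also have "\<dots> \<le> ennreal ((?L + \<epsilon>) * (?b - ?a) / pi)"
        using expected_zeros_bounds(2)[OF ab C] unfolding int by blast
      finally have "(\<rho> x - \<epsilon>) * (?b - ?a) \<le> (?L + \<epsilon>) * (?b - ?a) / pi"
        using L0 h by (subst (asm) ennreal_le_iff) auto
      then have "(\<rho> x - \<epsilon>) * (?b - ?a) \<le> ((?L + \<epsilon>) / pi) * (?b - ?a)" by simp
      then have "\<rho> x - \<epsilon> \<le> (?L + \<epsilon>) / pi" by (rule mult_right_le_imp_le) (use h in simp)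
      then show ?thesis by (simp add: field_simps)
    next
      case False
      then have neg: "pi * (\<rho> x - \<epsilon>) \<le> 0" by (simp add: mult_le_0_iff)
      define r where "r = angle_kernel U V ?a ?b / \<bar>?a - ?b\<bar>"
      have ne: "?a \<noteq> ?b" and d: "\<bar>?a - x\<bar> < \<delta>" "\<bar>?b - x\<bar> < \<delta>" using h by auto
      have r: "\<bar>r - ?L\<bar> < \<epsilon>" and p: "pair_kernel U V ?a ?b > 0"
        unfolding r_def using near[OF ne d] by blast+
      have "r \<ge> 0" unfolding r_def using angle_kernel_nonneg[OF ne p] by simp
      then have "0 \<le> ?L + \<epsilon>" using r unfolding abs_less_iff by linarith
      with neg show ?thesis by (rule order_trans)
    qed
    then show ?thesis using lower by (simp add: abs_le_iff algebra_simps)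
  qed
  then have "\<bar>pi * \<rho> x - sqrt (zero_speed_sq U V x)\<bar> \<le> 0 + e" if "e > 0" for e
  proof -
    have "pi + 1 > 0" using pi_gt_zero by linarith
    then show ?thesis using \<open>\<And>\<epsilon>. \<epsilon> > 0 \<Longrightarrow> _ \<le> (pi + 1) * \<epsilon>\<close>[of "e / (pi + 1)"] that by simp
  qed
  then have "\<bar>pi * \<rho> x - sqrt (zero_speed_sq U V x)\<bar> \<le> 0" by (rule field_le_epsilon)
  then show ?thesis by simp
qed
end

section \<open>Gaussian series\<close>

lemma symmetric_partial_sums:
  fixes f :: "int \<Rightarrow> 'b :: {comm_monoid_add, topological_space}"
  assumes "(f has_sum S) J"
  shows "(\<lambda>N. \<Sum>n\<in>{n\<in>J. \<bar>n\<bar> \<le> int N}. f n) \<longlonglongrightarrow> S"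
proof -
  have fin: "finite {n\<in>J. \<bar>n\<bar> \<le> int N}" for N
    by (rule finite_subset[of _ "{- int N..int N}"]) auto
  have "filterlim (\<lambda>N. {n\<in>J. \<bar>n\<bar> \<le> int N}) (finite_subsets_at_top J) sequentially"
    unfolding filterlim_finite_subsets_at_top
  proof (intro allI impI)
    fix X assume X: "finite X \<and> X \<subseteq> J"
    then obtain N0 where N0: "\<forall>n\<in>X. nat \<bar>n\<bar> \<le> N0" using finite_nat_set_iff_bounded_le[of "(\<lambda>n. nat \<bar>n\<bar>) ` X"] by auto
    have "X \<subseteq> {n\<in>J. \<bar>n\<bar> \<le> int N}" if "N \<ge> N0" for N
    proof
      fix n assume n: "n \<in> X"
      then have "nat \<bar>n\<bar> \<le> N" using N0 that by force
      then show "n \<in> {n\<in>J. \<bar>n\<bar> \<le> int N}" using X n by auto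
    qed
    then show "eventually (\<lambda>N. finite {n\<in>J. \<bar>n\<bar> \<le> int N} \<and> X \<subseteq> {n\<in>J. \<bar>n\<bar> \<le> int N} \<and> {n\<in>J. \<bar>n\<bar> \<le> int N} \<subseteq> J) sequentially"
      using fin by (intro eventually_sequentiallyI[of N0]) auto
  qed
  from filterlim_compose[OF assms[unfolded has_sum_def] this] show ?thesis by simp
qed

lemma (in prob_space) char_gaussian_combination:
  assumes "finite S" and indep: "indep_vars (\<lambda>_. borel) a S"
    and normal: "\<And>n. n \<in> S \<Longrightarrow> distributed M lborel (a n) (\<lambda>x. ennreal (std_normal_density x))"
  shows "(LINT \<xi>|M. iexp (\<Sum>n\<in>S. a n \<xi> * b n)) = of_real (exp (- (\<Sum>n\<in>S. (b n)\<^sup>2) / 2))"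
proof -
  have m: "a n \<in> borel_measurable M" if "n \<in> S" for n
    using indep that by (auto simp: indep_vars_def)
  have "indep_vars (\<lambda>_. borel) (\<lambda>n. (\<lambda>x. x * b n) \<circ> a n) S"
    by (rule indep_vars_compose[OF indep]) simp
  then have ind: "indep_vars (\<lambda>_. borel) (\<lambda>n \<xi>. a n \<xi> * b n) S" by (simp add: comp_def)
  have meas: "(\<lambda>\<xi>. \<Sum>n\<in>S. a n \<xi> * b n) \<in> borel_measurable M"
    using m by (intro borel_measurable_sum borel_measurable_times) auto
  have "(LINT \<xi>|M. iexp (\<Sum>n\<in>S. a n \<xi> * b n)) = char (distr M borel (\<lambda>\<xi>. \<Sum>n\<in>S. a n \<xi> * b n)) 1"
    unfolding char_def using meas by (subst integral_distr) (auto simp del: of_real_sum)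
  also have "\<dots> = (\<Prod>n\<in>S. char (distr M borel (\<lambda>\<xi>. a n \<xi> * b n)) 1)"
    by (rule char_distr_sum[OF ind])
  also have "\<dots> = (\<Prod>n\<in>S. of_real (exp (- (b n)\<^sup>2 / 2)))"
  proof (rule prod.cong)
    fix n assume n: "n \<in> S"
    have "char (distr M borel (\<lambda>\<xi>. a n \<xi> * b n)) 1 = (LINT \<xi>|M. iexp (b n * a n \<xi>))"
      unfolding char_def using m[OF n] by (subst integral_distr) (auto simp: mult_ac)
    also have "\<dots> = char (distr M lborel (a n)) (b n)"
      unfolding char_def using m[OF n] by (subst integral_distr) auto
    also have "distr M lborel (a n) = std_gauss"
      using distributed_distr_eq_density[OF normal[OF n]] by simp
    also have "char std_gauss (b n) = of_real (exp (- (b n)\<^sup>2 / 2))"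
      by (simp add: char_std_normal_distribution)
    finally show "char (distr M borel (\<lambda>\<xi>. a n \<xi> * b n)) 1 = of_real (exp (- (b n)\<^sup>2 / 2))" .
  qed simp
  also have "\<dots> = of_real (exp (\<Sum>n\<in>S. - (b n)\<^sup>2 / 2))"
    using assms(1) by (simp add: exp_sum)
  also have "(\<Sum>n\<in>S. - (b n)\<^sup>2 / 2) = - (\<Sum>n\<in>S. (b n)\<^sup>2) / 2"
    by (simp add: sum_negf sum_divide_distrib)
  finally show ?thesis .
qed

text \<open>
  Almost sure convergence alone forces the variances to be summable: otherwise the characteristic
  functions of the partial sums would tend to 0 away from the origin, which no characteristic function
  does. The joint characteristic function is then the limit of those of the partial sums.
\<close>
lemma (in prob_space) gaussian_series_char:
  fixes a :: "int \<Rightarrow> 'a \<Rightarrow> real" and r :: "int \<Rightarrow> real \<Rightarrow> real" and X :: "real \<Rightarrow> 'a \<Rightarrow> real"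
  assumes indep: "indep_vars (\<lambda>_. borel) a J"
    and normal: "\<And>n. n \<in> J \<Longrightarrow> distributed M lborel (a n) (\<lambda>x. ennreal (std_normal_density x))"
    and X [measurable]: "\<And>x. X x \<in> borel_measurable M"
    and conv: "\<And>x. AE \<xi> in M. (\<lambda>N. \<Sum>n\<in>{n\<in>J. \<bar>n\<bar> \<le> int N}. a n \<xi> * r n x) \<longlonglongrightarrow> X x \<xi>"
  shows "(\<lambda>n. (r n x)\<^sup>2) summable_on J"
    and "finite I \<Longrightarrow> (LINT \<xi>|M. iexp (\<Sum>x\<in>I. v x * X x \<xi>)) =
        of_real (exp (- (\<Sum>x\<in>I. \<Sum>y\<in>I. v x * v y * (\<Sum>\<^sub>\<infinity>n\<in>J. r n x * r n y)) / 2))"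
proof -
  let ?S = "\<lambda>N::nat. {n\<in>J. \<bar>n\<bar> \<le> int N}"
  have fin: "finite (?S N)" for N
    by (rule finite_subset[of _ "{- int N..int N}"]) auto
  have am: "a n \<in> borel_measurable M" if "n \<in> J" for n
    using indep that by (auto simp: indep_vars_def)
  have lim: "(\<lambda>N. complex_of_real (exp (- (\<Sum>n\<in>?S N. (\<Sum>x\<in>I. v x * r n x)\<^sup>2) / 2)))
      \<longlonglongrightarrow> (LINT \<xi>|M. iexp (\<Sum>x\<in>I. v x * X x \<xi>))" if I: "finite I" for I v
  proof -
    have "(\<lambda>N. LINT \<xi>|M. iexp (\<Sum>n\<in>?S N. a n \<xi> * (\<Sum>x\<in>I. v x * r n x))) \<longlonglongrightarrow> (LINT \<xi>|M. iexp (\<Sum>x\<in>I. v x * X x \<xi>))"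
    proof (rule integral_dominated_convergence[where w = "\<lambda>_. 1"])
      show "(\<lambda>\<xi>. iexp (\<Sum>x\<in>I. v x * X x \<xi>)) \<in> borel_measurable M" by measurable
      show "(\<lambda>\<xi>. iexp (\<Sum>n\<in>?S N. a n \<xi> * (\<Sum>x\<in>I. v x * r n x))) \<in> borel_measurable M" for N
      proof -
        have "(\<lambda>\<xi>. \<Sum>n\<in>?S N. a n \<xi> * (\<Sum>x\<in>I. v x * r n x)) \<in> borel_measurable M"
          using am by (intro borel_measurable_sum borel_measurable_times) auto
        then show ?thesis by measurable
      qed
      have "AE \<xi> in M. \<forall>x\<in>I. (\<lambda>N. \<Sum>n\<in>?S N. a n \<xi> * r n x) \<longlonglongrightarrow> X x \<xi>"
        using I conv by (intro AE_finite_allI) auto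
      then show "AE \<xi> in M. (\<lambda>N. iexp (\<Sum>n\<in>?S N. a n \<xi> * (\<Sum>x\<in>I. v x * r n x))) \<longlonglongrightarrow> iexp (\<Sum>x\<in>I. v x * X x \<xi>)"
      proof (rule AE_mp, intro AE_I2 impI)
        fix \<xi> assume c: "\<forall>x\<in>I. (\<lambda>N. \<Sum>n\<in>?S N. a n \<xi> * r n x) \<longlonglongrightarrow> X x \<xi>"
        have "(\<lambda>N. \<Sum>x\<in>I. v x * (\<Sum>n\<in>?S N. a n \<xi> * r n x)) \<longlonglongrightarrow> (\<Sum>x\<in>I. v x * X x \<xi>)"
          using c by (intro tendsto_sum tendsto_mult tendsto_const) auto
        moreover have "(\<Sum>x\<in>I. v x * (\<Sum>n\<in>?S N. a n \<xi> * r n x)) = (\<Sum>n\<in>?S N. a n \<xi> * (\<Sum>x\<in>I. v x * r n x))" for N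
          unfolding sum_distrib_left by (subst sum.swap) (simp add: mult_ac)
        ultimately have "(\<lambda>N. \<Sum>n\<in>?S N. a n \<xi> * (\<Sum>x\<in>I. v x * r n x)) \<longlonglongrightarrow> (\<Sum>x\<in>I. v x * X x \<xi>)" by simp
        then show "(\<lambda>N. iexp (\<Sum>n\<in>?S N. a n \<xi> * (\<Sum>x\<in>I. v x * r n x))) \<longlonglongrightarrow> iexp (\<Sum>x\<in>I. v x * X x \<xi>)"
          by (intro tendsto_exp tendsto_mult tendsto_const tendsto_of_real)
      qed
    qed (auto simp del: of_real_sum)
    moreover have "(LINT \<xi>|M. iexp (\<Sum>n\<in>?S N. a n \<xi> * (\<Sum>x\<in>I. v x * r n x))) =
        complex_of_real (exp (- (\<Sum>n\<in>?S N. (\<Sum>x\<in>I. v x * r n x)\<^sup>2) / 2))" for N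
      using indep_vars_subset[OF indep, of "?S N"] normal fin
      by (intro char_gaussian_combination) auto
    ultimately show ?thesis by simp
  qed
  show sq: "(\<lambda>n. (r n x)\<^sup>2) summable_on J" for x
  proof (rule nonneg_bdd_above_summable_on)
    define \<sigma> where "\<sigma> N = (\<Sum>n\<in>?S N. (r n x)\<^sup>2)" for N
    have mono: "mono \<sigma>"
      unfolding \<sigma>_def by (intro monoI sum_mono2 fin) auto
    have "\<exists>B. \<forall>N. \<sigma> N \<le> B"
    proof (rule ccontr)
      assume unb: "\<nexists>B. \<forall>N. \<sigma> N \<le> B"
      have inf: "filterlim \<sigma> at_top sequentially"
        unfolding filterlim_at_top
      proof
        fix Z
        obtain N0 where "\<sigma> N0 > Z" using unb by (meson not_le)
        then have "Z \<le> \<sigma> N" if "N \<ge> N0" for N using monoD[OF mono that] by linarith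
        then show "eventually (\<lambda>N. Z \<le> \<sigma> N) sequentially" by (rule eventually_sequentiallyI)
      qed
      \<comment> \<open>The limit would be 0 for every \<open>t \<noteq> 0\<close>, but tends to 1 along \<open>t = 1 / (m + 1)\<close>.\<close>
      have zero: "(LINT \<xi>|M. iexp (t * X x \<xi>)) = 0" if "t \<noteq> 0" for t
      proof -
        have "(\<lambda>N. complex_of_real (exp (- (\<Sum>n\<in>?S N. (t * r n x)\<^sup>2) / 2))) \<longlonglongrightarrow> (LINT \<xi>|M. iexp (t * X x \<xi>))"
          using lim[of "{x}" "\<lambda>_. t"] by simp
        moreover have "- (\<Sum>n\<in>?S N. (t * r n x)\<^sup>2) / 2 = - (t\<^sup>2 / 2 * \<sigma> N)" for N
          unfolding \<sigma>_def by (simp add: power_mult_distrib flip: sum_distrib_left)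
        moreover have "(\<lambda>N. complex_of_real (exp (- (t\<^sup>2 / 2 * \<sigma> N)))) \<longlonglongrightarrow> complex_of_real 0"
        proof (intro tendsto_of_real)
          have "filterlim (\<lambda>N. t\<^sup>2 / 2 * \<sigma> N) at_top sequentially"
            using that by (intro filterlim_tendsto_pos_mult_at_top[OF tendsto_const _ inf]) simp
          then have "filterlim (\<lambda>N. - (t\<^sup>2 / 2 * \<sigma> N)) at_bot sequentially"
            by (simp add: filterlim_uminus_at_top)
          then show "(\<lambda>N. exp (- (t\<^sup>2 / 2 * \<sigma> N))) \<longlonglongrightarrow> 0" by (rule filterlim_compose[OF exp_at_bot])
        qed
        ultimately show ?thesis using LIMSEQ_unique by fastforce
      qed
      have "(\<lambda>m. LINT \<xi>|M. iexp ((1 / real (Suc m)) * X x \<xi>)) \<longlonglongrightarrow> (LINT \<xi>|M. 1)"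
      proof (rule integral_dominated_convergence[where w = "\<lambda>_. 1"])
        have "(\<lambda>m. iexp ((1 / real (Suc m)) * X x \<xi>)) \<longlonglongrightarrow> iexp (0 * X x \<xi>)" for \<xi>
          using LIMSEQ_Suc[OF lim_1_over_n[where 'a = real]]
          by (intro tendsto_exp tendsto_mult tendsto_const tendsto_of_real) simp
        then show "AE \<xi> in M. (\<lambda>m. iexp ((1 / real (Suc m)) * X x \<xi>)) \<longlonglongrightarrow> 1" by simp
      qed (auto simp del: of_real_mult)
      moreover have "(LINT \<xi>|M. iexp ((1 / real (Suc m)) * X x \<xi>)) = 0" for m by (rule zero) simp
      ultimately have "(\<lambda>m::nat. 0 :: complex) \<longlonglongrightarrow> (LINT \<xi>|M. 1)" by simp
      then show False by (simp add: prob_space LIMSEQ_const_iff)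
    qed
    then obtain B where B: "\<And>N. \<sigma> N \<le> B" by blast
    show "bdd_above (sum (\<lambda>n. (r n x)\<^sup>2) ` {F. F \<subseteq> J \<and> finite F})"
    proof (rule bdd_aboveI2)
      fix F assume F: "F \<in> {F. F \<subseteq> J \<and> finite F}"
      then obtain N where N: "\<forall>n\<in>F. nat \<bar>n\<bar> \<le> N" using finite_nat_set_iff_bounded_le[of "(\<lambda>n. nat \<bar>n\<bar>) ` F"] by auto
      have "F \<subseteq> ?S N"
      proof
        fix n assume n: "n \<in> F"
        then have "nat \<bar>n\<bar> \<le> N" using N by blast
        then show "n \<in> ?S N" using F n by auto
      qed
      then have "sum (\<lambda>n. (r n x)\<^sup>2) F \<le> \<sigma> N" unfolding \<sigma>_def by (intro sum_mono2 fin) auto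
      then show "sum (\<lambda>n. (r n x)\<^sup>2) F \<le> B" using B[of N] by linarith
    qed
  qed auto
  assume I: "finite I"
  have cov: "((\<lambda>n. r n x * r n y) has_sum (\<Sum>\<^sub>\<infinity>n\<in>J. r n x * r n y)) J" for x y
  proof (rule has_sum_infsum, rule abs_summable_summable, rule summable_on_comparison_test)
    show "(\<lambda>n. (r n x)\<^sup>2 + (r n y)\<^sup>2) summable_on J" by (intro summable_on_add sq)
    show "norm (r n x * r n y) \<le> (r n x)\<^sup>2 + (r n y)\<^sup>2" for n
    proof -
      have "2 * (\<bar>r n x\<bar> * \<bar>r n y\<bar>) \<le> \<bar>r n x\<bar>\<^sup>2 + \<bar>r n y\<bar>\<^sup>2" using sum_squares_bound[of "\<bar>r n x\<bar>" "\<bar>r n y\<bar>"] by simp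
      moreover have "0 \<le> \<bar>r n x\<bar> * \<bar>r n y\<bar>" by simp
      ultimately show ?thesis unfolding power2_abs real_norm_def abs_mult by linarith
    qed
  qed simp
  let ?Q = "\<Sum>x\<in>I. \<Sum>y\<in>I. v x * v y * (\<Sum>\<^sub>\<infinity>n\<in>J. r n x * r n y)"
  have "(\<lambda>N. \<Sum>x\<in>I. \<Sum>y\<in>I. v x * v y * (\<Sum>n\<in>?S N. r n x * r n y)) \<longlonglongrightarrow> ?Q"
    by (intro tendsto_sum tendsto_mult tendsto_const symmetric_partial_sums cov)
  moreover have "(\<Sum>x\<in>I. \<Sum>y\<in>I. v x * v y * (\<Sum>n\<in>?S N. r n x * r n y)) = (\<Sum>n\<in>?S N. (\<Sum>x\<in>I. v x * r n x)\<^sup>2)" for N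
  proof -
    have "(\<Sum>n\<in>?S N. (\<Sum>x\<in>I. v x * r n x)\<^sup>2) = (\<Sum>n\<in>?S N. \<Sum>x\<in>I. \<Sum>y\<in>I. v x * v y * (r n x * r n y))"
      unfolding power2_eq_square sum_product by (simp add: mult_ac)
    also have "\<dots> = (\<Sum>x\<in>I. \<Sum>n\<in>?S N. \<Sum>y\<in>I. v x * v y * (r n x * r n y))" by (rule sum.swap)
    also have "\<dots> = (\<Sum>x\<in>I. \<Sum>y\<in>I. \<Sum>n\<in>?S N. v x * v y * (r n x * r n y))"
      by (intro sum.cong refl) (rule sum.swap)
    finally show ?thesis by (simp add: sum_distrib_left)
  qed
  ultimately have "(\<lambda>N. \<Sum>n\<in>?S N. (\<Sum>x\<in>I. v x * r n x)\<^sup>2) \<longlonglongrightarrow> ?Q" by simp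
  then have "(\<lambda>N. complex_of_real (exp (- (\<Sum>n\<in>?S N. (\<Sum>x\<in>I. v x * r n x)\<^sup>2) / 2))) \<longlonglongrightarrow> of_real (exp (- ?Q / 2))"
    by (intro tendsto_of_real tendsto_exp tendsto_divide tendsto_minus tendsto_const) auto
  then show "(LINT \<xi>|M. iexp (\<Sum>x\<in>I. v x * X x \<xi>)) = of_real (exp (- ?Q / 2))"
    using LIMSEQ_unique[OF lim[OF I]] by blast
qed

section \<open>Kernels with prescribed real zeros\<close>

text \<open>
  The kernels \<open>k n z = c n * s z / (z - w n)\<close>, written without division. The function \<open>s\<close> vanishes exactly at the
  points \<open>w n\<close>; that its zeros there are simple is contained in \<open>k n (w n) \<noteq> 0\<close>.
\<close>
locale kernel_system =
  fixes J :: "int set" and k :: "int \<Rightarrow> complex \<Rightarrow> complex" and w c :: "int \<Rightarrow> real" and s :: "complex \<Rightarrow> complex"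
  assumes s_hol: "s holomorphic_on UNIV" and s_real: "\<And>x::real. s (of_real x) \<in> \<real>"
    and s_zero: "\<And>z. s z = 0 \<Longrightarrow> \<exists>n\<in>J. z = of_real (w n)"
    and w_inj: "inj_on w J"
    and k_hol: "\<And>n. n \<in> J \<Longrightarrow> k n holomorphic_on UNIV"
    and k_real: "\<And>n (x::real). n \<in> J \<Longrightarrow> k n (of_real x) \<in> \<real>"
    and k_eq: "\<And>n z. n \<in> J \<Longrightarrow> k n z * (z - of_real (w n)) = of_real (c n) * s z"
    and c_nz: "\<And>n. n \<in> J \<Longrightarrow> c n \<noteq> 0"
    and k_diag: "\<And>n. n \<in> J \<Longrightarrow> k n (of_real (w n)) \<noteq> 0"
    and J_ne: "J \<noteq> {}"
    and sq_summable: "\<And>x. (\<lambda>n. (rd (k n) 0 x)\<^sup>2) summable_on J"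
begin

lemma s_w: "n \<in> J \<Longrightarrow> s (of_real (w n)) = 0"
  using k_eq[of n "of_real (w n)"] c_nz[of n] by simp

lemma k_re: "n \<in> J \<Longrightarrow> k n (of_real x) = of_real (rd (k n) 0 x)"
  using k_real[of n x] by (simp add: rd_def)

lemma s_re: "s (of_real x) = of_real (rd s 0 x)"
  using s_real[of x] by (simp add: rd_def)

lemma kr_eq:
  assumes n: "n \<in> J"
  shows "rd (k n) 0 x * (x - w n) = c n * rd s 0 x"
proof -
  have "complex_of_real (rd (k n) 0 x * (x - w n)) = k n (of_real x) * (of_real x - of_real (w n))"
    by (simp add: k_re[OF n])
  also have "\<dots> = of_real (c n) * s (of_real x)" by (rule k_eq[OF n])
  also have "\<dots> = complex_of_real (c n * rd s 0 x)" by (simp add: s_re)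
  finally show ?thesis by (simp only: of_real_eq_iff)
qed

lemma s_nonreal: "s \<i> \<noteq> 0"
proof
  assume "s \<i> = 0"
  then obtain n where "\<i> = complex_of_real (w n)" using s_zero by blast
  from arg_cong[OF this, of Im] show False by simp
qed

lemma k_nonzero: "n \<in> J \<Longrightarrow> rd s 0 x \<noteq> 0 \<Longrightarrow> rd (k n) 0 x \<noteq> 0"
  using kr_eq[of n x] c_nz[of n] by auto

lemma s_real_nonzero: "\<exists>x. rd s 0 x \<noteq> 0"
proof (rule ccontr)
  assume "\<nexists>x. rd s 0 x \<noteq> 0"
  then have z: "rd s 0 x = 0" for x by blast
  have "s \<i> = 0"
    by (rule entire_eqI_real[where g = "\<lambda>_. 0", OF s_hol holomorphic_on_const]) (simp add: s_re z)
  then show False using s_nonreal by simp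
qed

lemma finite_near: "finite {n\<in>J. cmod (of_real (w n) - z) \<le> R}"
proof -
  have nc: "\<not> s constant_on UNIV"
  proof
    assume "s constant_on UNIV"
    then obtain d where d: "\<And>z. s z = d" unfolding constant_on_def by auto
    obtain n where "n \<in> J" using J_ne by blast
    then show False using d s_w[of n] s_nonreal by metis
  qed
  have "finite {u\<in>cball z R. s u = 0}"
    by (rule holomorphic_compact_finite_zeros[OF s_hol open_UNIV connected_UNIV compact_cball subset_UNIV nc])
  moreover have "(\<lambda>n. complex_of_real (w n)) ` {n\<in>J. cmod (of_real (w n) - z) \<le> R} \<subseteq> {u\<in>cball z R. s u = 0}"
    using s_w by (auto simp: dist_norm norm_minus_commute)
  ultimately have "finite ((\<lambda>n. complex_of_real (w n)) ` {n\<in>J. cmod (of_real (w n) - z) \<le> R})"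
    by (rule rev_finite_subset)
  then show ?thesis
    by (rule finite_imageD) (use w_inj in \<open>auto simp: inj_on_def\<close>)
qed

text \<open>
  Away from the finitely many nearby points \<open>w n\<close> the kernel at \<open>z\<close> is bounded by a constant multiple of the
  kernel at a fixed point \<open>x0\<close> with \<open>s x0 \<noteq> 0\<close>, since \<open>\<bar>x0 - w n\<bar>\<close> and \<open>\<bar>z - w n\<bar>\<close> are comparable. Square
  summability at \<open>x0\<close> and \<open>y\<close> then gives a summable majorant.
\<close>
lemma local_majorant:
  "\<exists>m. m summable_on J \<and> (\<forall>n\<in>J. \<forall>z\<in>cball z0 1. cmod (k n z * of_real (rd (k n) 0 y)) \<le> m n)"
proof -
  obtain x0 where x0: "rd s 0 x0 \<noteq> 0" using s_real_nonzero by blast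
  let ?K = "cball z0 1"
  have bdd: "\<exists>B\<ge>0. \<forall>z\<in>?K. cmod (f z) \<le> B" if "f holomorphic_on UNIV" for f
  proof -
    have "compact (f ` ?K)"
      by (intro compact_continuous_image compact_cball continuous_on_subset[OF holomorphic_on_imp_continuous_on[OF that]]) auto
    then have "bounded (f ` ?K)" by (rule compact_imp_bounded)
    then obtain B where "B > 0" "\<forall>z\<in>f ` ?K. cmod z \<le> B" unfolding bounded_pos by blast
    then show ?thesis by (intro exI[of _ B]) auto
  qed
  obtain S where S: "S \<ge> 0" "\<And>z. z \<in> ?K \<Longrightarrow> cmod (s z) \<le> S" using bdd[OF s_hol] by blast
  have "\<forall>n\<in>J. \<exists>B. B \<ge> 0 \<and> (\<forall>z\<in>?K. cmod (k n z) \<le> B)" using bdd k_hol by blast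
  then obtain b where b: "\<forall>n\<in>J. b n \<ge> 0 \<and> (\<forall>z\<in>?K. cmod (k n z) \<le> b n)" by (rule bchoice[THEN exE])
  \<comment> \<open>\<open>R\<close> bounds \<open>\<bar>x0 - z\<bar>\<close> on the ball, and \<open>\<bar>z - w n\<bar> \<ge> 1\<close> for \<open>n\<close> outside \<open>?J0\<close>, so \<open>\<bar>x0 - w n\<bar> \<le> (1 + R) * \<bar>z - w n\<bar>\<close>.\<close>
  define R where "R = cmod (of_real x0 - z0) + 1"
  define B where "B = (1 + R) * S / \<bar>rd s 0 x0\<bar>"
  have R: "R \<ge> 0" by (simp add: R_def)
  have B: "B \<ge> 0" using S(1) R by (simp add: B_def)
  let ?J0 = "{n\<in>J. cmod (of_real (w n) - z0) \<le> 2}"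
  define m where "m n = B * ((rd (k n) 0 x0)\<^sup>2 + (rd (k n) 0 y)\<^sup>2) + (if n \<in> ?J0 then b n * \<bar>rd (k n) 0 y\<bar> else 0)" for n
  have "m summable_on J"
    unfolding m_def
  proof (intro summable_on_add summable_on_cmult_right sq_summable)
    have "(\<lambda>n. b n * \<bar>rd (k n) 0 y\<bar>) summable_on ?J0" using finite_near by (rule summable_on_finite)
    moreover have "(\<lambda>n. b n * \<bar>rd (k n) 0 y\<bar>) summable_on ?J0 \<longleftrightarrow>
        (\<lambda>n. if n \<in> ?J0 then b n * \<bar>rd (k n) 0 y\<bar> else 0) summable_on J"
      by (rule summable_on_cong_neutral) auto
    ultimately show "(\<lambda>n. if n \<in> ?J0 then b n * \<bar>rd (k n) 0 y\<bar> else 0) summable_on J" by blast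
  qed
  moreover have "cmod (k n z * of_real (rd (k n) 0 y)) \<le> m n" if n: "n \<in> J" and z: "z \<in> ?K" for n z
  proof (cases "n \<in> ?J0")
    case True
    have "cmod (k n z * of_real (rd (k n) 0 y)) \<le> b n * \<bar>rd (k n) 0 y\<bar>"
      unfolding norm_mult norm_of_real using b n z by (intro mult_right_mono) auto
    moreover have "0 \<le> B * ((rd (k n) 0 x0)\<^sup>2 + (rd (k n) 0 y)\<^sup>2)" using B by simp
    ultimately show ?thesis unfolding m_def if_P[OF True] by linarith
  next
    case False
    then have far: "cmod (of_real (w n) - z0) > 2" using n by auto
    have z1: "cmod (z0 - z) \<le> 1" using z by (simp add: dist_norm)
    have "cmod (of_real (w n) - z0) \<le> cmod (of_real (w n) - z) + cmod (z - z0)"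
      using norm_triangle_ineq[of "of_real (w n) - z" "z - z0"] by simp
    then have d: "cmod (z - of_real (w n)) \<ge> 1" using far z1 by (simp add: norm_minus_commute)
    have "cmod (of_real x0 - of_real (w n)) \<le> cmod (of_real x0 - z) + cmod (z - of_real (w n))"
      using norm_triangle_ineq[of "of_real x0 - z" "z - of_real (w n)"] by simp
    moreover have "cmod (of_real x0 - z) \<le> cmod (of_real x0 - z0) + cmod (z0 - z)"
      using norm_triangle_ineq[of "of_real x0 - z0" "z0 - z"] by simp
    ultimately have "cmod (of_real x0 - of_real (w n)) \<le> R + cmod (z - of_real (w n))"
      using z1 by (simp add: R_def)
    also have "\<dots> \<le> R * cmod (z - of_real (w n)) + cmod (z - of_real (w n))"
      using mult_left_mono[OF d R] by simp
    finally have x: "\<bar>x0 - w n\<bar> \<le> (1 + R) * cmod (z - of_real (w n))"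
      unfolding of_real_diff[symmetric] norm_of_real by (simp add: algebra_simps)
    have e0: "\<bar>rd (k n) 0 x0\<bar> * \<bar>x0 - w n\<bar> = \<bar>c n\<bar> * \<bar>rd s 0 x0\<bar>"
      using arg_cong[OF kr_eq[OF n, of x0], of abs] by (simp only: abs_mult)
    have ez: "cmod (k n z) * cmod (z - of_real (w n)) = \<bar>c n\<bar> * cmod (s z)"
      using arg_cong[OF k_eq[OF n, of z], of cmod] by (simp only: norm_mult norm_of_real)
    have "cmod (k n z) * cmod (z - of_real (w n)) * \<bar>rd s 0 x0\<bar> = \<bar>rd (k n) 0 x0\<bar> * \<bar>x0 - w n\<bar> * cmod (s z)"
      unfolding ez e0 by simp
    also have "\<dots> \<le> \<bar>rd (k n) 0 x0\<bar> * ((1 + R) * cmod (z - of_real (w n))) * S"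
      using x S z R by (intro mult_mono mult_nonneg_nonneg) auto
    finally have "(cmod (k n z) * \<bar>rd s 0 x0\<bar>) * cmod (z - of_real (w n)) \<le> (\<bar>rd (k n) 0 x0\<bar> * (1 + R) * S) * cmod (z - of_real (w n))"
      by (simp add: mult_ac)
    then have "cmod (k n z) * \<bar>rd s 0 x0\<bar> \<le> \<bar>rd (k n) 0 x0\<bar> * (1 + R) * S"
      by (rule mult_right_le_imp_le) (use d in linarith)
    then have kz: "cmod (k n z) \<le> B * \<bar>rd (k n) 0 x0\<bar>"
      using x0 by (simp add: B_def field_simps)
    have "cmod (k n z * of_real (rd (k n) 0 y)) \<le> B * \<bar>rd (k n) 0 x0\<bar> * \<bar>rd (k n) 0 y\<bar>"
      unfolding norm_mult norm_of_real using kz by (intro mult_right_mono) auto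
    also have "\<dots> \<le> B * ((rd (k n) 0 x0)\<^sup>2 + (rd (k n) 0 y)\<^sup>2)"
    proof -
      have "\<bar>p\<bar> * \<bar>q\<bar> \<le> p\<^sup>2 + q\<^sup>2" for p q :: real
      proof -
        have "2 * (\<bar>p\<bar> * \<bar>q\<bar>) \<le> \<bar>p\<bar>\<^sup>2 + \<bar>q\<bar>\<^sup>2" using sum_squares_bound[of "\<bar>p\<bar>" "\<bar>q\<bar>"] by simp
        moreover have "0 \<le> \<bar>p\<bar> * \<bar>q\<bar>" by simp
        ultimately show ?thesis unfolding power2_abs by linarith
      qed
      then show ?thesis unfolding mult.assoc by (intro mult_left_mono B)
    qed
    finally show ?thesis unfolding m_def if_not_P[OF False] by simp
  qed
  ultimately show ?thesis by blast
qed

definition D :: "real \<Rightarrow> complex \<Rightarrow> complex" where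
  "D y z = (\<Sum>\<^sub>\<infinity>n\<in>J. k n z * of_real (rd (k n) 0 y))"

definition C :: "real \<Rightarrow> real \<Rightarrow> real" where
  "C x y = (\<Sum>\<^sub>\<infinity>n\<in>J. rd (k n) 0 x * rd (k n) 0 y)"

lemma D_hol: "D y holomorphic_on UNIV"
proof -
  have "D y holomorphic_on ball z0 1" for z0
  proof -
    obtain m where m1: "m summable_on J" and m2: "\<forall>n\<in>J. \<forall>z\<in>cball z0 1. cmod (k n z * of_real (rd (k n) 0 y)) \<le> m n"
      using local_majorant[of z0 y] by (elim exE conjE)
    have ulim: "uniform_limit (cball z0 1) (\<lambda>X z. \<Sum>n\<in>X. k n z * of_real (rd (k n) 0 y)) (D y) (finite_subsets_at_top J)"
      unfolding D_def[abs_def] using m2 by (intro Weierstrass_m_test_general[OF _ m1]) simp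
    have cont: "eventually (\<lambda>X. continuous_on (cball z0 1) (\<lambda>z. \<Sum>n\<in>X. k n z * of_real (rd (k n) 0 y)) \<and>
        (\<lambda>z. \<Sum>n\<in>X. k n z * of_real (rd (k n) 0 y)) holomorphic_on ball z0 1) (finite_subsets_at_top J)"
    proof (rule eventually_finite_subsets_at_top_weakI)
      fix X assume X: "finite X" "X \<subseteq> J"
      then have h: "(\<lambda>z. \<Sum>n\<in>X. k n z * of_real (rd (k n) 0 y)) holomorphic_on UNIV"
        using k_hol by (intro holomorphic_on_sum holomorphic_intros) auto
      show "continuous_on (cball z0 1) (\<lambda>z. \<Sum>n\<in>X. k n z * of_real (rd (k n) 0 y)) \<and>
        (\<lambda>z. \<Sum>n\<in>X. k n z * of_real (rd (k n) 0 y)) holomorphic_on ball z0 1"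
        using continuous_on_subset[OF holomorphic_on_imp_continuous_on[OF h]] holomorphic_on_subset[OF h] by blast
    qed
    show ?thesis
      using holomorphic_uniform_limit[OF cont ulim finite_subsets_at_top_neq_bot] by blast
  qed
  then have "D y analytic_on UNIV"
    unfolding analytic_on_def by (intro ballI exI[of _ 1] conjI) simp_all
  then show ?thesis by (rule analytic_imp_holomorphic)
qed

lemma has_sum_C: "((\<lambda>n. rd (k n) 0 x * rd (k n) 0 y) has_sum C x y) J"
proof -
  obtain m where m: "m summable_on J" "\<forall>n\<in>J. \<forall>z\<in>cball (of_real x) 1. cmod (k n z * of_real (rd (k n) 0 y)) \<le> m n"
    using local_majorant[of "of_real x" y] by (elim exE conjE)
  have "(\<lambda>n. rd (k n) 0 x * rd (k n) 0 y) summable_on J"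
  proof (rule abs_summable_summable, rule summable_on_comparison_test[OF m(1)])
    fix n assume n: "n \<in> J"
    have "cmod (k n (of_real x) * of_real (rd (k n) 0 y)) \<le> m n" 
      using m(2)[rule_format, OF n, of "of_real x"] by simp
    then show "norm (rd (k n) 0 x * rd (k n) 0 y) \<le> m n"
      unfolding k_re[OF n] of_real_mult[symmetric] norm_of_real by simp
  qed simp
  then show ?thesis unfolding C_def by (rule has_sum_infsum)
qed

lemma D_real: "D y (of_real x) = of_real (C x y)"
proof -
  have "((\<lambda>n. complex_of_real (rd (k n) 0 x * rd (k n) 0 y)) has_sum of_real (C x y)) J"
    by (rule has_sum_of_real[OF has_sum_C])
  then have "((\<lambda>n. k n (of_real x) * of_real (rd (k n) 0 y)) has_sum of_real (C x y)) J"
    by (rule has_sum_cong[THEN iffD1, rotated]) (simp add: k_re)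
  then show ?thesis unfolding D_def by (rule infsumI)
qed

lemma C_diag_pos: "C x x > 0"
proof -
  have "\<exists>n\<in>J. rd (k n) 0 x \<noteq> 0"
  proof (cases "rd s 0 x = 0")
    case True
    then obtain n where n: "n \<in> J" "x = w n" using s_zero[of "of_real x"] by (auto simp: s_re)
    then show ?thesis using k_diag[of n] k_re[of n x] by auto
  next
    case False
    then show ?thesis using J_ne k_nonzero by blast
  qed
  then obtain n where n: "n \<in> J" "rd (k n) 0 x \<noteq> 0" by blast
  have "(\<Sum>n\<in>{n}. rd (k n) 0 x * rd (k n) 0 x) \<le> C x x"
    by (rule finite_sum_le_has_sum[OF has_sum_C]) (use n in auto)
  moreover have "rd (k n) 0 x * rd (k n) 0 x > 0" using n(2) not_real_square_gt_zero by blast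
  ultimately show ?thesis by simp
qed

text \<open>
  A partial fraction identity, which holds term by term: multiplied by \<open>c n\<close> it is a polynomial identity in the
  factors \<open>k n\<close> and \<open>x - w n\<close>, valid also at the zeros of \<open>s\<close>.
\<close>
lemma kernel_identity:
  "(x - x0) * C x x0 * rd s 0 y - (y - x0) * C y x0 * rd s 0 x = (x - y) * C x y * rd s 0 x0"
proof -
  have "((\<lambda>n. ((x - x0) * rd s 0 y) * (rd (k n) 0 x * rd (k n) 0 x0) + (- ((y - x0) * rd s 0 x)) * (rd (k n) 0 y * rd (k n) 0 x0))
     has_sum (((x - x0) * rd s 0 y) * C x x0 + (- ((y - x0) * rd s 0 x)) * C y x0)) J"
    by (rule has_sum_add[OF has_sum_cmult_right[OF has_sum_C] has_sum_cmult_right[OF has_sum_C]])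
  moreover have termwise: "((x - x0) * rd s 0 y) * (rd (k n) 0 x * rd (k n) 0 x0) + (- ((y - x0) * rd s 0 x)) * (rd (k n) 0 y * rd (k n) 0 x0) =
      ((x - y) * rd s 0 x0) * (rd (k n) 0 x * rd (k n) 0 y)" if n: "n \<in> J" for n
  proof -
    let ?k = "rd (k n) 0"
    have "c n * (((x - x0) * rd s 0 y) * (?k x * ?k x0) + (- ((y - x0) * rd s 0 x)) * (?k y * ?k x0)) =
       (x - x0) * (c n * rd s 0 y) * (?k x * ?k x0) - (y - x0) * (c n * rd s 0 x) * (?k y * ?k x0)"
      by (simp add: algebra_simps)
    also have "\<dots> = (x - y) * (?k x0 * (x0 - w n)) * (?k x * ?k y)"
      unfolding kr_eq[OF n, symmetric] by (simp add: algebra_simps)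
    also have "\<dots> = c n * (((x - y) * rd s 0 x0) * (?k x * ?k y))"
      unfolding kr_eq[OF n] by (simp add: mult_ac)
    finally show ?thesis using c_nz[OF n] by simp
  qed
  ultimately have "((\<lambda>n. ((x - y) * rd s 0 x0) * (rd (k n) 0 x * rd (k n) 0 y))
     has_sum (((x - x0) * rd s 0 y) * C x x0 + (- ((y - x0) * rd s 0 x)) * C y x0)) J"
    by (rule has_sum_cong[THEN iffD1, rotated])
  moreover have "((\<lambda>n. ((x - y) * rd s 0 x0) * (rd (k n) 0 x * rd (k n) 0 y)) has_sum (((x - y) * rd s 0 x0) * C x y)) J"
    by (rule has_sum_cmult_right[OF has_sum_C])
  ultimately have "((x - x0) * rd s 0 y) * C x x0 + (- ((y - x0) * rd s 0 x)) * C y x0 = ((x - y) * rd s 0 x0) * C x y"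
    by (rule has_sum_unique)
  then show ?thesis by (simp add: mult_ac)
qed

text \<open>
  With \<open>V = s\<close> and \<open>U z = (z - x0) * C z x0 / s x0\<close> this is \<open>kernel_identity\<close>. The quotient \<open>U / V\<close> is the Herglotz
  function with poles \<open>w n\<close> that vanishes at \<open>x0\<close>. There are no common zeros: at \<open>w n\<close> only the \<open>n\<close>-th term of \<open>U\<close> survives,
  and it is not zero.
\<close>
theorem kernel_is_pair_kernel:
  "\<exists>U V. U holomorphic_on UNIV \<and> (\<forall>x::real. U (of_real x) \<in> \<real>) \<and>
     V holomorphic_on UNIV \<and> (\<forall>x::real. V (of_real x) \<in> \<real>) \<and>
     (\<forall>z. \<not> (U z = 0 \<and> V z = 0)) \<and> (\<forall>x. wronsk U V 1 0 x > 0) \<and> (\<forall>x y. pair_kernel U V x y = C x y)"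
proof -
  obtain x0 where x0: "rd s 0 x0 \<noteq> 0" using s_real_nonzero by blast
  define U where "U z = (z - of_real x0) * D x0 z / of_real (rd s 0 x0)" for z
  have U: "U holomorphic_on UNIV"
    unfolding U_def[abs_def] using x0 by (intro holomorphic_intros D_hol) auto
  have Ux: "U (of_real x) = of_real ((x - x0) * C x x0 / rd s 0 x0)" for x
    by (simp add: U_def D_real)
  then have rU: "rd U 0 x = (x - x0) * C x x0 / rd s 0 x0" for x by (simp add: rd_def)
  have id: "rd U 0 x * rd s 0 y - rd s 0 x * rd U 0 y = (x - y) * C x y" for x y
  proof -
    have "rd U 0 x * rd s 0 y - rd s 0 x * rd U 0 y =
        ((x - x0) * C x x0 * rd s 0 y - (y - x0) * C y x0 * rd s 0 x) / rd s 0 x0"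
      unfolding rU diff_divide_distrib by simp
    also have "\<dots> = (x - y) * C x y" unfolding kernel_identity using x0 by simp
    finally show ?thesis .
  qed
  have diag: "wronsk U s 1 0 x = C x x" for x
  proof -
    have rD: "rd (D x) 0 y = C y x" for y by (simp add: rd_def D_real)
    have "((\<lambda>y. (y - x) * rd (D x) 0 y) has_real_derivative 1 * rd (D x) 0 x + rd (D x) 1 x * (x - x)) (at x)"
      using has_derivative_rd[OF D_hol, of x 0 x] by (intro DERIV_mult) (auto intro!: derivative_eq_intros)
    then have 1: "((\<lambda>y. rd U 0 y * rd s 0 x - rd s 0 y * rd U 0 x) has_real_derivative C x x) (at x)"
      by (simp add: id rD)
    have 2: "((\<lambda>y. rd U 0 y * rd s 0 x - rd s 0 y * rd U 0 x) has_real_derivative wronsk U s 1 0 x) (at x)"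
      using has_derivative_rd[OF U, of 0 x] has_derivative_rd[OF s_hol, of 0 x]
      unfolding wronsk_def by (auto intro!: derivative_eq_intros)
    show ?thesis using DERIV_unique[OF 2 1] .
  qed
  have "\<not> (U z = 0 \<and> s z = 0)" for z
  proof
    assume 0: "U z = 0 \<and> s z = 0"
    then obtain n where n: "n \<in> J" "z = of_real (w n)" using s_zero by blast
    have s0: "rd s 0 (w n) = 0" using s_w[OF n(1)] by (simp add: rd_def)
    have other: "rd (k m) 0 (w n) = 0" if "m \<in> J" "m \<noteq> n" for m
    proof -
      have "w n \<noteq> w m" using w_inj that n(1) by (auto simp: inj_on_def)
      then show ?thesis using kr_eq[OF that(1), of "w n"] s0 by simp
    qed
    have "((\<lambda>m. rd (k m) 0 (w n) * rd (k m) 0 x0) has_sum (rd (k n) 0 (w n) * rd (k n) 0 x0)) J"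
      by (rule has_sum_finite_neutralI[where B = "{n}"]) (use n other in auto)
    then have "C (w n) x0 = rd (k n) 0 (w n) * rd (k n) 0 x0"
      using has_sum_unique[OF has_sum_C] by blast
    moreover have "rd (k n) 0 (w n) \<noteq> 0" using k_diag[OF n(1)] k_re[OF n(1), of "w n"] by auto
    moreover have "rd (k n) 0 x0 \<noteq> 0" by (rule k_nonzero[OF n(1) x0])
    moreover have "w n \<noteq> x0" using s0 x0 by auto
    ultimately have "U z \<noteq> 0" unfolding n(2) Ux using x0 by simp
    then show False using 0 by simp
  qed
  moreover have "pair_kernel U s x y = C x y" for x y
    using id[of x y] diag[of x] by (cases "x = y") (simp_all add: pair_kernel_def)
  moreover have "wronsk U s 1 0 x > 0" for x using diag C_diag_pos by simp
  moreover have "U (of_real x) \<in> \<real>" for x :: real unfolding Ux by simp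
  ultimately show ?thesis using U s_hol s_real by blast
qed
end

section \<open>The kernels of a de Branges basis\<close>

lemma holomorphic_conj_reflect:
  assumes "f holomorphic_on UNIV"
  shows "conj_reflect f holomorphic_on UNIV"
proof -
  have "cnj \<circ> f \<circ> cnj holomorphic_on UNIV"
    by (rule holomorphic_on_compose_cnj_cnj) (use assms holomorphic_on_subset in auto)
  then show ?thesis by (simp add: conj_reflect_def[abs_def] comp_def)
qed

lemma phase_point_eq:
  assumes "phase_function E \<phi>" "n \<in> phase_indices \<phi> \<alpha>"
  shows "\<phi> (phase_point \<phi> \<alpha> n) = \<alpha> + pi * of_int n"
proof -
  obtain x where x: "\<phi> x = \<alpha> + pi * of_int n" using assms(2) by (auto simp: phase_indices_def)
  have "strict_mono \<phi>" using assms(1) by (simp add: phase_function_def)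
  then have "phase_point \<phi> \<alpha> n = x"
    unfolding phase_point_def using x strict_mono_eq[of \<phi> _ x] by (intro the_equality) simp_all
  then show ?thesis using x by simp
qed

text \<open>
  The entire function \<open>s z / (z - a)\<close> for a zero \<open>a\<close> of \<open>s\<close>.
\<close>
definition divided_zero :: "(complex \<Rightarrow> complex) \<Rightarrow> complex \<Rightarrow> complex \<Rightarrow> complex" where
  "divided_zero s a z = (if z = a then deriv s a else s z / (z - a))"

lemma holomorphic_divided_zero:
  assumes "s holomorphic_on UNIV" "s a = 0"
  shows "divided_zero s a holomorphic_on UNIV"
  by (rule pole_theorem_0[OF assms(1), of a]) (auto simp: divided_zero_def assms(2))

lemma real_deriv_of_real:
  assumes s: "s holomorphic_on UNIV" and re: "\<And>x::real. s (of_real x) \<in> \<real>"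
  shows "deriv s (of_real x) \<in> \<real>"
proof -
  have "(s has_field_derivative deriv s (of_real x)) (at (of_real x))" using s by (simp add: holomorphic_derivI)
  then have "((\<lambda>x. s (of_real x)) has_vector_derivative deriv s (of_real x)) (at x)"
    by (rule has_vector_derivative_real_field)
  then have "((\<lambda>x. Im (s (of_real x))) has_vector_derivative Im (deriv s (of_real x))) (at x)"
    by (rule bounded_linear.has_vector_derivative[OF bounded_linear_Im])
  moreover have "Im (s (of_real y)) = 0" for y using re[of y] by (simp add: complex_is_Real_iff)
  ultimately have "((\<lambda>x. 0 :: real) has_vector_derivative Im (deriv s (of_real x))) (at x)" by simp
  then have "Im (deriv s (of_real x)) = 0"
    using vector_derivative_unique_at[OF _ has_vector_derivative_const] by blast
  then show ?thesis by (simp add: complex_is_Real_iff)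
qed

text \<open>
  Up to a real factor and the sign \<open>(- 1) ^ n\<close>, all the kernels \<open>db_kernel E z (w n)\<close> have the same numerator
  \<open>s z = \<i> / 2 * (E z * exp (\<i> * \<alpha>) - conj_reflect E z * exp (- \<i> * \<alpha>))\<close>, as \<open>\<phi> (w n)\<close> equals \<open>\<alpha>\<close> modulo \<open>pi\<close>. A zero of \<open>s\<close>
  satisfies \<open>\<bar>E z\<bar> = \<bar>conj_reflect E z\<bar>\<close>, so it is real, and on the real line \<open>s x = \<bar>E x\<bar> * sin (\<phi> x - \<alpha>)\<close>. Unit
  norm excludes the degenerate case of a vanishing kernel.
\<close>
theorem phase_kernels_structure:
  fixes E \<phi> \<alpha>
  defines "J \<equiv> phase_indices \<phi> \<alpha>"
    and "w \<equiv> phase_point \<phi> \<alpha>"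
    and "k \<equiv> (\<lambda>n. db_normalized_kernel E (phase_point \<phi> \<alpha> n))"
  assumes E: "hermite_biehler E" and \<phi>: "phase_function E \<phi>" and norm1: "\<And>n. n \<in> J \<Longrightarrow> db_inner E (k n) (k n) = 1"
  obtains s c where "s holomorphic_on UNIV" "\<And>x::real. s (of_real x) \<in> \<real>"
    "\<And>z. s z = 0 \<Longrightarrow> \<exists>n\<in>J. z = of_real (w n)" "inj_on w J"
    "\<And>n. n \<in> J \<Longrightarrow> k n holomorphic_on UNIV" "\<And>n (x::real). n \<in> J \<Longrightarrow> k n (of_real x) \<in> \<real>"
    "\<And>n z. n \<in> J \<Longrightarrow> k n z * (z - of_real (w n)) = of_real (c n) * s z"
    "\<And>n. n \<in> J \<Longrightarrow> c n \<noteq> 0" "\<And>n. n \<in> J \<Longrightarrow> k n (of_real (w n)) \<noteq> 0"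
proof -
  have Eh: "E holomorphic_on UNIV" and Egt: "\<And>z. Im z > 0 \<Longrightarrow> cmod (conj_reflect E z) < cmod (E z)"
    and Enz: "\<And>x::real. E (of_real x) \<noteq> 0" using E by (auto simp: hermite_biehler_def)
  have sm: "strict_mono \<phi>" and Ephase: "\<And>x. E (of_real x) = of_real (cmod (E (of_real x))) * exp (- \<i> * of_real (\<phi> x))"
    using \<phi> by (auto simp: phase_function_def)
  have wn: "\<phi> (w n) = \<alpha> + pi * of_int n" if "n \<in> J" for n
    using phase_point_eq[OF \<phi>] that by (simp add: J_def w_def)
  have wuniq: "x = w n" if "\<phi> x = \<alpha> + pi * of_int n" "n \<in> J" for x n
    using wn[OF that(2)] that(1) sm by (metis strict_mono_eq)
  define u where "u = exp (\<i> * of_real \<alpha>)"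
  have cu: "cnj u = exp (- (\<i> * of_real \<alpha>))" by (simp add: u_def exp_cnj)
  have ucu: "u * cnj u = 1" by (simp add: cu) (simp add: u_def exp_minus)
  have nu: "cmod u = 1" by (simp add: u_def)
  define s where "s z = \<i> / 2 * (E z * u - conj_reflect E z * cnj u)" for z
  have sh: "s holomorphic_on UNIV"
    unfolding s_def[abs_def] by (intro holomorphic_intros Eh holomorphic_conj_reflect)
  have cr: "conj_reflect E (of_real x) = cnj (E (of_real x))" for x :: real by (simp add: conj_reflect_def)
  have s_val: "s (of_real x) = of_real (cmod (E (of_real x)) * sin (\<phi> x - \<alpha>))" for x :: real
  proof -
    let ?r = "cmod (E (of_real x))"
    have "E (of_real x) * u = of_real ?r * exp (\<i> * of_real (\<alpha> - \<phi> x))"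
      by (subst Ephase) (simp add: u_def exp_add[symmetric] algebra_simps)
    then have 1: "E (of_real x) * u = of_real ?r * cis (\<alpha> - \<phi> x)" by (simp add: cis_conv_exp)
    then have 2: "cnj (E (of_real x)) * cnj u = of_real ?r * cnj (cis (\<alpha> - \<phi> x))"
      by (metis complex_cnj_mult complex_cnj_complex_of_real)
    have "s (of_real x) = \<i> / 2 * (of_real ?r * (cis (\<alpha> - \<phi> x) - cnj (cis (\<alpha> - \<phi> x))))"
      unfolding s_def cr 1 2 by (simp add: algebra_simps)
    also have "cis (\<alpha> - \<phi> x) - cnj (cis (\<alpha> - \<phi> x)) = 2 * \<i> * of_real (sin (\<alpha> - \<phi> x))"
      by (simp add: complex_eq_iff)
    also have "\<i> / 2 * (of_real ?r * (2 * \<i> * of_real (sin (\<alpha> - \<phi> x)))) = of_real (- ?r * sin (\<alpha> - \<phi> x))"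
      by (simp add: complex_eq_iff)
    also have "- ?r * sin (\<alpha> - \<phi> x) = ?r * sin (\<phi> x - \<alpha>)" using sin_minus[of "\<phi> x - \<alpha>"] by simp
    finally show ?thesis .
  qed
  have sr: "s (of_real x) \<in> \<real>" for x :: real unfolding s_val by simp
  have s0: "\<exists>n\<in>J. z = of_real (w n)" if z: "s z = 0" for z
  proof -
    have eq: "cmod (E z) = cmod (conj_reflect E z)"
    proof -
      have "E z * u = conj_reflect E z * cnj u" using z by (simp add: s_def)
      then have "cmod (E z * u) = cmod (conj_reflect E z * cnj u)" by simp
      then show ?thesis by (simp add: norm_mult nu)
    qed
    have "Im z = 0"
    proof (rule ccontr)
      assume "Im z \<noteq> 0"
      then consider "Im z > 0" | "Im (cnj z) > 0" by (cases "Im z > 0") auto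
      then show False
      proof cases
        case 1 then show ?thesis using Egt[of z] eq by simp
      next
        case 2 then show ?thesis using Egt[of "cnj z"] eq by (simp add: conj_reflect_def)
      qed
    qed
    then have zr: "z = of_real (Re z)" by (simp add: complex_eq_iff)
    then have "sin (\<phi> (Re z) - \<alpha>) = 0" using z s_val[of "Re z"] Enz[of "Re z"] by (metis mult_eq_0_iff norm_eq_zero of_real_eq_0_iff)
    then obtain i :: int where "\<phi> (Re z) - \<alpha> = of_int i * pi" unfolding sin_zero_iff_int2 by blast
    then have i: "\<phi> (Re z) = \<alpha> + pi * of_int i" by (simp add: algebra_simps)
    then have "i \<in> J" by (auto simp: J_def phase_indices_def)
    then show ?thesis using wuniq[OF i] zr by metis
  qed
  have winj: "inj_on w J"
  proof (rule inj_onI)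
    fix m n assume "m \<in> J" "n \<in> J" "w m = w n"
    then have "\<alpha> + pi * of_int m = \<alpha> + pi * of_int n" using wn by metis
    then show "m = n" by simp
  qed
  define \<beta> where "\<beta> n = cmod (E (of_real (w n))) * (if even n then 1 else - 1) / pi" for n
  have sw: "s (of_real (w n)) = 0" if n: "n \<in> J" for n
  proof -
    have "sin (\<phi> (w n) - \<alpha>) = 0" unfolding sin_zero_iff_int2 using wn[OF n] by auto
    then show ?thesis unfolding s_val by simp
  qed
  have kern: "db_kernel E z (of_real (w n)) = of_real (\<beta> n) * divided_zero s (of_real (w n)) z" if n: "n \<in> J" for n z
  proof -
    define r where "r = cmod (E (of_real (w n)))"
    define e :: real where "e = (if even n then 1 else - 1)"
    have "exp (- \<i> * of_real (\<phi> (w n))) = cis (- (\<alpha> + pi * of_int n))" unfolding wn[OF n] cis_conv_exp by (simp add: algebra_simps)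
    also have "\<dots> = cis (- \<alpha>) * cis (- (pi * of_int n))" by (simp add: cis_mult)
    also have "cis (- (pi * of_int n)) = of_real e"
      by (simp add: complex_eq_iff cos_npi_int e_def)
    also have "cis (- \<alpha>) = cnj u" by (simp add: u_def cis_conv_exp[symmetric] cis_cnj)
    finally have "E (of_real (w n)) = of_real r * (cnj u * of_real e)" using Ephase[of "w n"] by (simp add: r_def)
    then have E1: "E (of_real (w n)) = of_real (r * e) * cnj u" by (simp only: of_real_mult mult_ac)
    then have E2: "cnj (E (of_real (w n))) = of_real (r * e) * u"
      by (simp only: complex_cnj_mult complex_cnj_complex_of_real complex_cnj_cnj)
    have num: "E z * cnj (E (of_real (w n))) - conj_reflect E z * cnj (conj_reflect E (of_real (w n))) =
        of_real (r * e) * (2 / \<i>) * s z" for z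
      unfolding cr complex_cnj_cnj E2 E1 by (simp add: s_def algebra_simps)
    have dn: "deriv (\<lambda>z. of_real (r * e) * (2 / \<i>) * s z) (of_real (w n)) = of_real (r * e) * (2 / \<i>) * deriv s (of_real (w n))"
      using sh by (intro deriv_cmult) (simp add: holomorphic_on_imp_differentiable_at)
    have co: "\<i> / (2 * of_real pi) * (of_real (r * e) * (2 / \<i>) * x) = of_real (\<beta> n) * x" for x
    proof -
      have b: "complex_of_real (\<beta> n) = of_real r * of_real e / of_real pi"
        by (simp only: \<beta>_def r_def e_def of_real_mult of_real_divide)
      show ?thesis unfolding b by (simp add: field_simps)
    qed
    show ?thesis
    proof (cases "z = of_real (w n)")
      case True
      then show ?thesis
        unfolding db_kernel_def Let_def num divided_zero_def using dn co by simp
    next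
      case False
      then show ?thesis
        unfolding db_kernel_def Let_def num divided_zero_def using co[of "s z / (z - of_real (w n))"] by simp
    qed
  qed
  define g where "g n = divided_zero s (of_real (w n))" for n
  define c where "c n = \<beta> n / sqrt (\<beta> n * Re (deriv s (of_real (w n))))" for n
  have dreal: "deriv s (of_real x) = of_real (Re (deriv s (of_real x)))" for x
    using real_deriv_of_real[OF sh sr, of x] by simp
  have kg: "k n z = of_real (c n) * g n z" if n: "n \<in> J" for n z
  proof -
    have "Re (db_kernel E (of_real (w n)) (of_real (w n))) = \<beta> n * Re (deriv s (of_real (w n)))"
      unfolding kern[OF n] by (simp add: divided_zero_def)
    then show ?thesis
      unfolding k_def db_normalized_kernel_def w_def[symmetric] kern[OF n] c_def g_def by simp
  qed
  have c0: "c n \<noteq> 0" if n: "n \<in> J" for n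
  proof
    assume "c n = 0"
    then have "k n z = 0" for z using kg[OF n] by simp
    then have "db_inner E (k n) (k n) = 0" by (simp add: db_inner_def)
    then show False using norm1[OF n] by simp
  qed
  have "k n (of_real (w n)) \<noteq> 0" if n: "n \<in> J" for n
  proof -
    have "Re (deriv s (of_real (w n))) \<noteq> 0" using c0[OF n] by (auto simp: c_def)
    then have "deriv s (of_real (w n)) \<noteq> 0" by auto
    then show ?thesis unfolding kg[OF n] using c0[OF n] by (simp add: g_def divided_zero_def)
  qed
  moreover have "k n z * (z - of_real (w n)) = of_real (c n) * s z" if n: "n \<in> J" for n z
    unfolding kg[OF n] using sw[OF n] by (simp add: g_def divided_zero_def)
  moreover have "k n holomorphic_on UNIV" if n: "n \<in> J" for n
  proof -
    have "(\<lambda>z. of_real (c n) * g n z) holomorphic_on UNIV"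
      unfolding g_def by (intro holomorphic_intros holomorphic_divided_zero sh sw[OF n])
    then show ?thesis using kg[OF n] by (simp add: fun_eq_iff[symmetric] cong: holomorphic_cong)
  qed
  moreover have "k n (of_real x) \<in> \<real>" if n: "n \<in> J" for n and x :: real
    unfolding kg[OF n] g_def divided_zero_def using sr[of x] real_deriv_of_real[OF sh sr, of "w n"]
    by (auto intro!: Reals_mult Reals_divide Reals_diff)
  ultimately show thesis
    using sh sr s0 winj c0 that[of s c] by blast
qed

section \<open>Equal intensities give equal laws\<close>

text \<open>
  The kernels of the basis form a \<open>kernel_system\<close>, whose sum is the covariance of the series. A locally
  finite intensity excludes an empty basis, for which \<open>F\<close> would vanish
  identically and have infinitely many zeros in every interval.
\<close>
lemma de_branges_GAF_is_gaussian_entire: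
  assumes gaf: "de_branges_GAF M F" and \<rho>: "first_intensity M F \<rho>"
  shows "\<exists>U V. gaussian_entire M F U V"
proof -
  obtain E \<phi> \<alpha> a where E: "hermite_biehler E" and \<phi>: "phase_function E \<phi>"
    and onb: "db_orthonormal_basis E (phase_indices \<phi> \<alpha>) (\<lambda>n. db_normalized_kernel E (phase_point \<phi> \<alpha> n))"
    and indep: "prob_space.indep_vars M (\<lambda>_. borel) a (phase_indices \<phi> \<alpha>)"
    and normal: "\<And>n. n \<in> phase_indices \<phi> \<alpha> \<Longrightarrow> distributed M lborel (a n) (\<lambda>x. ennreal (std_normal_density x))"
    and conv: "AE \<xi> in M. \<forall>C. compact C \<longrightarrow> uniform_limit C
        (\<lambda>N z. \<Sum>n\<in>{n\<in>phase_indices \<phi> \<alpha>. \<bar>n\<bar> \<le> int N}. of_real (a n \<xi>) * db_normalized_kernel E (phase_point \<phi> \<alpha> n) z)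
        (F \<xi>) sequentially"
    using gaf unfolding de_branges_GAF_def Let_def by blast
  have M: "prob_space M" and Fm: "\<And>z. (\<lambda>\<xi>. F \<xi> z) \<in> borel_measurable M"
    and Fh: "\<And>\<xi>. \<xi> \<in> space M \<Longrightarrow> F \<xi> holomorphic_on UNIV"
    using gaf unfolding de_branges_GAF_def by blast+
  interpret prob_space M by (rule M)
  define J where "J = phase_indices \<phi> \<alpha>"
  define w where "w = phase_point \<phi> \<alpha>"
  define k where "k n = db_normalized_kernel E (w n)" for n
  have "db_inner E (k n) (k n) = 1" if "n \<in> J" for n
    using onb that unfolding db_orthonormal_basis_def J_def k_def w_def by simp
  then obtain s c where sh: "s holomorphic_on UNIV" and sr: "\<And>x::real. s (of_real x) \<in> \<real>"
    and s0: "\<And>z. s z = 0 \<Longrightarrow> \<exists>n\<in>J. z = of_real (w n)" and winj: "inj_on w J"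
    and kh: "\<And>n. n \<in> J \<Longrightarrow> k n holomorphic_on UNIV" and kr: "\<And>n (x::real). n \<in> J \<Longrightarrow> k n (of_real x) \<in> \<real>"
    and keq: "\<And>n z. n \<in> J \<Longrightarrow> k n z * (z - of_real (w n)) = of_real (c n) * s z"
    and c0: "\<And>n. n \<in> J \<Longrightarrow> c n \<noteq> 0" and kd: "\<And>n. n \<in> J \<Longrightarrow> k n (of_real (w n)) \<noteq> 0"
    using phase_kernels_structure[OF E \<phi>, of \<alpha>] unfolding J_def k_def w_def by blast
  have lim: "AE \<xi> in M. \<forall>z. (\<lambda>N. \<Sum>n\<in>{n\<in>J. \<bar>n\<bar> \<le> int N}. of_real (a n \<xi>) * k n z) \<longlonglongrightarrow> F \<xi> z"
    using conv
  proof (rule AE_mp, intro AE_I2 impI allI)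
    fix \<xi> z assume "\<forall>C. compact C \<longrightarrow> uniform_limit C
        (\<lambda>N z. \<Sum>n\<in>{n\<in>phase_indices \<phi> \<alpha>. \<bar>n\<bar> \<le> int N}. of_real (a n \<xi>) * db_normalized_kernel E (phase_point \<phi> \<alpha> n) z)
        (F \<xi>) sequentially"
    then have "uniform_limit {z} (\<lambda>N z. \<Sum>n\<in>{n\<in>J. \<bar>n\<bar> \<le> int N}. of_real (a n \<xi>) * k n z) (F \<xi>) sequentially"
      unfolding J_def k_def w_def using compact_sing by blast
    then show "(\<lambda>N. \<Sum>n\<in>{n\<in>J. \<bar>n\<bar> \<le> int N}. of_real (a n \<xi>) * k n z) \<longlonglongrightarrow> F \<xi> z"
      by (rule tendsto_uniform_limitI) simp
  qed
  have kx: "k n (of_real x) = of_real (rd (k n) 0 x)" if "n \<in> J" for n x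
    using kr[OF that, of x] by (simp add: rd_def)
  have part: "(\<Sum>n\<in>{n\<in>J. \<bar>n\<bar> \<le> int N}. of_real (a n \<xi>) * k n (of_real x)) =
      of_real (\<Sum>n\<in>{n\<in>J. \<bar>n\<bar> \<le> int N}. a n \<xi> * rd (k n) 0 x)" for N \<xi> x
    unfolding of_real_sum by (intro sum.cong refl) (simp add: kx)
  have Freal: "AE \<xi> in M. \<forall>x::real. F \<xi> (of_real x) \<in> \<real>"
    using lim
  proof (rule AE_mp, intro AE_I2 impI allI)
    fix \<xi> and x :: real
    assume "\<forall>z. (\<lambda>N. \<Sum>n\<in>{n\<in>J. \<bar>n\<bar> \<le> int N}. of_real (a n \<xi>) * k n z) \<longlonglongrightarrow> F \<xi> z"
    then have "(\<lambda>N. complex_of_real (\<Sum>n\<in>{n\<in>J. \<bar>n\<bar> \<le> int N}. a n \<xi> * rd (k n) 0 x)) \<longlonglongrightarrow> F \<xi> (of_real x)"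
      unfolding part[symmetric] by blast
    then show "F \<xi> (of_real x) \<in> \<real>"
      by (rule Lim_in_closed_set[OF closed_complex_Reals, rotated 2]) auto
  qed
  have convR: "AE \<xi> in M. (\<lambda>N. \<Sum>n\<in>{n\<in>J. \<bar>n\<bar> \<le> int N}. a n \<xi> * rd (k n) 0 x) \<longlonglongrightarrow> rd (F \<xi>) 0 x" for x
    using lim
  proof (rule AE_mp, intro AE_I2 impI)
    fix \<xi>
    assume "\<forall>z. (\<lambda>N. \<Sum>n\<in>{n\<in>J. \<bar>n\<bar> \<le> int N}. of_real (a n \<xi>) * k n z) \<longlonglongrightarrow> F \<xi> z"
    then have "(\<lambda>N. complex_of_real (\<Sum>n\<in>{n\<in>J. \<bar>n\<bar> \<le> int N}. a n \<xi> * rd (k n) 0 x)) \<longlonglongrightarrow> F \<xi> (of_real x)"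
      unfolding part[symmetric] by blast
    from tendsto_Re[OF this] show "(\<lambda>N. \<Sum>n\<in>{n\<in>J. \<bar>n\<bar> \<le> int N}. a n \<xi> * rd (k n) 0 x) \<longlonglongrightarrow> rd (F \<xi>) 0 x"
      unfolding rd_def[of "F \<xi>"] Re_complex_of_real by simp
  qed
  have Xm: "(\<lambda>\<xi>. rd (F \<xi>) 0 x) \<in> borel_measurable M" for x
    unfolding rd_def using Fm by simp
  note indep' = indep[folded J_def]
  have normal': "distributed M lborel (a n) (\<lambda>x. ennreal (std_normal_density x))" if "n \<in> J" for n
    using normal that by (simp add: J_def)
  have sq: "(\<lambda>n. (rd (k n) 0 x)\<^sup>2) summable_on J" for x
    by (rule gaussian_series_char(1)[OF indep' normal' Xm convR])
  have charF: "(LINT \<xi>|M. iexp (\<Sum>x\<in>I. v x * rd (F \<xi>) 0 x)) =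
      of_real (exp (- (\<Sum>x\<in>I. \<Sum>y\<in>I. v x * v y * (\<Sum>\<^sub>\<infinity>n\<in>J. rd (k n) 0 x * rd (k n) 0 y)) / 2))" if "finite I" for I v
    by (rule gaussian_series_char(2)[OF indep' normal' Xm convR that])
  have Jne: "J \<noteq> {}"
  proof
    assume J: "J = {}"
    have "AE \<xi> in M. zero_count (F \<xi>) {0..1} = \<infinity>"
      using lim
    proof (rule AE_mp, intro AE_I2 impI)
      fix \<xi> assume "\<forall>z. (\<lambda>N. \<Sum>n\<in>{n\<in>J. \<bar>n\<bar> \<le> int N}. of_real (a n \<xi>) * k n z) \<longlonglongrightarrow> F \<xi> z"
      then have "F \<xi> z = 0" for z using J by (simp add: LIMSEQ_const_iff)
      then have "real_zeros (F \<xi>) \<inter> {0..1} = {0..1}" by (simp add: real_zeros_def)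
      then show "zero_count (F \<xi>) {0..1} = \<infinity>"
        unfolding zero_count_def by (simp add: emeasure_count_space_infinite)
    qed
    then have "(\<integral>\<^sup>+\<xi>. zero_count (F \<xi>) {0..1} \<partial>M) = (\<integral>\<^sup>+\<xi>. \<infinity> \<partial>M)" by (rule nn_integral_cong_AE)
    then have inf: "(\<integral>\<^sup>+x\<in>{0..1}. ennreal (\<rho> x) \<partial>lborel) = \<infinity>"
      using \<rho> by (simp add: first_intensity_def emeasure_space_1)
    have "continuous_on {0..1} \<rho>" using \<rho> continuous_on_subset unfolding first_intensity_def by blast
    then have "compact (\<rho> ` {0..1})" by (intro compact_continuous_image) auto
    then have "bdd_above (\<rho> ` {0..1})" by (intro bounded_imp_bdd_above compact_imp_bounded)
    then obtain B where B: "\<And>x. x \<in> {0..1} \<Longrightarrow> \<rho> x \<le> B" unfolding bdd_above_def by blast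
    have "(\<integral>\<^sup>+x\<in>{0..1}. ennreal (\<rho> x) \<partial>lborel) \<le> (\<integral>\<^sup>+x\<in>{0..1::real}. ennreal B \<partial>lborel)"
      by (intro nn_integral_mono) (auto simp: indicator_def intro!: ennreal_leI B)
    also have "\<dots> < \<infinity>" by (simp add: nn_integral_cmult_indicator)
    finally show False using inf by simp
  qed
  interpret K: kernel_system J k w c s
    by unfold_locales (fact sh sr s0 winj kh kr keq c0 kd Jne sq)+
  obtain U V where UV: "U holomorphic_on UNIV" "\<And>x::real. U (of_real x) \<in> \<real>"
     "V holomorphic_on UNIV" "\<And>x::real. V (of_real x) \<in> \<real>"
     "\<And>z. \<not> (U z = 0 \<and> V z = 0)" "\<And>x. wronsk U V 1 0 x > 0" "\<And>x y. pair_kernel U V x y = K.C x y"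
    using K.kernel_is_pair_kernel by blast
  have charUV: "(LINT \<xi>|M. iexp (\<Sum>x\<in>I. v x * rd (F \<xi>) 0 x)) =
      of_real (exp (- (\<Sum>x\<in>I. \<Sum>y\<in>I. v x * v y * pair_kernel U V x y) / 2))" if "finite I" for I v
    unfolding UV(7) K.C_def by (rule charF[OF that])
  have "gaussian_entire M F U V"
    by unfold_locales (fact Fm Fh Freal UV(1-6) charUV)+
  then show ?thesis by blast
qed

lemma sets_finite_cylinder:
  assumes "finite I" "\<And>x. x \<in> I \<Longrightarrow> g x \<in> measurable M borel" "\<And>x. x \<in> I \<Longrightarrow> A x \<in> sets borel"
  shows "{\<xi>\<in>space M. \<forall>x\<in>I. g x \<xi> \<in> A x} \<in> sets M"
  using assms by (auto intro!: sets.sets_Collect_finite_All' simp: pred_def intro: measurable_sets_Collect)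

text \<open>
  Probabilities of complex cylinder sets are those of real ones, because \<open>F\<close> is almost surely real on the
  real line.
\<close>
lemma (in gaussian_entire) cylinder_prob:
  fixes S :: "complex \<Rightarrow> complex" and \<sigma> :: "real \<Rightarrow> real"
  assumes S: "\<And>x::real. S (of_real x) = of_real (\<sigma> x)" and I: "finite I"
    and A: "\<And>x. x \<in> I \<Longrightarrow> A x \<in> sets borel"
  shows "measure M {\<xi>\<in>space M. \<forall>x\<in>I. S (of_real x) * F \<xi> (of_real x) \<in> A x} =
    measure M {\<xi>\<in>space M. \<forall>x\<in>I. \<sigma> x * rd (F \<xi>) 0 x \<in> complex_of_real -` A x}"
proof (rule finite_measure_eq_AE)
  show "AE \<xi> in M. (\<xi> \<in> {\<xi>\<in>space M. \<forall>x\<in>I. S (of_real x) * F \<xi> (of_real x) \<in> A x}) =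
    (\<xi> \<in> {\<xi>\<in>space M. \<forall>x\<in>I. \<sigma> x * rd (F \<xi>) 0 x \<in> complex_of_real -` A x})"
    using F_real
  proof (rule AE_mp, intro AE_I2 impI)
    fix \<xi> assume "\<forall>x::real. F \<xi> (of_real x) \<in> \<real>"
    then have "F \<xi> (of_real x) = of_real (rd (F \<xi>) 0 x)" for x by (simp add: rd_def)
    then show "(\<xi> \<in> {\<xi>\<in>space M. \<forall>x\<in>I. S (of_real x) * F \<xi> (of_real x) \<in> A x}) =
      (\<xi> \<in> {\<xi>\<in>space M. \<forall>x\<in>I. \<sigma> x * rd (F \<xi>) 0 x \<in> complex_of_real -` A x})" by (simp add: S)
  qed
  show "{\<xi>\<in>space M. \<forall>x\<in>I. S (of_real x) * F \<xi> (of_real x) \<in> A x} \<in> sets M"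
    by (rule sets_finite_cylinder[OF I]) (auto intro!: borel_measurable_times F_meas A)
  have "complex_of_real -` A x \<in> sets borel" if "x \<in> I" for x
    using measurable_sets[of complex_of_real borel borel "A x"] A[OF that] by simp
  then show "{\<xi>\<in>space M. \<forall>x\<in>I. \<sigma> x * rd (F \<xi>) 0 x \<in> complex_of_real -` A x} \<in> sets M"
    by (intro sets_finite_cylinder[OF I]) (auto intro!: borel_measurable_times X_meas)
qed

lemma scaled_kernel_imp_same_distribution:
  fixes S :: "complex \<Rightarrow> complex"
  assumes "gaussian_entire M F U V" "gaussian_entire N G U' V'"
    and S: "\<And>x::real. S (of_real x) = complex_of_real (\<sigma> x)"
    and k: "\<And>x y. pair_kernel U' V' x y = \<sigma> x * \<sigma> y * pair_kernel U V x y"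
  shows "same_distribution (Pi\<^sub>M (UNIV :: real set) (\<lambda>_. borel))
           M (\<lambda>\<xi> x. S (of_real x) * F \<xi> (of_real x)) N (\<lambda>\<xi> x. G \<xi> (of_real x))"
proof -
  interpret F: gaussian_entire M F U V by fact
  interpret G: gaussian_entire N G U' V' by fact
  let ?P = "Pi\<^sub>M (UNIV :: real set) (\<lambda>_. borel :: complex measure)"
  let ?X = "\<lambda>\<xi> x::real. S (of_real x) * F \<xi> (of_real x)" and ?Y = "\<lambda>\<xi> x::real. G \<xi> (of_real x)"
  have X: "?X \<in> measurable M ?P"
    by (rule measurable_PiM_single') (auto intro!: borel_measurable_times F.F_meas)
  have Y: "?Y \<in> measurable N ?P"
    by (rule measurable_PiM_single') (auto intro!: G.F_meas)
  have "distr M ?P ?X = distr N ?P ?Y"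
  proof (rule measure_eqI_PiM_infinite)
    show "finite_measure (distr M ?P ?X)"
      using F.prob_space_distr[OF X] by (rule prob_space.finite_measure)
    fix A :: "real \<Rightarrow> complex set" and I :: "real set"
    assume I: "finite I" and A: "\<And>x. x \<in> I \<Longrightarrow> A x \<in> sets borel"
    have emb: "prod_emb UNIV (\<lambda>_. borel) I (Pi\<^sub>E I A) \<in> sets ?P"
      using I A by (intro sets_PiM_I) auto
    have cyl: "f \<in> prod_emb UNIV (\<lambda>_. borel) I (Pi\<^sub>E I A) \<longleftrightarrow> (\<forall>x\<in>I. f x \<in> A x)" for f
      by (auto simp: prod_emb_def PiE_iff)
    have B: "complex_of_real -` A x \<in> sets borel" if "x \<in> I" for x
      using measurable_sets[of complex_of_real borel borel "A x"] A[OF that] by simp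
    have "measure M {\<xi>\<in>space M. \<forall>x\<in>I. \<sigma> x * rd (F \<xi>) 0 x \<in> complex_of_real -` A x} =
          measure N {\<xi>\<in>space N. \<forall>x\<in>I. 1 * rd (G \<xi>) 0 x \<in> complex_of_real -` A x}"
    proof (rule joint_char_uniqueness[OF F.prob_space_axioms G.prob_space_axioms I _ _ _ B])
      fix v :: "real \<Rightarrow> real"
      have "(LINT \<xi>|M. iexp (\<Sum>x\<in>I. (v x * \<sigma> x) * rd (F \<xi>) 0 x)) =
          of_real (exp (- (\<Sum>x\<in>I. \<Sum>y\<in>I. v x * \<sigma> x * (v y * \<sigma> y) * pair_kernel U V x y) / 2))"
        by (rule F.char_F[OF I])
      also have "(\<Sum>x\<in>I. \<Sum>y\<in>I. v x * \<sigma> x * (v y * \<sigma> y) * pair_kernel U V x y) =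
          (\<Sum>x\<in>I. \<Sum>y\<in>I. v x * v y * pair_kernel U' V' x y)"
        unfolding k by (simp add: mult_ac)
      also have "of_real (exp (- \<dots> / 2)) = (LINT \<xi>|N. iexp (\<Sum>x\<in>I. v x * rd (G \<xi>) 0 x))"
        by (rule G.char_F[OF I, symmetric])
      finally show "(LINT \<xi>|M. iexp (\<Sum>x\<in>I. v x * (\<sigma> x * rd (F \<xi>) 0 x))) = (LINT \<xi>|N. iexp (\<Sum>x\<in>I. v x * (1 * rd (G \<xi>) 0 x)))"
        by (simp only: mult.assoc mult_1_left)
    qed (auto intro!: borel_measurable_times F.X_meas G.X_meas)
    then have "measure M {\<xi>\<in>space M. \<forall>x\<in>I. S (of_real x) * F \<xi> (of_real x) \<in> A x} =
        measure N {\<xi>\<in>space N. \<forall>x\<in>I. 1 * G \<xi> (of_real x) \<in> A x}"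
      using F.cylinder_prob[where S = S and \<sigma> = \<sigma>, OF S I A] G.cylinder_prob[where S = "\<lambda>_. 1" and \<sigma> = "\<lambda>_. 1", OF _ I A]
      by simp
    moreover have "?X -` prod_emb UNIV (\<lambda>_. borel) I (Pi\<^sub>E I A) \<inter> space M = {\<xi>\<in>space M. \<forall>x\<in>I. S (of_real x) * F \<xi> (of_real x) \<in> A x}"
      using cyl by auto
    moreover have "?Y -` prod_emb UNIV (\<lambda>_. borel) I (Pi\<^sub>E I A) \<inter> space N = {\<xi>\<in>space N. \<forall>x\<in>I. 1 * G \<xi> (of_real x) \<in> A x}"
      using cyl by auto
    ultimately show "emeasure (distr M ?P ?X) (prod_emb UNIV (\<lambda>_. borel) I (Pi\<^sub>E I A)) =
        emeasure (distr N ?P ?Y) (prod_emb UNIV (\<lambda>_. borel) I (Pi\<^sub>E I A))"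
      by (simp only: emeasure_distr[OF X emb] emeasure_distr[OF Y emb] F.emeasure_eq_measure G.emeasure_eq_measure)
  qed simp_all
  then show ?thesis unfolding same_distribution_def using X Y by blast
qed

theorem theorem1p8:
  fixes M :: "'a measure" and N :: "'b measure"
    and F :: "'a \<Rightarrow> complex \<Rightarrow> complex" and G :: "'b \<Rightarrow> complex \<Rightarrow> complex"
    and \<rho>F \<rho>G :: "real \<Rightarrow> real"
  assumes "de_branges_GAF M F" and "de_branges_GAF N G"
    and "first_intensity M F \<rho>F" and "first_intensity N G \<rho>G"
    and "\<forall>x. \<rho>F x = \<rho>G x"
  shows "(\<exists>S :: complex \<Rightarrow> complex. S holomorphic_on UNIV \<and> (\<forall>z. S z \<noteq> 0) \<and>
            same_distribution (Pi\<^sub>M (UNIV :: real set) (\<lambda>_. borel))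
              M (\<lambda>\<xi> x. S (of_real x) * F \<xi> (of_real x))
              N (\<lambda>\<xi> x. G \<xi> (of_real x))) \<and>
         same_distribution (Pi\<^sub>M (sets (borel :: real measure)) (\<lambda>_. borel))
              M (zero_process F) N (zero_process G)"
proof -
  obtain U V where F: "gaussian_entire M F U V"
    using de_branges_GAF_is_gaussian_entire[OF assms(1,3)] by blast
  obtain U' V' where G: "gaussian_entire N G U' V'"
    using de_branges_GAF_is_gaussian_entire[OF assms(2,4)] by blast
  interpret F: gaussian_entire M F U V by (rule F)
  interpret G: gaussian_entire N G U' V' by (rule G)
  have "sqrt (zero_speed_sq U V x) = sqrt (zero_speed_sq U' V' x)" for x
    using F.first_intensity_eq_speed[OF assms(3), of x] G.first_intensity_eq_speed[OF assms(4), of x] assms(5) by simp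
  then have q: "zero_speed_sq U V x = zero_speed_sq U' V' x" for x by simp
  obtain S \<sigma> where S: "S holomorphic_on UNIV" "\<And>z. S z \<noteq> 0" "\<And>x::real. S (of_real x) = of_real (\<sigma> x)"
    and k: "\<And>x y. pair_kernel U' V' x y = \<sigma> x * \<sigma> y * pair_kernel U V x y"
    using equal_speed_imp_kernel_scaling[OF F.U F.V F.no_common_zero F.W G.U G.V G.no_common_zero G.W q] by blast
  have field: "same_distribution (Pi\<^sub>M (UNIV :: real set) (\<lambda>_. borel))
      M (\<lambda>\<xi> x. S (of_real x) * F \<xi> (of_real x)) N (\<lambda>\<xi> x. G \<xi> (of_real x))"
    by (rule scaled_kernel_imp_same_distribution[OF F G S(3) k])
  have "same_distribution (Pi\<^sub>M (sets (borel :: real measure)) (\<lambda>_. borel))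
      M (zero_process (\<lambda>\<xi> z. S z * F \<xi> z)) N (zero_process G)"
    by (rule same_distribution_zero_process[OF _ _ field]) (auto intro!: holomorphic_on_mult S(1) F.F_hol G.F_hol)
  moreover have "zero_process (\<lambda>\<xi> z. S z * F \<xi> z) = zero_process F"
    by (simp add: zero_process_def zero_count_def real_zeros_def S(2) fun_eq_iff)
  ultimately show ?thesis using S field by auto
qed

end
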